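(* Let $\mathbb{F}\in\{\mathbb{C},\mathbb{R},\mathbb{Q}\}$. For any integer $r\ge 3$, any $0<\varepsilon\le 1$, and any finite set $S\subseteq\mathbb{F}$, there is a constant $C=C(r,\varepsilon,S)$ such that the following holds. Let $f\in\mathbb{F}[x_1,\dots,x_n]$ be a quadratic polynomial all of whose degree-2 coefficients are elements of the set $S$. Let $\xi=(\xi_1,\dots,\xi_n)$ be a sequence of independent Rademacher random variables, and suppose that we have \[\sup_{x\in\mathbb{F}}\Pr\left(f(\xi)=x\right)\ge C\cdot\frac{(\log n)^{r/2}}{n^{1-2/(r+2)}}.\] Then there is a quadratic form $h\in\mathbb{F}[x_1,\dots,x_n]$ of rank strictly less than $r$ such that $f$ and $h$ differ in at most $\varepsilon n^2$ coefficients.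
   Context: A Rademacher random variable takes the values $1$ and $-1$ with probability $1/2$ each. The logarithm is natural. The coefficients of a quadratic polynomial in $x_1,\dots,x_n$ are those of the monomials $x_ix_j$ ($i\le j$; these are the degree-2 coefficients), $x_i$, and $1$. A quadratic form over $\mathbb{F}$ in $n$ variables is a homogeneous quadratic polynomial $h\in\mathbb{F}[x_1,\dots,x_n]$; it has a unique representation $h(x)=x^TQx$ with $Q\in\mathbb{F}^{n\times n}$ symmetric (where $x$ is the column vector with entries $x_1,\dots,x_n$), and the rank of $h$ is defined to be the rank of $Q$ (so $h=0$ has rank $0$).
   Formalization: The number of variables is assumed to satisfy n ≥ 2; for n = 1 we have log n = 0, so the probability hypothesis always holds and the claim fails, e.g. for f = x_1^2 + x_1 + 1 with S = {1}. *)

theory Defs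
  imports
    "HOL-Library.Poly_Mapping"
    "HOL-Probability.Product_PMF"
    "Jordan_Normal_Form.DL_Rank"
begin

text \<open>
  A monomial is a finitely supported map from variable indices to exponents, and a polynomial is a
  finitely supported map from monomials to coefficients.  The polynomial ring in \<open>n\<close> variables
  consists of the polynomials in which only the variables with index in \<open>{..<n}\<close> occur; the
  variable with index \<open>i\<close> is the \<open>x\<^sub>i\<^sub>+\<^sub>1\<close> of the usual numbering.
\<close>

type_synonym 'a mpoly = "(nat \<Rightarrow>\<^sub>0 nat) \<Rightarrow>\<^sub>0 'a"

definition coeff_of :: "'a::zero mpoly \<Rightarrow> (nat \<Rightarrow>\<^sub>0 nat) \<Rightarrow> 'a" where
  "coeff_of p m = Poly_Mapping.lookup p m"

definition monom_degree :: "(nat \<Rightarrow>\<^sub>0 nat) \<Rightarrow> nat" where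
  "monom_degree m = (\<Sum>i\<in>Poly_Mapping.keys m. Poly_Mapping.lookup m i)"

definition mvar :: "nat \<Rightarrow> 'a::zero_neq_one mpoly" where
  "mvar i = Poly_Mapping.single (Poly_Mapping.single i 1) 1"

definition mconst :: "'a::zero \<Rightarrow> 'a mpoly" where
  "mconst c = Poly_Mapping.single 0 c"

definition mpoly_eval :: "'a::comm_semiring_1 mpoly \<Rightarrow> (nat \<Rightarrow> 'a) \<Rightarrow> 'a" where
  "mpoly_eval p x = (\<Sum>m\<in>Poly_Mapping.keys p.
     coeff_of p m * (\<Prod>i\<in>Poly_Mapping.keys m. x i ^ Poly_Mapping.lookup m i))"

definition mpolys :: "nat \<Rightarrow> 'a::zero mpoly set" where
  "mpolys n = {p. \<forall>m\<in>Poly_Mapping.keys p. Poly_Mapping.keys m \<subseteq> {..<n}}"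

text \<open>
  As usual, a quadratic polynomial has degree at most 2, and a homogeneous quadratic polynomial may
  be zero.
\<close>

definition quadratic_polys :: "nat \<Rightarrow> 'a::zero mpoly set" where
  "quadratic_polys n = {p \<in> mpolys n. \<forall>m\<in>Poly_Mapping.keys p. monom_degree m \<le> 2}"

definition quadratic_forms :: "nat \<Rightarrow> 'a::zero mpoly set" where
  "quadratic_forms n = {p \<in> mpolys n. \<forall>m\<in>Poly_Mapping.keys p. monom_degree m = 2}"

definition deg2_coeffs :: "nat \<Rightarrow> 'a::zero mpoly \<Rightarrow> 'a set" where
  "deg2_coeffs n p =
     {coeff_of p (Poly_Mapping.single i 1 + Poly_Mapping.single j 1) | i j. i \<le> j \<and> j < n}"

definition num_diff_coeffs :: "'a::zero mpoly \<Rightarrow> 'a mpoly \<Rightarrow> nat" where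
  "num_diff_coeffs p q = card {m. coeff_of p m \<noteq> coeff_of q m}"

definition matrix_form :: "nat \<Rightarrow> 'a::comm_ring_1 mat \<Rightarrow> 'a mpoly" where
  "matrix_form n Q = (\<Sum>i<n. \<Sum>j<n. mvar i * mconst (Q $$ (i, j)) * mvar j)"

definition represents_form :: "nat \<Rightarrow> 'a::comm_ring_1 mat \<Rightarrow> 'a mpoly \<Rightarrow> bool" where
  "represents_form n Q h \<longleftrightarrow>
     Q \<in> carrier_mat n n \<and> transpose_mat Q = Q \<and> h = matrix_form n Q"

text \<open>The description in the following definition is proper by \<open>ex1_represents_form\<close> below.\<close>

definition form_rank :: "nat \<Rightarrow> 'a::field_char_0 mpoly \<Rightarrow> nat" where
  "form_rank n h = vec_space.rank n (THE Q. represents_form n Q h)"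

lemma single_add_single_eq_iff:
  "Poly_Mapping.single i (1::nat) + Poly_Mapping.single j 1 =
     Poly_Mapping.single a 1 + Poly_Mapping.single b 1 \<longleftrightarrow>
   (i = a \<and> j = b) \<or> (i = b \<and> j = (a::nat))"
  (is "?l = ?r \<longleftrightarrow> _")
proof
  assume *: "?l = ?r"
  have "Poly_Mapping.lookup ?l k = Poly_Mapping.lookup ?r k" for k
    by (simp only: *)
  from this[unfolded lookup_add lookup_single when_def]
  have **: "(if i = k then 1 else 0) + (if j = k then 1 else 0) =
      (if a = k then 1 else 0) + (if b = k then 1 else (0::nat))" for k .
  show "(i = a \<and> j = b) \<or> (i = b \<and> j = a)"
  proof (cases "i = a")
    case True
    have "j = b"
    proof (rule ccontr)
      assume "j \<noteq> b"
      with True show False using **[of j] by simp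
    qed
    with True show ?thesis by simp
  next
    case False
    have "i = b"
    proof (rule ccontr)
      assume "i \<noteq> b"
      with False show False using **[of i] by simp
    qed
    moreover have "j = a"
    proof (rule ccontr)
      assume "j \<noteq> a"
      with False show False using **[of a] by simp
    qed
    ultimately show ?thesis by simp
  qed
qed (auto simp: add.commute)

lemma coeff_of_matrix_form:
  assumes "a < n" "b < n"
  shows "coeff_of (matrix_form n Q) (Poly_Mapping.single a 1 + Poly_Mapping.single b 1) =
    (if a = b then Q $$ (a, a) else Q $$ (a, b) + Q $$ (b, a))"
proof -
  have *: "mvar i * mconst c * mvar j =
      Poly_Mapping.single (Poly_Mapping.single i 1 + Poly_Mapping.single j 1) c"
    for i j and c :: 'a
    by (simp add: mvar_def mconst_def mult_single)
  have "coeff_of (matrix_form n Q) (Poly_Mapping.single a 1 + Poly_Mapping.single b 1) =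
      (\<Sum>i<n. \<Sum>j<n. if (i = a \<and> j = b) \<or> (i = b \<and> j = a) then Q $$ (i, j) else 0)"
    unfolding coeff_of_def matrix_form_def * lookup_sum lookup_single single_add_single_eq_iff
    by (simp add: when_def)
  also have "\<dots> = (\<Sum>i<n. \<Sum>j<n. (if i = a then if j = b then Q $$ (i, j) else 0 else 0) +
      (if i = b then if j = a then if a = b then 0 else Q $$ (i, j) else 0 else 0))"
    by (intro sum.cong refl) auto
  also have "\<dots> = (\<Sum>i<n. (if i = a then Q $$ (i, b) else 0) +
      (if i = b then if a = b then 0 else Q $$ (i, a) else 0))"
    using assms by (intro sum.cong refl) (auto simp: sum.distrib)
  also have "\<dots> = (if a = b then Q $$ (a, a) else Q $$ (a, b) + Q $$ (b, a))"
    using assms by (simp add: sum.distrib)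
  finally show ?thesis .
qed

lemma monom_degree_2D:
  assumes "monom_degree m = 2"
  shows "\<exists>a b. m = Poly_Mapping.single a 1 + Poly_Mapping.single b 1"
proof -
  let ?K = "Poly_Mapping.keys m"
  have eq: "m = (\<Sum>i\<in>?K. Poly_Mapping.single i (Poly_Mapping.lookup m i))"
    by (rule poly_mapping_eqI)
      (auto simp: lookup_sum lookup_single when_def in_keys_iff)
  have sum2: "(\<Sum>i\<in>?K. Poly_Mapping.lookup m i) = 2"
    using assms by (simp add: monom_degree_def)
  have pos: "Poly_Mapping.lookup m i \<ge> 1" if "i \<in> ?K" for i
    using that by (simp add: in_keys_iff)
  have "?K \<noteq> {}" using sum2 by auto
  then obtain a where a: "a \<in> ?K" by blast
  have s: "Poly_Mapping.lookup m a + (\<Sum>i\<in>?K - {a}. Poly_Mapping.lookup m i) = 2"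
    using sum2 a by (simp add: sum.remove)
  show ?thesis
  proof (cases "?K = {a}")
    case True
    then have "Poly_Mapping.lookup m a = 2" using sum2 by simp
    then have "m = Poly_Mapping.single a 2" using eq True by simp
    then show ?thesis by (metis one_add_one single_add)
  next
    case False
    then obtain b where b: "b \<in> ?K - {a}" using a by blast
    have s': "Poly_Mapping.lookup m a + (Poly_Mapping.lookup m b +
        (\<Sum>i\<in>?K - {a} - {b}. Poly_Mapping.lookup m i)) = 2"
      using s b by (subst (asm) sum.remove[of _ b]) auto
    have b': "b \<in> ?K" using b by blast
    have z: "(\<Sum>i\<in>?K - {a} - {b}. Poly_Mapping.lookup m i) = 0"
      and la: "Poly_Mapping.lookup m a = 1" and lb: "Poly_Mapping.lookup m b = 1"
      using s' pos[OF a] pos[OF b'] by linarith+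
    have "\<forall>i\<in>?K - {a} - {b}. Poly_Mapping.lookup m i = 0"
      using z by (simp only: sum_eq_0_iff finite_Diff finite_keys)
    moreover have "Poly_Mapping.lookup m i \<noteq> 0" if "i \<in> ?K" for i
      using pos[OF that] by simp
    ultimately have "?K - {a} - {b} = {}" by blast
    then have "?K = {a, b}" using a b by blast
    moreover have "a \<noteq> b" using b by auto
    ultimately show ?thesis using eq la lb by auto
  qed
qed

lemma coeff_of_outside_quadratic_form:
  assumes "h \<in> quadratic_forms n"
    and "\<nexists>a b. a < n \<and> b < n \<and> m = Poly_Mapping.single a 1 + Poly_Mapping.single b 1"
  shows "coeff_of h m = 0"
proof (rule ccontr)
  assume "coeff_of h m \<noteq> 0"
  then have k: "m \<in> Poly_Mapping.keys h" by (simp add: coeff_of_def in_keys_iff)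
  then have "monom_degree m = 2" and sub: "Poly_Mapping.keys m \<subseteq> {..<n}"
    using assms(1) by (auto simp: quadratic_forms_def mpolys_def)
  then obtain a b where m: "m = Poly_Mapping.single a 1 + Poly_Mapping.single b 1"
    using monom_degree_2D by blast
  then have "a \<in> Poly_Mapping.keys m" "b \<in> Poly_Mapping.keys m"
    by (auto simp: in_keys_iff lookup_add lookup_single when_def)
  with sub m assms(2) show False by blast
qed

lemma matrix_form_in_quadratic_forms: "matrix_form n Q \<in> quadratic_forms n"
proof -
  have "Poly_Mapping.keys m \<subseteq> {..<n} \<and> monom_degree m = 2"
    if "m \<in> Poly_Mapping.keys (matrix_form n Q)" for m
  proof -
    have *: "mvar i * mconst c * mvar j =
        Poly_Mapping.single (Poly_Mapping.single i 1 + Poly_Mapping.single j 1) c"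
      for i j and c :: 'a
      by (simp add: mvar_def mconst_def mult_single)
    have "\<exists>i<n. \<exists>j<n. m = Poly_Mapping.single i 1 + Poly_Mapping.single j 1"
    proof (rule ccontr)
      assume "\<not> ?thesis"
      then have "Poly_Mapping.lookup (matrix_form n Q) m = 0"
        unfolding matrix_form_def * lookup_sum lookup_single
        by (intro sum.neutral ballI) (auto simp: when_def)
      with that show False by (simp add: in_keys_iff)
    qed
    then obtain i j where ij: "i < n" "j < n"
      and m: "m = Poly_Mapping.single i 1 + Poly_Mapping.single j 1" by blast
    have keys: "Poly_Mapping.keys m = {i, j}"
      unfolding m by (auto simp: in_keys_iff lookup_add lookup_single when_def split: if_splits)
    show ?thesis
      using ij keys by (cases "i = j")
        (auto simp: monom_degree_def m lookup_add lookup_single when_def)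
  qed
  then show ?thesis by (auto simp: quadratic_forms_def mpolys_def)
qed

lemma ex1_represents_form:
  fixes h :: "'a::field_char_0 mpoly"
  assumes h: "h \<in> quadratic_forms n"
  shows "\<exists>!Q. represents_form n Q h"
proof (rule ex_ex1I)
  let ?e = "\<lambda>i j. Poly_Mapping.single i 1 + Poly_Mapping.single j (1::nat) :: nat \<Rightarrow>\<^sub>0 nat"
  define Q where
    "Q = mat n n (\<lambda>(i, j). if i = j then coeff_of h (?e i j) else coeff_of h (?e i j) / 2)"
  have "coeff_of h m = coeff_of (matrix_form n Q) m" for m
  proof (cases "\<exists>a b. a < n \<and> b < n \<and> m = ?e a b")
    case True
    then obtain a b where ab: "a < n" "b < n" "m = ?e a b" by blast
    show ?thesis
      unfolding ab(3) coeff_of_matrix_form[OF ab(1,2)]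
      using ab(1,2) by (simp add: Q_def add.commute)
  next
    case False
    then show ?thesis
      using coeff_of_outside_quadratic_form[OF h]
        coeff_of_outside_quadratic_form[OF matrix_form_in_quadratic_forms] by metis
  qed
  then have "h = matrix_form n Q"
    by (intro poly_mapping_eqI) (simp add: coeff_of_def)
  moreover have "transpose_mat Q = Q"
    by (rule eq_matI) (auto simp: Q_def add.commute)
  ultimately show "\<exists>Q. represents_form n Q h"
    by (auto simp: represents_form_def Q_def intro!: exI[of _ Q])
next
  fix Q R
  assume Q: "represents_form n Q h" and R: "represents_form n R h"
  have sym: "M $$ (j, i) = M $$ (i, j)"
    if "represents_form n M h" "i < n" "j < n" for M i j
  proof -
    have "dim_row M = n" "dim_col M = n" and t: "transpose_mat M = M"
      using that(1) by (auto simp: represents_form_def)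
    then have "transpose_mat M $$ (i, j) = M $$ (j, i)"
      using that(2,3) index_transpose_mat(1)[of i M j] by (simp del: index_transpose_mat)
    with t show ?thesis by simp
  qed
  show "Q = R"
  proof (rule eq_matI)
    fix i j assume "i < dim_row R" "j < dim_col R"
    then have ij: "i < n" "j < n" using R by (auto simp: represents_form_def)
    have "matrix_form n Q = matrix_form n R"
      using Q R by (simp add: represents_form_def)
    then have "(if i = j then Q $$ (i, i) else Q $$ (i, j) + Q $$ (j, i)) =
        (if i = j then R $$ (i, i) else R $$ (i, j) + R $$ (j, i))"
      using coeff_of_matrix_form[OF ij, of Q] coeff_of_matrix_form[OF ij, of R] by simp
    then show "Q $$ (i, j) = R $$ (i, j)"
      using sym[OF Q ij] sym[OF R ij] by (auto split: if_splits)
  qed (use Q R in \<open>auto simp: represents_form_def\<close>)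
qed

text \<open>
  The joint law of \<open>n\<close> independent Rademacher variables, with \<open>\<plusminus>1\<close> taken in the field over which the
  polynomials live.  The entries with index \<open>\<ge> n\<close> are set to the dummy value 0.
\<close>

definition rademacher_seq :: "nat \<Rightarrow> (nat \<Rightarrow> 'a::field_char_0) pmf" where
  "rademacher_seq n = Pi_pmf {..<n} 0 (\<lambda>_. pmf_of_set {1, - 1})"

definition max_point_prob :: "nat \<Rightarrow> 'a::field_char_0 mpoly \<Rightarrow> real" where
  "max_point_prob n f =
     (SUP x. measure_pmf.prob (rademacher_seq n) {\<xi>. mpoly_eval f \<xi> = x})"

end

theory Submission
  imports Defs
begin

text \<open>
  Write \<open>A\<close> for the matrix of degree-2 coefficients of \<open>f\<close>.  Bordering a nonsingular \<open>k \<times> k\<close> minor either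
  yields many nonsingular minors of size \<open>k + 1\<close> or shows that \<open>A\<close> agrees, up to few entries, with a
  matrix of rank \<open>k\<close>; since \<open>S\<close> is finite, the latter can be made symmetric.  So if \<open>A\<close> is far from
  rank less than \<open>r\<close>, there are a partition \<open>I, J\<close> of the indices, one nonsingular pattern \<open>P\<close>, and
  linearly many disjoint column tuples in \<open>J\<close>, each with linearly many disjoint row tuples in \<open>I\<close>, on
  which \<open>A\<close> equals \<open>P\<close>.  An additive map to the reals reduces to real \<open>f\<close>.

  Let \<open>\<phi>\<close> be the characteristic function of \<open>f(\<xi>)\<close>.  By Cauchy--Schwarz over the variables in \<open>J\<close>,
  \<open>\<bar>\<phi>(\<theta>)\<bar>\<^sup>2\<close> is at most the mean of a product of \<open>\<bar>cos(\<theta> y\<^sub>j)\<bar>\<close>, where \<open>y\<close> is linear in the variables in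
  \<open>I\<close>.  By the AM-GM inequality a single column tuple suffices, and there \<open>y\<close> is the image under \<open>P\<close> of
  \<open>r\<close> independent simple random walks of length of order \<open>n\<close>.  Counting the lattice points for which
  all \<open>\<theta> y\<^sub>j\<close> lie near multiples of \<open>\<pi>\<close> gives, with \<open>L = sqrt (ln n)\<close>,
  \<open>\<bar>\<phi>(\<theta>)\<bar>\<^sup>2 = O((L \<theta> + L\<^sup>2 / sqrt n + L / (\<theta> n))\<^sup>r)\<close>.  The point probability is at most the average
  of \<open>\<bar>\<phi>\<bar>\<close> against the Fejer kernel over the multiples of \<open>1 / n\<close> up to \<open>N / n\<close>, and
  \<open>N\<close> of order \<open>n\<close> to the power \<open>r / (r + 2)\<close> balances the contributions.
\<close>

section \<open>Nonsingular minors and closeness to low rank\<close>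

text \<open>The partition \<open>I, J\<close> makes the two groups of signs independent, so that all
  terms inside one group drop out of the decoupled estimate. Linearly many blocks are needed on both
  sides: the rows give walks of length of order \<open>n\<close>, the columns give cosines raised to
  a power of order \<open>n\<close>, so that only points with every
  \<open>\<theta> y\<^sub>j\<close> within order \<open>L / sqrt n\<close> of a multiple of
  \<open>\<pi>\<close> count. Since the AM-GM inequality leaves one column tuple at a time, row
  tuples may be chosen separately for each column tuple. Drawing the single pattern \<open>P\<close>
  from a finite set lets all constants depend on \<open>r\<close>, \<open>\<epsilon>\<close> and
  \<open>S\<close> alone.

  The exponent comes from a balance. After taking the square root, the term
  \<open>L \<theta>\<close> averaged over \<open>\<theta> \<le> N / n\<close> contributes
  \<open>(L N / n)^(r / 2)\<close>, while frequency zero contributes \<open>1 / N\<close>. Apart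
  from logarithms they agree at \<open>N = n^(r / (r + 2))\<close>, where
  \<open>1 / N = n^(-(1 - 2 / (r + 2)))\<close>. The term \<open>L / (\<theta> n)\<close> equals
  \<open>L / k\<close> at \<open>\<theta> = k / n\<close>; its power \<open>r / 2\<close> is
  summable over \<open>k\<close> because \<open>r \<ge> 3\<close>.\<close>

definition submat :: "(nat \<Rightarrow> nat \<Rightarrow> 'a) \<Rightarrow> nat \<Rightarrow> (nat \<Rightarrow> nat) \<Rightarrow> (nat \<Rightarrow> nat) \<Rightarrow> 'a mat" where
  "submat A k R T = mat k k (\<lambda>(a, b). A (R a) (T b))"

text \<open>Cramer's rule: these coefficients express the column \<open>v\<close> through the
  columns \<open>T\<close> of the minor, each being minus the cofactor at \<open>(k, b)\<close> in
  the bordered matrix divided by the old determinant. The argument is the restriction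
  \<open>v\<close> of the new column to the rows \<open>R\<close>, not its index, so that for fixed
  \<open>R\<close> and \<open>T\<close> only finitely many values occur when the entries come from a
  finite set.\<close>

definition border_coeff ::
    "(nat \<Rightarrow> nat \<Rightarrow> 'a::field) \<Rightarrow> nat \<Rightarrow> (nat \<Rightarrow> nat) \<Rightarrow> (nat \<Rightarrow> nat) \<Rightarrow> nat \<Rightarrow> (nat \<Rightarrow> 'a) \<Rightarrow> 'a" where
  "border_coeff A k R T b v =
     - ((-1) ^ (k + b) * Determinant.det (mat k k (\<lambda>(a, c).
          let c' = (if c < b then c else Suc c) in if c' = k then v a else A (R a) (T c')))) /
     Determinant.det (submat A k R T)"

text \<open>Laplace expansion along the new row \<open>i\<close>: the last cofactor is the old
  minor, and the others involve column \<open>j\<close> only through its entries in the rows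
  \<open>R\<close>. A vanishing bordered minor therefore determines \<open>A i j\<close> from row
  \<open>i\<close> on \<open>T\<close> and column \<open>j\<close> on \<open>R\<close>.\<close>

lemma det_submat_border:
  assumes "Determinant.det (submat A k R T) \<noteq> (0::'a::field)"
  shows "Determinant.det (submat A (Suc k) (R(k := i)) (T(k := j))) =
    Determinant.det (submat A k R T) *
      (A i j - (\<Sum>b<k. A i (T b) * border_coeff A k R T b (\<lambda>a\<in>{..<k}. A (R a) j)))"
proof -
  let ?M = "submat A (Suc k) (R(k := i)) (T(k := j))"
  let ?D = "Determinant.det (submat A k R T)"
  let ?v = "\<lambda>a\<in>{..<k}. A (R a) j"
  have M: "?M \<in> carrier_mat (Suc k) (Suc k)" by (simp add: submat_def)
  have "mat_delete ?M k k = submat A k R T"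
    by (rule eq_matI) (auto simp: mat_delete_def submat_def)
  then have kk: "cofactor ?M k k = ?D" by (simp add: cofactor_def)
  have kb: "cofactor ?M k b = - (?D * border_coeff A k R T b ?v)" if "b < k" for b
  proof -
    have "mat_delete ?M k b = mat k k (\<lambda>(a, c).
        let c' = (if c < b then c else Suc c) in if c' = k then ?v a else A (R a) (T c'))"
      using that by (intro eq_matI) (auto simp: mat_delete_def submat_def Let_def)
    then show ?thesis using assms by (simp add: cofactor_def border_coeff_def)
  qed
  have "Determinant.det ?M = (\<Sum>b<Suc k. ?M $$ (k, b) * cofactor ?M k b)"
    by (rule laplace_expansion_row[OF M]) simp
  also have "\<dots> = (\<Sum>b<k. ?M $$ (k, b) * cofactor ?M k b) + ?M $$ (k, k) * cofactor ?M k k"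
    by (rule sum.lessThan_Suc)
  also have "?M $$ (k, k) * cofactor ?M k k = A i j * ?D"
    unfolding kk by (simp add: submat_def)
  also have "(\<Sum>b<k. ?M $$ (k, b) * cofactor ?M k b) =
      (\<Sum>b<k. A i (T b) * - (?D * border_coeff A k R T b ?v))"
  proof (rule sum.cong[OF refl])
    fix b assume "b \<in> {..<k}"
    then have b: "b < k" by simp
    show "?M $$ (k, b) * cofactor ?M k b = A i (T b) * - (?D * border_coeff A k R T b ?v)"
      unfolding kb[OF b] using b by (simp add: submat_def)
  qed
  also have "(\<Sum>b<k. A i (T b) * - (?D * border_coeff A k R T b ?v)) + A i j * ?D =
      ?D * (A i j - (\<Sum>b<k. A i (T b) * border_coeff A k R T b ?v))"
    by (simp add: algebra_simps sum_distrib_left sum_negf)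
  finally show ?thesis .
qed

text \<open>A factorization through \<open>k\<close> terms stands for rank at most \<open>k\<close>:
  it comes for free with a \<open>B\<close> built from types, and it yields the rank bound by
  subadditivity. Symmetry is demanded because \<open>B\<close> has to become the matrix of a
  quadratic form.\<close>

definition near_low_rank :: "(nat \<Rightarrow> nat \<Rightarrow> 'a::field) \<Rightarrow> nat \<Rightarrow> nat \<Rightarrow> real \<Rightarrow> bool" where
  "near_low_rank A n k \<epsilon> \<longleftrightarrow> (\<exists>B X W.
     (\<forall>i<n. \<forall>j<n. B i j = B j i \<and> B i j = (\<Sum>b<k. X i b * W b j)) \<and>
     real (card {(i, j). i < n \<and> j < n \<and> A i j \<noteq> B i j}) \<le> \<epsilon> * (real n)\<^sup>2)"

lemma near_low_rank_mono:
  assumes "near_low_rank A n k \<epsilon>" "k \<le> l"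
  shows "near_low_rank A n l \<epsilon>"
proof -
  obtain B X W where B: "\<forall>i<n. \<forall>j<n. B i j = B j i \<and> B i j = (\<Sum>b<k. X i b * W b j)"
    "real (card {(i, j). i < n \<and> j < n \<and> A i j \<noteq> B i j}) \<le> \<epsilon> * (real n)\<^sup>2"
    using assms(1) unfolding near_low_rank_def by blast
  have "(\<Sum>b<k. X i b * W b j) = (\<Sum>b<l. (if b < k then X i b else 0) * W b j)" for i j
    using assms(2) by (intro sum.mono_neutral_cong_left) auto
  then have "\<forall>i<n. \<forall>j<n. B i j = B j i \<and> B i j = (\<Sum>b<l. (if b < k then X i b else 0) * W b j)"
    using B(1) by simp
  then show ?thesis using B(2) unfolding near_low_rank_def
    by (intro exI[of _ B] exI[of _ "\<lambda>i b. if b < k then X i b else 0"] exI[of _ W] conjI)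
qed

abbreviation tuples :: "nat \<Rightarrow> nat \<Rightarrow> (nat \<Rightarrow> nat) set" where
  "tuples k n \<equiv> PiE {..<k} (\<lambda>_. {..<n})"

definition symm_valued :: "'a set \<Rightarrow> nat \<Rightarrow> (nat \<Rightarrow> nat \<Rightarrow> 'a) \<Rightarrow> bool" where
  "symm_valued S n A \<longleftrightarrow> (\<forall>i<n. \<forall>j<n. A i j \<in> S \<and> A i j = A j i)"

text \<open>
  Where bordering the minor \<open>(R, T)\<close> gives determinant zero, \<open>A i j\<close> agrees with \<open>\<beta> (\<tau> i) (\<tau> j)\<close>
  for a finite-valued type \<open>\<tau>\<close>.  As \<open>A\<close> is symmetric, \<open>\<beta>\<close> must be symmetric on the types that occur
  often, so discarding the rare types leaves a symmetric matrix.
\<close>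
lemma near_low_rank_if_few_borders:
  fixes S :: "'a::field set" and \<epsilon> :: real
  assumes "finite S" "\<epsilon> > 0"
  shows "\<exists>\<delta>>0. \<forall>n A R T. symm_valued S n A \<longrightarrow> R \<in> tuples k n \<longrightarrow> T \<in> tuples k n \<longrightarrow>
    Determinant.det (submat A k R T) \<noteq> 0 \<longrightarrow>
    real (card {(i, j). i < n \<and> j < n \<and>
      Determinant.det (submat A (Suc k) (R(k := i)) (T(k := j))) \<noteq> 0}) < \<delta> * (real n)\<^sup>2 \<longrightarrow>
    near_low_rank A n k \<epsilon>"
proof -
  define \<Theta> where "\<Theta> = PiE {..<k} (\<lambda>_. S) \<times> PiE {..<k} (\<lambda>_. S)"
  define t where "t = real (card \<Theta>) + 1"
  \<comment> \<open>Types with fewer than \<open>\<eta> * n\<close> indices cover at most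
    \<open>t * \<eta> * n = \<epsilon> / 4 * n\<close> indices, whose two strips cost
    \<open>\<epsilon> / 2 * n^2\<close> entries; the other half of the budget pays for the pairs
    with a nonzero border. If \<open>\<beta>\<close> were asymmetric on two frequent types, each of
    their at least \<open>\<eta>^2 * n^2\<close> pairs would be such a pair in one of the two
    orders; hence the bound \<open>\<eta>^2 / 2\<close> in \<open>\<delta>\<close>.\<close>
  define \<eta> where "\<eta> = \<epsilon> / (4 * t)"
  define \<delta> where "\<delta> = min (\<eta>\<^sup>2 / 2) (\<epsilon> / 2)"
  have fin: "finite \<Theta>" unfolding \<Theta>_def by (intro finite_cartesian_product finite_PiE) (use assms in auto)
  have t: "t > 0" by (simp add: t_def add.commute add_pos_nonneg)
  then have \<eta>: "\<eta> > 0" using assms by (simp add: \<eta>_def)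
  then have \<delta>: "\<delta> > 0" using assms by (simp add: \<delta>_def)
  have "near_low_rank A n k \<epsilon>"
    if A: "symm_valued S n A" and R: "R \<in> tuples k n" and T: "T \<in> tuples k n"
      and D: "Determinant.det (submat A k R T) \<noteq> 0"
      and few: "real (card {(i, j). i < n \<and> j < n \<and>
        Determinant.det (submat A (Suc k) (R(k := i)) (T(k := j))) \<noteq> 0}) < \<delta> * (real n)\<^sup>2"
    for n A R T
  proof -
    define E where "E = {(i, j). i < n \<and> j < n \<and>
        Determinant.det (submat A (Suc k) (R(k := i)) (T(k := j))) \<noteq> 0}"
    define \<tau> where "\<tau> i = (\<lambda>b\<in>{..<k}. A i (T b), \<lambda>a\<in>{..<k}. A (R a) i)" for i
    define \<beta> where "\<beta> p q = (\<Sum>b<k. fst p b * border_coeff A k R T b (snd q))"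
      for p q :: "(nat \<Rightarrow> 'a) \<times> (nat \<Rightarrow> 'a)"
    have finE: "finite E" by (rule finite_subset[of _ "{..<n} \<times> {..<n}"]) (auto simp: E_def)
    have AB: "A i j = \<beta> (\<tau> i) (\<tau> j)" if "i < n" "j < n" "(i, j) \<notin> E" for i j
    proof -
      have "A i j - (\<Sum>b<k. A i (T b) * border_coeff A k R T b (\<lambda>a\<in>{..<k}. A (R a) j)) = 0"
        using that det_submat_border[OF D, of i j] D by (simp add: E_def)
      then show ?thesis by (simp add: \<beta>_def \<tau>_def)
    qed
    have \<tau>: "\<tau> i \<in> \<Theta>" if "i < n" for i
      using that R T A unfolding \<tau>_def \<Theta>_def symm_valued_def by (auto simp: PiE_iff)
    define cl where "cl p = {i. i < n \<and> \<tau> i = p}" for p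
    define G where "G = {i. i < n \<and> real (card (cl (\<tau> i))) \<ge> \<eta> * real n}"
    define H where "H = {i. i < n \<and> i \<notin> G}"
    have fincl: "finite (cl p)" for p by (simp add: cl_def)
    have "H \<subseteq> (\<Union>p\<in>{p\<in>\<Theta>. real (card (cl p)) \<le> \<eta> * real n}. cl p)"
      using \<tau> by (auto simp: H_def G_def cl_def)
    then have "real (card H) \<le> real (card (\<Union>p\<in>{p\<in>\<Theta>. real (card (cl p)) \<le> \<eta> * real n}. cl p))"
      by (intro of_nat_mono card_mono) (auto simp: fin fincl)
    also have "\<dots> \<le> (\<Sum>p\<in>{p\<in>\<Theta>. real (card (cl p)) \<le> \<eta> * real n}. real (card (cl p)))"
      using of_nat_mono[OF card_UN_le[of "{p\<in>\<Theta>. real (card (cl p)) \<le> \<eta> * real n}" cl], where 'a = real] fin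
      by simp
    also have "\<dots> \<le> (\<Sum>p\<in>{p\<in>\<Theta>. real (card (cl p)) \<le> \<eta> * real n}. \<eta> * real n)"
      by (intro sum_mono) auto
    also have "\<dots> \<le> t * (\<eta> * real n)"
      using card_mono[OF fin, of "{p\<in>\<Theta>. real (card (cl p)) \<le> \<eta> * real n}"] \<eta>
      by (auto simp: t_def intro!: mult_right_mono)
    also have "\<dots> = \<epsilon> / 4 * real n" using t by (simp add: \<eta>_def)
    finally have H: "real (card H) \<le> \<epsilon> / 4 * real n" .
    have sym: "\<beta> (\<tau> i) (\<tau> j) = \<beta> (\<tau> j) (\<tau> i)" if "i \<in> G" "j \<in> G" for i j
    proof (rule ccontr)
      assume ne: "\<beta> (\<tau> i) (\<tau> j) \<noteq> \<beta> (\<tau> j) (\<tau> i)"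
      have "cl (\<tau> i) \<times> cl (\<tau> j) \<subseteq> E \<union> prod.swap ` E"
      proof
        fix x assume "x \<in> cl (\<tau> i) \<times> cl (\<tau> j)"
        then obtain a b where x: "x = (a, b)" "a < n" "b < n" "\<tau> a = \<tau> i" "\<tau> b = \<tau> j"
          by (auto simp: cl_def)
        have "(a, b) \<in> E \<or> (b, a) \<in> E"
          using AB[of a b] AB[of b a] A x ne unfolding symm_valued_def by metis
        then show "x \<in> E \<union> prod.swap ` E" using x(1) by (force simp: image_iff)
      qed
      then have "card (cl (\<tau> i) \<times> cl (\<tau> j)) \<le> card E + card (prod.swap ` E)"
        by (meson card_Un_le card_mono finE finite_UnI finite_imageI le_trans)
      also have "\<dots> \<le> 2 * card E" using card_image_le[OF finE, of prod.swap] by simp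
      finally have "real (card (cl (\<tau> i))) * real (card (cl (\<tau> j))) \<le> 2 * real (card E)"
        by (simp add: card_cartesian_product flip: of_nat_mult)
      moreover have "(\<eta> * real n) * (\<eta> * real n) \<le> real (card (cl (\<tau> i))) * real (card (cl (\<tau> j)))"
        using that \<eta> by (intro mult_mono) (auto simp: G_def)
      moreover have "\<delta> * (real n)\<^sup>2 \<le> \<eta>\<^sup>2 / 2 * (real n)\<^sup>2"
        by (intro mult_right_mono) (auto simp: \<delta>_def)
      moreover have "(\<eta> * real n) * (\<eta> * real n) = \<eta>\<^sup>2 * (real n)\<^sup>2"
        by (simp add: power2_eq_square)
      ultimately show False using few[folded E_def] by linarith
    qed
    define B where "B i j = (if i \<in> G \<and> j \<in> G then \<beta> (\<tau> i) (\<tau> j) else 0)" for i j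
    define X where "X i b = (if i \<in> G then fst (\<tau> i) b else 0)" for i b
    define W where "W b j = (if j \<in> G then border_coeff A k R T b (snd (\<tau> j)) else 0)" for b j
    have 1: "\<forall>i<n. \<forall>j<n. B i j = B j i \<and> B i j = (\<Sum>b<k. X i b * W b j)"
      using sym by (auto simp: B_def \<beta>_def X_def W_def)
    have "{(i, j). i < n \<and> j < n \<and> A i j \<noteq> B i j} \<subseteq> E \<union> (H \<times> {..<n} \<union> {..<n} \<times> H)"
      using AB by (auto simp: B_def H_def)
    then have "card {(i, j). i < n \<and> j < n \<and> A i j \<noteq> B i j} \<le> card (E \<union> (H \<times> {..<n} \<union> {..<n} \<times> H))"
      by (intro card_mono) (auto simp: finE H_def)
    also have "\<dots> \<le> card E + (card (H \<times> {..<n}) + card ({..<n} \<times> H))"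
      by (meson add_left_mono card_Un_le le_trans)
    also have "\<dots> = card E + 2 * (card H * n)" by (simp add: card_cartesian_product)
    finally have "real (card {(i, j). i < n \<and> j < n \<and> A i j \<noteq> B i j}) \<le>
        real (card E + 2 * (card H * n))"
      by (rule of_nat_mono)
    also have "\<dots> = real (card E) + 2 * (real (card H) * real n)" by simp
    also have "\<dots> \<le> \<epsilon> / 2 * (real n)\<^sup>2 + 2 * (\<epsilon> / 4 * real n * real n)"
    proof -
      have "\<delta> * (real n)\<^sup>2 \<le> \<epsilon> / 2 * (real n)\<^sup>2" by (intro mult_right_mono) (auto simp: \<delta>_def)
      then show ?thesis using few H by (intro add_mono mult_left_mono mult_right_mono) (auto simp: E_def)
    qed
    also have "\<dots> = \<epsilon> * (real n)\<^sup>2" by (simp add: power2_eq_square)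
    finally show ?thesis unfolding near_low_rank_def by (intro exI[of _ B] exI[of _ X] exI[of _ W] conjI 1)
  qed
  then show ?thesis using \<delta> by (intro exI[of _ \<delta>] conjI allI impI)
qed

section \<open>Counting nonsingular minors\<close>

definition nonsing_pairs :: "(nat \<Rightarrow> nat \<Rightarrow> 'a::field) \<Rightarrow> nat \<Rightarrow> nat \<Rightarrow> ((nat \<Rightarrow> nat) \<times> (nat \<Rightarrow> nat)) set" where
  "nonsing_pairs A n k =
     {(R, T). R \<in> tuples k n \<and> T \<in> tuples k n \<and> Determinant.det (submat A k R T) \<noteq> 0}"

lemma finite_tuples: "finite (tuples k n)"
  by (simp add: finite_PiE)

lemma finite_nonsing_pairs: "finite (nonsing_pairs A n k)"
  by (rule finite_subset[of _ "tuples k n \<times> tuples k n"]) (auto simp: nonsing_pairs_def finite_tuples)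

lemma tuple_upd_inject:
  assumes "f \<in> tuples k n" "g \<in> tuples k n" "f(k := i) = g(k := j)"
  shows "f = g \<and> i = j"
proof
  show "i = j" using fun_cong[OF assms(3), of k] by simp
  show "f = g"
  proof
    fix x show "f x = g x"
      using fun_cong[OF assms(3), of x] assms(1,2) by (cases "x = k") (auto simp: PiE_def extensional_def)
  qed
qed

lemma tuple_upd: "f \<in> tuples k n \<Longrightarrow> i < n \<Longrightarrow> f(k := i) \<in> tuples (Suc k) n"
  by (auto simp: PiE_iff extensional_def less_Suc_eq)

text \<open>A nonsingular pair of size \<open>k\<close> has at least \<open>\<delta> * n^2\<close>
  nonsingular borders, since otherwise \<open>A\<close> would be near rank \<open>k\<close>;
  bordering is injective in the pair and the two new indices, so the counts multiply. Farness is
  assumed at every level \<open>l < k\<close> because the induction borders at each of them.\<close>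

lemma many_nonsing_pairs:
  fixes S :: "'a::field set" and \<epsilon> :: real
  assumes "finite S" "\<epsilon> > 0"
  shows "\<exists>c>0. \<forall>n A. symm_valued S n A \<longrightarrow> (\<forall>l<k. \<not> near_low_rank A n l \<epsilon>) \<longrightarrow>
    real (card (nonsing_pairs A n k)) \<ge> c * real n ^ (2 * k)"
proof (induction k)
  case 0
  have "nonsing_pairs A n 0 = {(\<lambda>_. undefined, \<lambda>_. undefined)}" for n and A :: "nat \<Rightarrow> nat \<Rightarrow> 'a"
    by (auto simp: nonsing_pairs_def submat_def)
  then show ?case by (intro exI[of _ 1]) simp
next
  case (Suc k)
  then obtain c where c: "c > 0" and IH: "\<And>n A. symm_valued S n A \<Longrightarrow>
      (\<forall>l<k. \<not> near_low_rank A n l \<epsilon>) \<Longrightarrow> real (card (nonsing_pairs A n k)) \<ge> c * real n ^ (2 * k)"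
    by blast
  obtain \<delta> where \<delta>: "\<delta> > 0" and ext: "\<And>n A R T. symm_valued S n A \<Longrightarrow> R \<in> tuples k n \<Longrightarrow>
    T \<in> tuples k n \<Longrightarrow> Determinant.det (submat A k R T) \<noteq> 0 \<Longrightarrow>
    real (card {(i, j). i < n \<and> j < n \<and>
      Determinant.det (submat A (Suc k) (R(k := i)) (T(k := j))) \<noteq> 0}) < \<delta> * (real n)\<^sup>2 \<Longrightarrow>
    near_low_rank A n k \<epsilon>"
    using near_low_rank_if_few_borders[OF assms, of k] by blast
  have "real (card (nonsing_pairs A n (Suc k))) \<ge> c * \<delta> * real n ^ (2 * Suc k)"
    if A: "symm_valued S n A" and far: "\<forall>l<Suc k. \<not> near_low_rank A n l \<epsilon>" for n A
  proof -
    define Ex where "Ex p = {(i, j). i < n \<and> j < n \<and>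
      Determinant.det (submat A (Suc k) ((fst p)(k := i)) ((snd p)(k := j))) \<noteq> 0}"
      for p :: "(nat \<Rightarrow> nat) \<times> (nat \<Rightarrow> nat)"
    define \<Phi> where "\<Phi> x = ((fst (fst x))(k := fst (snd x)), (snd (fst x))(k := snd (snd x)))"
      for x :: "((nat \<Rightarrow> nat) \<times> (nat \<Rightarrow> nat)) \<times> nat \<times> nat"
    have finEx: "finite (Ex p)" for p
      by (rule finite_subset[of _ "{..<n} \<times> {..<n}"]) (auto simp: Ex_def)
    have ge: "real (card (Ex p)) \<ge> \<delta> * (real n)\<^sup>2" if "p \<in> nonsing_pairs A n k" for p
    proof (rule ccontr)
      assume "\<not> real (card (Ex p)) \<ge> \<delta> * (real n)\<^sup>2"
      then have "near_low_rank A n k \<epsilon>"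
        using that by (intro ext[OF A, of "fst p" "snd p"])
          (simp_all add: nonsing_pairs_def Ex_def case_prod_unfold)
      then show False using far by blast
    qed
    have inj: "inj_on \<Phi> (Sigma (nonsing_pairs A n k) Ex)"
    proof (rule inj_onI)
      fix x y assume x: "x \<in> Sigma (nonsing_pairs A n k) Ex" and y: "y \<in> Sigma (nonsing_pairs A n k) Ex"
        and eq: "\<Phi> x = \<Phi> y"
      obtain R T i j where x': "x = ((R, T), (i, j))" by (cases x) auto
      obtain R' T' i' j' where y': "y = ((R', T'), (i', j'))" by (cases y) auto
      have tup: "R \<in> tuples k n" "R' \<in> tuples k n" "T \<in> tuples k n" "T' \<in> tuples k n"
        using x y by (simp_all add: x' y' nonsing_pairs_def)
      have "R(k := i) = R'(k := i')" "T(k := j) = T'(k := j')"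
        using eq by (simp_all add: \<Phi>_def x' y')
      with tuple_upd_inject[OF tup(1,2)] tuple_upd_inject[OF tup(3,4)]
      show "x = y" by (simp add: x' y')
    qed
    have sub: "\<Phi> ` Sigma (nonsing_pairs A n k) Ex \<subseteq> nonsing_pairs A n (Suc k)"
    proof (rule image_subsetI)
      fix x assume x: "x \<in> Sigma (nonsing_pairs A n k) Ex"
      obtain R T i j where x': "x = ((R, T), (i, j))" by (cases x) auto
      show "\<Phi> x \<in> nonsing_pairs A n (Suc k)"
        using x tuple_upd[of R k n i] tuple_upd[of T k n j]
        by (simp add: x' \<Phi>_def nonsing_pairs_def Ex_def del: fun_upd_apply)
    qed
    have "c * \<delta> * real n ^ (2 * Suc k) = (c * real n ^ (2 * k)) * (\<delta> * (real n)\<^sup>2)"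
      by (simp add: power2_eq_square)
    also have "\<dots> \<le> real (card (nonsing_pairs A n k)) * (\<delta> * (real n)\<^sup>2)"
      using IH[OF A] far \<delta> by (intro mult_right_mono) auto
    also have "\<dots> = (\<Sum>p\<in>nonsing_pairs A n k. \<delta> * (real n)\<^sup>2)" by simp
    also have "\<dots> \<le> (\<Sum>p\<in>nonsing_pairs A n k. real (card (Ex p)))" using ge by (intro sum_mono)
    also have "\<dots> = real (card (Sigma (nonsing_pairs A n k) Ex))"
      using card_SigmaI[OF finite_nonsing_pairs[of A n k], of Ex] finEx by simp
    also have "\<dots> \<le> real (card (nonsing_pairs A n (Suc k)))"
      using card_image[OF inj] card_mono[OF finite_nonsing_pairs sub] by simp
    finally show ?thesis .
  qed
  then show ?case using c \<delta> by (intro exI[of _ "c * \<delta>"] conjI allI impI) simp_all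
qed

section \<open>Disjoint blocks of minors\<close>

lemma card_tuples_fixed:
  assumes "a < r"
  shows "card {f \<in> tuples r n. f a = u} \<le> n ^ (r - 1)"
proof -
  have "{f \<in> tuples r n. f a = u} \<subseteq> PiE {..<r} (\<lambda>b. if b = a then {u} else {..<n})"
    by (auto simp: PiE_def Pi_def)
  then have "card {f \<in> tuples r n. f a = u} \<le> card (PiE {..<r} (\<lambda>b. if b = a then {u} else {..<n}))"
    by (intro card_mono finite_PiE) auto
  also have "\<dots> = (\<Prod>b<r. if b = a then 1 else n)"
    by (subst card_PiE) (auto intro!: prod.cong)
  also have "\<dots> = (\<Prod>b\<in>{..<r} - {a}. n)"
    using assms by (subst prod.remove[of _ a]) auto
  also have "\<dots> = n ^ (r - 1)" using assms by simp
  finally show ?thesis .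
qed

lemma card_tuples: "card (tuples r n) = n ^ r"
  by (simp add: card_PiE)

text \<open>A maximal disjoint subfamily \<open>G\<close> occupies at most \<open>r * card G\<close>
  indices, and every tuple of \<open>F\<close> meets one of them. A given value in a given position
  is taken by at most \<open>n^(r - 1)\<close> tuples, so \<open>card F\<close> is at most
  \<open>r * (r * card G) * n^(r - 1)\<close>.\<close>

lemma disjoint_subfamily:
  fixes c :: real
  assumes F: "F \<subseteq> tuples r n" and r: "r > 0" and n: "n > 0" and c: "real (card F) \<ge> c * real n ^ r"
  shows "\<exists>G\<subseteq>F. (\<forall>f\<in>G. \<forall>g\<in>G. f \<noteq> g \<longrightarrow> f ` {..<r} \<inter> g ` {..<r} = {}) \<and>
    (real r)\<^sup>2 * real (card G) \<ge> c * real n"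
proof -
  define \<G> where "\<G> = {G. G \<subseteq> F \<and> (\<forall>f\<in>G. \<forall>g\<in>G. f \<noteq> g \<longrightarrow> f ` {..<r} \<inter> g ` {..<r} = {})}"
  have finF: "finite F" using F finite_tuples finite_subset by blast
  have "finite \<G>" by (rule finite_subset[of _ "Pow F"]) (auto simp: \<G>_def finF)
  moreover have "{} \<in> \<G>" by (auto simp: \<G>_def)
  ultimately obtain G where G: "G \<in> \<G>" and max: "\<And>G'. G' \<in> \<G> \<Longrightarrow> G \<subseteq> G' \<Longrightarrow> G = G'"
    using finite_has_maximal[of \<G>] by blast
  have GF: "G \<subseteq> F" and dis: "\<forall>f\<in>G. \<forall>g\<in>G. f \<noteq> g \<longrightarrow> f ` {..<r} \<inter> g ` {..<r} = {}"
    using G by (auto simp: \<G>_def)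
  have finG: "finite G" using GF finF finite_subset by blast
  define U where "U = (\<Union>f\<in>G. f ` {..<r})"
  have finU: "finite U" using finG by (simp add: U_def)
  have "card U \<le> (\<Sum>f\<in>G. card (f ` {..<r}))" unfolding U_def by (rule card_UN_le[OF finG])
  also have "\<dots> \<le> (\<Sum>f\<in>G. r)"
    by (intro sum_mono) (use card_image_le[of "{..<r}"] in auto)
  finally have U: "card U \<le> r * card G" by (simp add: mult.commute)
  have hit: "f ` {..<r} \<inter> U \<noteq> {}" if f: "f \<in> F" for f
  proof
    assume no: "f ` {..<r} \<inter> U = {}"
    then have "insert f G \<in> \<G>" using G f unfolding \<G>_def U_def by blast
    then have "f \<in> G" using max by blast
    then have "f ` {..<r} \<subseteq> U" by (auto simp: U_def)
    with no r show False by auto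
  qed
  have "F \<subseteq> (\<Union>(a, u)\<in>{..<r} \<times> U. {f \<in> tuples r n. f a = u})"
  proof
    fix f assume f: "f \<in> F"
    obtain a where "a < r" "f a \<in> U" using hit[OF f] by auto
    then show "f \<in> (\<Union>(a, u)\<in>{..<r} \<times> U. {f \<in> tuples r n. f a = u})"
      using f F by (intro UN_I[of "(a, f a)"]) auto
  qed
  then have "card F \<le> card (\<Union>(a, u)\<in>{..<r} \<times> U. {f \<in> tuples r n. f a = u})"
    by (intro card_mono) (auto simp: finU finite_tuples)
  also have "\<dots> \<le> (\<Sum>x\<in>{..<r} \<times> U. card (case x of (a, u) \<Rightarrow> {f \<in> tuples r n. f a = u}))"
    by (rule card_UN_le) (simp add: finU)
  also have "\<dots> \<le> (\<Sum>x\<in>{..<r} \<times> U. n ^ (r - 1))"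
    using card_tuples_fixed by (intro sum_mono) auto
  also have "\<dots> = r * card U * n ^ (r - 1)" by (simp add: card_cartesian_product)
  also have "\<dots> \<le> r * (r * card G) * n ^ (r - 1)" using U by (intro mult_mono) auto
  finally have "real (card F) \<le> real (r * (r * card G) * n ^ (r - 1))" by (rule of_nat_mono)
  then have "c * real n ^ r \<le> (real r)\<^sup>2 * real (card G) * real n ^ (r - 1)"
    using c by (simp add: power2_eq_square mult.assoc)
  moreover have "real n ^ r = real n * real n ^ (r - 1)"
    using r by (metis power_eq_if not_gr_zero)
  ultimately have "(c * real n) * real n ^ (r - 1) \<le> ((real r)\<^sup>2 * real (card G)) * real n ^ (r - 1)"
    by (simp add: mult.assoc)
  then have "c * real n \<le> (real r)\<^sup>2 * real (card G)"
    using n by (subst (asm) mult_le_cancel_right) (auto simp: not_less)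
  then show ?thesis using GF dis by blast
qed

text \<open>Membership is prescribed for at most \<open>2 * r\<close> indices and free for the
  others, so a uniformly random \<open>I\<close> separates \<open>A\<close> from \<open>B\<close>
  with probability at least \<open>4^(-r)\<close>.\<close>

lemma card_separating_sets:
  assumes "A \<subseteq> {..<n}" "B \<subseteq> {..<n}" "A \<inter> B = {}" "card A \<le> r" "card B \<le> r"
  shows "2 ^ n \<le> card {I \<in> Pow {..<n}. A \<subseteq> I \<and> B \<inter> I = {}} * 4 ^ r"
proof -
  let ?D = "{..<n} - (A \<union> B)"
  have fin: "finite A" "finite B" using assms(1,2) finite_subset by blast+
  have cAB: "card (A \<union> B) = card A + card B" using assms(3) fin by (simp add: card_Un_disjoint)
  have "inj_on (\<lambda>V. A \<union> V) (Pow ?D)" by (rule inj_onI) blast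
  then have "card ((\<lambda>V. A \<union> V) ` Pow ?D) = 2 ^ card ?D"
    by (simp add: card_image card_Pow)
  moreover have "(\<lambda>V. A \<union> V) ` Pow ?D \<subseteq> {I \<in> Pow {..<n}. A \<subseteq> I \<and> B \<inter> I = {}}"
    using assms(1-3) by blast
  then have "card ((\<lambda>V. A \<union> V) ` Pow ?D) \<le> card {I \<in> Pow {..<n}. A \<subseteq> I \<and> B \<inter> I = {}}"
    by (intro card_mono) auto
  ultimately have 1: "2 ^ card ?D \<le> card {I \<in> Pow {..<n}. A \<subseteq> I \<and> B \<inter> I = {}}" by simp
  have "card ?D = n - card (A \<union> B)" using assms(1,2) fin by (subst card_Diff_subset) auto
  then have "n \<le> card ?D + 2 * r" using cAB assms(4,5) by linarith
  then have "(2::nat) ^ n \<le> 2 ^ (card ?D + 2 * r)" by (intro power_increasing) auto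
  also have "\<dots> = 2 ^ card ?D * 4 ^ r" by (simp add: power_add power_mult)
  also have "\<dots> \<le> card {I \<in> Pow {..<n}. A \<subseteq> I \<and> B \<inter> I = {}} * 4 ^ r"
    using 1 by (intro mult_right_mono) auto
  finally show ?thesis .
qed

text \<open>By averaging: a uniformly random \<open>I\<close> keeps each pair with probability at
  least \<open>4^(-r)\<close>, so some \<open>I\<close> keeps that proportion of \<open>N\<close>.
  Decoupling needs rows and columns on opposite sides.\<close>

lemma separating_partition:
  assumes N: "finite N"
    and "\<And>R T. (R, T) \<in> N \<Longrightarrow> R \<in> tuples r n \<and> T \<in> tuples r n \<and> R ` {..<r} \<inter> T ` {..<r} = {}"
  shows "\<exists>I\<subseteq>{..<n}. card N \<le> card {(R, T) \<in> N. R ` {..<r} \<subseteq> I \<and> T ` {..<r} \<inter> I = {}} * 4 ^ r"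
proof (rule ccontr)
  let ?N = "\<lambda>I. {p \<in> N. fst p ` {..<r} \<subseteq> I \<and> snd p ` {..<r} \<inter> I = {}}"
  have eq: "{(R, T) \<in> N. R ` {..<r} \<subseteq> I \<and> T ` {..<r} \<inter> I = {}} = ?N I" for I by auto
  assume "\<not> ?thesis"
  then have less: "card (?N I) * 4 ^ r < card N" if "I \<subseteq> {..<n}" for I
    using that by (auto simp: eq not_le)
  have "(\<Sum>I\<in>Pow {..<n}. card (?N I)) = (\<Sum>I\<in>Pow {..<n}. \<Sum>p\<in>N. if p \<in> ?N I then 1 else 0)"
    by (simp add: N sum.If_cases Int_def)
  also have "\<dots> = (\<Sum>p\<in>N. \<Sum>I\<in>Pow {..<n}. if p \<in> ?N I then 1 else 0)" by (rule sum.swap)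
  also have "\<dots> = (\<Sum>p\<in>N. card {I \<in> Pow {..<n}. fst p ` {..<r} \<subseteq> I \<and> snd p ` {..<r} \<inter> I = {}})"
    by (intro sum.cong refl) (auto simp: sum.If_cases Int_def intro!: arg_cong[where f = card])
  finally have eq2: "(\<Sum>I\<in>Pow {..<n}. card (?N I)) * 4 ^ r =
      (\<Sum>p\<in>N. card {I \<in> Pow {..<n}. fst p ` {..<r} \<subseteq> I \<and> snd p ` {..<r} \<inter> I = {}} * 4 ^ r)"
    by (simp add: sum_distrib_right)
  have "card N * 2 ^ n = (\<Sum>p\<in>N. 2 ^ n)" by simp
  also have "\<dots> \<le> (\<Sum>p\<in>N. card {I \<in> Pow {..<n}. fst p ` {..<r} \<subseteq> I \<and> snd p ` {..<r} \<inter> I = {}} * 4 ^ r)"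
  proof (rule sum_mono)
    fix p assume "p \<in> N"
    then have p: "fst p \<in> tuples r n" "snd p \<in> tuples r n" "fst p ` {..<r} \<inter> snd p ` {..<r} = {}"
      using assms(2)[of "fst p" "snd p"] by auto
    then show "2 ^ n \<le> card {I \<in> Pow {..<n}. fst p ` {..<r} \<subseteq> I \<and> snd p ` {..<r} \<inter> I = {}} * 4 ^ r"
      using card_image_le[of "{..<r}"]
      by (intro card_separating_sets) (auto simp: PiE_iff Pi_iff intro: order_trans[OF card_image_le])
  qed
  also have "\<dots> = (\<Sum>I\<in>Pow {..<n}. card (?N I) * 4 ^ r)" by (simp only: eq2[symmetric] sum_distrib_right)
  also have "\<dots> < (\<Sum>I\<in>Pow {..<n}. card N)"
    using less by (intro sum_strict_mono) auto
  also have "\<dots> = card N * 2 ^ n" by (simp add: card_Pow)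
  finally show False by simp
qed

lemma popular_value:
  assumes "finite A" "finite B" "B \<noteq> {}" "f ` A \<subseteq> B"
  shows "\<exists>b\<in>B. card A \<le> card {x \<in> A. f x = b} * card B"
proof (rule ccontr)
  assume "\<not> ?thesis"
  then have less: "card {x \<in> A. f x = b} * card B < card A" if "b \<in> B" for b
    using that by (auto simp: not_le)
  have "card A = (\<Sum>b\<in>B. card {x \<in> A. f x = b})"
    using sum.group[OF assms(1,2,4), of "\<lambda>_. 1::nat"] by simp
  then have "card A * card B = (\<Sum>b\<in>B. card {x \<in> A. f x = b} * card B)"
    by (simp add: sum_distrib_right)
  also have "\<dots> < (\<Sum>b\<in>B. card A)" using less assms by (intro sum_strict_mono) auto
  finally show False by simp
qed

text \<open>A collision is one equation between a row index and a column index, which costs one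
  factor \<open>n\<close> out of \<open>n^(2 * r)\<close>. Colliding pairs cannot be separated by a
  partition and are discarded as negligible.\<close>

lemma card_colliding_pairs:
  "card {(R, T). R \<in> tuples r n \<and> T \<in> tuples r n \<and> R ` {..<r} \<inter> T ` {..<r} \<noteq> {}}
    \<le> r\<^sup>2 * n ^ (r + (r - 1))"
proof -
  let ?C = "\<lambda>x. SIGMA R:tuples r n. {T \<in> tuples r n. T (snd x) = R (fst x)}"
  have "{(R, T). R \<in> tuples r n \<and> T \<in> tuples r n \<and> R ` {..<r} \<inter> T ` {..<r} \<noteq> {}} \<subseteq>
      (\<Union>x\<in>{..<r} \<times> {..<r}. ?C x)"
  proof
    fix p assume "p \<in> {(R, T). R \<in> tuples r n \<and> T \<in> tuples r n \<and> R ` {..<r} \<inter> T ` {..<r} \<noteq> {}}"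
    then obtain R T where p: "p = (R, T)" "R \<in> tuples r n" "T \<in> tuples r n" "R ` {..<r} \<inter> T ` {..<r} \<noteq> {}"
      by (cases p) simp
    then obtain a b where "a < r" "b < r" "R a = T b" by auto
    then show "p \<in> (\<Union>x\<in>{..<r} \<times> {..<r}. ?C x)"
      using p by (intro UN_I[of "(a, b)"]) auto
  qed
  then have "card {(R, T). R \<in> tuples r n \<and> T \<in> tuples r n \<and> R ` {..<r} \<inter> T ` {..<r} \<noteq> {}} \<le>
      card (\<Union>x\<in>{..<r} \<times> {..<r}. ?C x)"
    by (intro card_mono finite_UN_I finite_SigmaI) (auto simp: finite_tuples)
  also have "\<dots> \<le> (\<Sum>x\<in>{..<r} \<times> {..<r}. card (?C x))" by (rule card_UN_le) simp
  also have "\<dots> \<le> (\<Sum>x\<in>{..<r} \<times> {..<r}. n ^ r * n ^ (r - 1))"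
  proof (rule sum_mono)
    fix x assume "x \<in> {..<r} \<times> {..<r}"
    then have "snd x < r" by auto
    have "card (?C x) = (\<Sum>R\<in>tuples r n. card {T \<in> tuples r n. T (snd x) = R (fst x)})"
      by (intro card_SigmaI) (auto simp: finite_tuples)
    also have "\<dots> \<le> (\<Sum>R\<in>tuples r n. n ^ (r - 1))"
      using card_tuples_fixed[OF \<open>snd x < r\<close>] by (intro sum_mono)
    finally show "card (?C x) \<le> n ^ r * n ^ (r - 1)" by (simp add: card_tuples)
  qed
  also have "\<dots> = r\<^sup>2 * n ^ (r + (r - 1))"
    by (simp add: card_cartesian_product power2_eq_square power_add)
  finally show ?thesis .
qed

text \<open>The set \<open>K T a\<close> is meant to hold the \<open>a\<close>-th entries of the
  \<open>q\<close> row tuples attached to \<open>T\<close>. Its variables all have the same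
  coefficients \<open>P a b\<close> against the columns of \<open>T\<close>, so only the sum of
  their signs matters. Sets belonging to different \<open>T\<close> may overlap, as one column tuple
  is used at a time.\<close>

definition block_structure :: "(nat \<Rightarrow> nat \<Rightarrow> 'a) \<Rightarrow> nat \<Rightarrow> nat set \<Rightarrow> nat set \<Rightarrow> (nat \<Rightarrow> nat \<Rightarrow> 'a) \<Rightarrow>
    (nat \<Rightarrow> nat) set \<Rightarrow> ((nat \<Rightarrow> nat) \<Rightarrow> nat \<Rightarrow> nat set) \<Rightarrow> nat \<Rightarrow> bool" where
  "block_structure A r I J P \<T> K q \<longleftrightarrow> finite \<T> \<and>
     (\<forall>T\<in>\<T>. inj_on T {..<r} \<and> T ` {..<r} \<subseteq> J) \<and>
     (\<forall>T\<in>\<T>. \<forall>T'\<in>\<T>. T \<noteq> T' \<longrightarrow> T ` {..<r} \<inter> T' ` {..<r} = {}) \<and>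
     (\<forall>T\<in>\<T>. \<forall>a<r. K T a \<subseteq> I \<and> card (K T a) = q) \<and>
     (\<forall>T\<in>\<T>. \<forall>a<r. \<forall>b<r. a \<noteq> b \<longrightarrow> K T a \<inter> K T b = {}) \<and>
     (\<forall>T\<in>\<T>. \<forall>a<r. \<forall>i\<in>K T a. \<forall>b<r. A i (T b) = P a b)"

abbreviation patterns :: "'a set \<Rightarrow> nat \<Rightarrow> (nat \<Rightarrow> nat \<Rightarrow> 'a) set" where
  "patterns S r \<equiv> PiE {..<r} (\<lambda>_. PiE {..<r} (\<lambda>_. S))"

lemma inj_on_if_det_submat_nonzero:
  assumes "Determinant.det (submat A r R T) \<noteq> (0::'a::field)"
  shows "inj_on R {..<r}" "inj_on T {..<r}"
proof -
  have car: "submat A r R T \<in> carrier_mat r r" by (simp add: submat_def)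
  show "inj_on R {..<r}"
  proof (rule inj_onI, rule ccontr)
    fix a b assume ab: "a \<in> {..<r}" "b \<in> {..<r}" "R a = R b" "a \<noteq> b"
    then have "row (submat A r R T) a = row (submat A r R T) b"
      by (intro eq_vecI) (simp_all add: submat_def)
    then show False using det_identical_rows[OF car ab(4)] ab assms by simp
  qed
  show "inj_on T {..<r}"
  proof (rule inj_onI, rule ccontr)
    fix a b assume ab: "a \<in> {..<r}" "b \<in> {..<r}" "T a = T b" "a \<noteq> b"
    then have "col (submat A r R T) a = col (submat A r R T) b"
      by (intro eq_vecI) (simp_all add: submat_def)
    then show False using det_identical_cols[OF car ab(4)] ab assms by simp
  qed
qed

text \<open>Fibres below the threshold contribute at most half of the guaranteed size of
  \<open>N\<close>, and a fibre has at most \<open>n^r\<close> elements, so the other half needs at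
  least \<open>c / 2 * n^r\<close> populous fibres.\<close>

lemma popular_fibers:
  fixes c :: real
  assumes N: "N \<subseteq> tuples r n \<times> tuples r n" and c: "real (card N) \<ge> c * real n ^ (2 * r)" and "n > 0" and "c \<ge> 0"
  shows "real (card {T \<in> tuples r n. real (card {R. (R, T) \<in> N}) \<ge> c / 2 * real n ^ r}) \<ge> c / 2 * real n ^ r"
proof -
  let ?F = "\<lambda>T. {R. (R, T) \<in> N}"
  let ?good = "{T \<in> tuples r n. real (card (?F T)) \<ge> c / 2 * real n ^ r}"
  have finN: "finite N" using N finite_tuples finite_subset by (metis finite_cartesian_product)
  have Fsub: "?F T \<subseteq> tuples r n" for T using N by auto
  have finF: "finite (?F T)" for T using Fsub finite_tuples finite_subset by metis
  have cF: "card (?F T) \<le> n ^ r" for T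
    using card_mono[OF finite_tuples Fsub, of T] by (simp add: card_tuples)
  have "N = prod.swap ` (SIGMA T:tuples r n. ?F T)" using N by (auto simp: image_iff)
  then have "card N = card (SIGMA T:tuples r n. ?F T)" by (metis card_image inj_swap)
  also have "\<dots> = (\<Sum>T\<in>tuples r n. card (?F T))"
    by (rule card_SigmaI) (auto simp: finite_tuples finF)
  finally have "real (card N) = (\<Sum>T\<in>tuples r n. real (card (?F T)))" by simp
  also have "\<dots> \<le> (\<Sum>T\<in>tuples r n. c / 2 * real n ^ r + (if T \<in> ?good then real n ^ r else 0))"
  proof (rule sum_mono)
    fix T assume T: "T \<in> tuples r n"
    have "real (card (?F T)) \<le> real n ^ r" using of_nat_mono[OF cF[of T], where 'a = real] by simp
    moreover have "0 \<le> c / 2 * real n ^ r" using \<open>c \<ge> 0\<close> by simp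
    ultimately have "real (card (?F T)) \<le> c / 2 * real n ^ r + real n ^ r" by linarith
    moreover have "real (card (?F T)) \<le> c / 2 * real n ^ r" if "T \<notin> ?good"
      using that T by simp
    ultimately show "real (card (?F T)) \<le> c / 2 * real n ^ r + (if T \<in> ?good then real n ^ r else 0)"
    proof (cases "T \<in> ?good")
      case True
      show ?thesis unfolding if_P[OF True] by fact
    next
      case False
      show ?thesis unfolding if_not_P[OF False] add_0_right
        using \<open>T \<notin> ?good \<Longrightarrow> real (card (?F T)) \<le> c / 2 * real n ^ r\<close>[OF False] .
    qed
  qed
  also have "\<dots> = real n ^ r * (c / 2 * real n ^ r) + real (card ?good) * real n ^ r"
    by (simp add: sum.distrib card_tuples sum.If_cases finite_tuples Int_def)
  finally have "c * real n ^ (2 * r) \<le> real n ^ r * (c / 2 * real n ^ r) + real (card ?good) * real n ^ r"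
    using c by linarith
  moreover have "c * real n ^ (2 * r) = 2 * ((c / 2 * real n ^ r) * real n ^ r)"
    by (simp add: power_even_eq power2_eq_square)
  moreover have "real n ^ r * (c / 2 * real n ^ r) = (c / 2 * real n ^ r) * real n ^ r" by simp
  ultimately have "(c / 2 * real n ^ r) * real n ^ r \<le> real (card ?good) * real n ^ r" by linarith
  then show ?thesis using \<open>n > 0\<close> by (subst (asm) mult_le_cancel_right) (auto simp: not_less)
qed

text \<open>Each reduction keeps a constant proportion of the nonsingular pairs: removing
  collisions, fixing the most frequent pattern, fixing a partition. Disjoint subfamilies are then
  extracted twice, among the column tuples with many partners and among the partners of each of
  these.\<close>

lemma block_structure_exists:
  fixes S :: "'a::field set" and \<epsilon> :: real
  assumes S: "finite S" and r: "r > 0" and \<epsilon>: "\<epsilon> > 0"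
  shows "\<exists>c>0. \<exists>n0. \<forall>n\<ge>n0. \<forall>A. symm_valued S n A \<longrightarrow> \<not> near_low_rank A n (r - 1) \<epsilon> \<longrightarrow>
    (\<exists>I\<subseteq>{..<n}. \<exists>P\<in>patterns S r. \<exists>\<T> K q. Determinant.det (mat r r (\<lambda>(a, b). P a b)) \<noteq> 0 \<and>
      block_structure A r I ({..<n} - I) P \<T> K q \<and> real (card \<T>) \<ge> c * real n \<and> real q \<ge> c * real n)"
proof -
  obtain c1 where c1: "c1 > 0" and many: "\<And>n A. symm_valued S n A \<Longrightarrow>
      \<forall>l<r. \<not> near_low_rank A n l \<epsilon> \<Longrightarrow> real (card (nonsing_pairs A n r)) \<ge> c1 * real n ^ (2 * r)"
    using many_nonsing_pairs[OF S \<epsilon>, of r] by blast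
  define p where "p = real (card (patterns S r)) + 1"
  \<comment> \<open>A factor 2 is lost to collisions, \<open>p\<close> to the choice of the pattern
    and \<open>4^r\<close> to the partition; \<open>c\<close> loses a further 2 for the populous
    fibres and \<open>r^2\<close> for disjointness.\<close>
  define c3 where "c3 = c1 / (2 * p * 4 ^ r)"
  define c where "c = c3 / (2 * (real r)\<^sup>2)"
  have p: "p > 0" by (simp add: p_def add.commute add_pos_nonneg)
  have finpat: "finite (patterns S r)" using S by (intro finite_PiE) auto
  have c3: "c3 > 0" using c1 p by (simp add: c3_def)
  then have c: "c > 0" using r by (simp add: c_def)
  \<comment> \<open>For \<open>n \<ge> n0\<close> the at most \<open>r^2 * n^(2 * r - 1)\<close>
    collisions amount to no more than half of \<open>c1 * n^(2 * r)\<close>.\<close>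
  define n0 where "n0 = nat \<lceil>2 * (real r)\<^sup>2 / c1\<rceil> + 1"
  have "\<exists>I\<subseteq>{..<n}. \<exists>P\<in>patterns S r. \<exists>\<T> K q. Determinant.det (mat r r (\<lambda>(a, b). P a b)) \<noteq> 0 \<and>
      block_structure A r I ({..<n} - I) P \<T> K q \<and> real (card \<T>) \<ge> c * real n \<and> real q \<ge> c * real n"
    if n: "n \<ge> n0" and A: "symm_valued S n A" and far: "\<not> near_low_rank A n (r - 1) \<epsilon>" for n A
  proof -
    have n1: "n > 0" using n by (simp add: n0_def)
    have "2 * (real r)\<^sup>2 / c1 \<le> real n" using n unfolding n0_def by linarith
    then have nr: "(real r)\<^sup>2 \<le> c1 / 2 * real n" using c1 by (simp add: field_simps)
    define Col where "Col = {(R, T). R \<in> tuples r n \<and> T \<in> tuples r n \<and> R ` {..<r} \<inter> T ` {..<r} \<noteq> {}}"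
    define N1 where "N1 = nonsing_pairs A n r - Col"
    have "\<forall>l<r. \<not> near_low_rank A n l \<epsilon>"
      using far near_low_rank_mono[of A n _ \<epsilon> "r - 1"] by fastforce
    then have "c1 * real n ^ (2 * r) \<le> real (card (nonsing_pairs A n r))" using many[OF A] by blast
    moreover have finCol: "finite Col"
      by (rule finite_subset[of _ "tuples r n \<times> tuples r n"]) (auto simp: Col_def finite_tuples)
    have "card (nonsing_pairs A n r) \<le> card N1 + card Col"
      unfolding N1_def using diff_card_le_card_Diff[OF finCol, of "nonsing_pairs A n r"] by linarith
    moreover have "real (card Col) \<le> c1 / 2 * real n ^ (2 * r)"
    proof -
      have "real (card Col) \<le> real (r\<^sup>2 * n ^ (r + (r - 1)))"
        unfolding Col_def by (intro of_nat_mono card_colliding_pairs)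
      also have "\<dots> \<le> (c1 / 2 * real n) * real n ^ (r + (r - 1))"
        using mult_right_mono[OF nr, of "real n ^ (r + (r - 1))"] by simp
      also have "real n * real n ^ (r + (r - 1)) = real n ^ (2 * r)"
        using r by (simp add: mult_2 flip: power_Suc)
      then have "(c1 / 2 * real n) * real n ^ (r + (r - 1)) = c1 / 2 * real n ^ (2 * r)"
        by (simp add: mult.assoc)
      finally show ?thesis .
    qed
    moreover have "real (card (nonsing_pairs A n r)) \<le> real (card N1) + real (card Col)"
      using of_nat_mono[OF \<open>card (nonsing_pairs A n r) \<le> card N1 + card Col\<close>, where 'a = real] by simp
    ultimately have N1: "c1 / 2 * real n ^ (2 * r) \<le> real (card N1)" by argo
    have finN1: "finite N1" unfolding N1_def by (rule finite_Diff[OF finite_nonsing_pairs])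
    define pat where "pat x = (\<lambda>a\<in>{..<r}. \<lambda>b\<in>{..<r}. A (fst x a) (snd x b))"
      for x :: "(nat \<Rightarrow> nat) \<times> (nat \<Rightarrow> nat)"
    have pat: "pat ` N1 \<subseteq> patterns S r"
    proof (rule image_subsetI)
      fix x assume "x \<in> N1"
      then have x: "fst x \<in> tuples r n" "snd x \<in> tuples r n"
        by (simp_all add: N1_def nonsing_pairs_def case_prod_unfold)
      have "A (fst x a) (snd x b) \<in> S" if "a < r" "b < r" for a b
      proof -
        have "fst x a < n" "snd x b < n" using x that by (auto simp: PiE_iff)
        then show ?thesis using A by (simp add: symm_valued_def)
      qed
      then show "pat x \<in> patterns S r" by (simp add: pat_def PiE_iff)
    qed
    have "N1 \<noteq> {}"
    proof
      assume "N1 = {}"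
      then have "c1 / 2 * real n ^ (2 * r) \<le> 0" using N1 by simp
      moreover have "c1 / 2 * real n ^ (2 * r) > 0" using c1 n1 by simp
      ultimately show False by linarith
    qed
    then have "patterns S r \<noteq> {}" using pat by blast
    from popular_value[OF finN1 finpat this pat]
    obtain P where P: "P \<in> patterns S r" and cP: "card N1 \<le> card {x \<in> N1. pat x = P} * card (patterns S r)"
      by blast
    define N2 where "N2 = {x \<in> N1. pat x = P}"
    have N2: "real (card N1) \<le> real (card N2) * p"
    proof -
      have "real (card N1) \<le> real (card N2 * card (patterns S r))"
        unfolding N2_def by (intro of_nat_mono cP)
      also have "\<dots> \<le> real (card N2) * p" by (simp add: p_def mult_left_mono)
      finally show ?thesis .
    qed
    have finN2: "finite N2" using finN1 by (simp add: N2_def)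
    have N2D: "R \<in> tuples r n \<and> T \<in> tuples r n \<and> R ` {..<r} \<inter> T ` {..<r} = {}"
      if "(R, T) \<in> N2" for R T
      using that by (auto simp: N2_def N1_def nonsing_pairs_def Col_def)
    obtain I where I: "I \<subseteq> {..<n}" and cI: "card N2 \<le>
        card {(R, T) \<in> N2. R ` {..<r} \<subseteq> I \<and> T ` {..<r} \<inter> I = {}} * 4 ^ r"
      using separating_partition[OF finN2 N2D] by blast
    define N3 where "N3 = {(R, T) \<in> N2. R ` {..<r} \<subseteq> I \<and> T ` {..<r} \<inter> I = {}}"
    have N3D: "R \<in> tuples r n" "T \<in> tuples r n" "R ` {..<r} \<subseteq> I" "T ` {..<r} \<subseteq> {..<n} - I"
      "inj_on R {..<r}" "inj_on T {..<r}" "pat (R, T) = P" "Determinant.det (submat A r R T) \<noteq> 0"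
      if "(R, T) \<in> N3" for R T
    proof -
      have *: "(R, T) \<in> N2" "R ` {..<r} \<subseteq> I" "T ` {..<r} \<inter> I = {}" using that by (auto simp: N3_def)
      then show "pat (R, T) = P" and det: "Determinant.det (submat A r R T) \<noteq> 0"
        by (auto simp: N2_def N1_def nonsing_pairs_def)
      show "inj_on R {..<r}" "inj_on T {..<r}" using inj_on_if_det_submat_nonzero[OF det] by auto
      show "R ` {..<r} \<subseteq> I" using * by simp
      show "R \<in> tuples r n" "T \<in> tuples r n" using N2D[OF *(1)] by auto
      then show "T ` {..<r} \<subseteq> {..<n} - I" using * by (auto simp: PiE_iff)
    qed
    have cN3: "c3 * real n ^ (2 * r) \<le> real (card N3)"
    proof -
      have "real (card N2) \<le> real (card N3 * 4 ^ r)" unfolding N3_def by (intro of_nat_mono cI)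
      then have "c1 / 2 * real n ^ (2 * r) \<le> real (card N3) * 4 ^ r * p"
        using N1 N2 mult_right_mono[of "real (card N2)" "real (card N3 * 4 ^ r)" p] p
        unfolding of_nat_mult of_nat_power of_nat_numeral by linarith
      then show ?thesis using p by (simp add: c3_def field_simps)
    qed
    define F where "F T = {R. (R, T) \<in> N3}" for T
    define \<T>0 where "\<T>0 = {T \<in> tuples r n. real (card (F T)) \<ge> c3 / 2 * real n ^ r}"
    have \<T>0: "\<T>0 \<subseteq> tuples r n" unfolding \<T>0_def by (rule Collect_restrict)
    have "N3 \<subseteq> tuples r n \<times> tuples r n" by (rule subrelI) (intro SigmaI N3D)
    from popular_fibers[OF this cN3 n1] c3 have "c3 / 2 * real n ^ r \<le> real (card \<T>0)"
      by (simp add: \<T>0_def F_def)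
    from disjoint_subfamily[OF \<T>0 r n1 this] obtain \<T> where \<T>: "\<T> \<subseteq> \<T>0"
      and dis: "\<forall>f\<in>\<T>. \<forall>g\<in>\<T>. f \<noteq> g \<longrightarrow> f ` {..<r} \<inter> g ` {..<r} = {}"
      and card\<T>: "c3 / 2 * real n \<le> (real r)\<^sup>2 * real (card \<T>)"
      by blast
    \<comment> \<open>All families of partners are cut down to the same size, so that the walks have
      a common length \<open>q\<close>.\<close>
    define q where "q = nat \<lceil>c * real n\<rceil>"
    have fin\<T>: "finite \<T>" using order.trans[OF \<T> \<T>0] finite_tuples finite_subset by blast
    have "\<exists>G. G \<subseteq> F T \<and> (\<forall>f\<in>G. \<forall>g\<in>G. f \<noteq> g \<longrightarrow> f ` {..<r} \<inter> g ` {..<r} = {}) \<and> card G = q \<and> finite G"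
      if T: "T \<in> \<T>" for T
    proof -
      have F: "F T \<subseteq> tuples r n" unfolding F_def using N3D(1) by blast
      have "T \<in> \<T>0" using T \<T> by blast
      then have "c3 / 2 * real n ^ r \<le> real (card (F T))" by (simp add: \<T>0_def)
      from disjoint_subfamily[OF F r n1 this] obtain G where G: "G \<subseteq> F T"
        and disG: "\<forall>f\<in>G. \<forall>g\<in>G. f \<noteq> g \<longrightarrow> f ` {..<r} \<inter> g ` {..<r} = {}"
        and cG: "c3 / 2 * real n \<le> (real r)\<^sup>2 * real (card G)" by blast
      have "c * real n \<le> real (card G)" using cG r by (simp add: c_def field_simps)
      then have "q \<le> card G" by (simp add: q_def)
      then obtain G' where "G' \<subseteq> G" "card G' = q" "finite G'"
        using obtain_subset_with_card_n by metis
      then show ?thesis using G disG by (intro exI[of _ G']) blast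
    qed
    then obtain G where G: "\<And>T. T \<in> \<T> \<Longrightarrow> G T \<subseteq> F T \<and>
        (\<forall>f\<in>G T. \<forall>g\<in>G T. f \<noteq> g \<longrightarrow> f ` {..<r} \<inter> g ` {..<r} = {}) \<and> card (G T) = q \<and> finite (G T)"
      by metis
    have GN: "(R, T) \<in> N3" if "T \<in> \<T>" "R \<in> G T" for R T
      using conjunct1[OF G[OF that(1)]] that(2) unfolding F_def by blast
    have Gcard: "card (G T) = q" if "T \<in> \<T>" for T using G[OF that] by simp
    have disG: "R = R'" if "T \<in> \<T>" "R \<in> G T" "R' \<in> G T" "a < r" "b < r" "R a = R' b" for R R' T a b
    proof (rule ccontr)
      assume "R \<noteq> R'"
      then have "R ` {..<r} \<inter> R' ` {..<r} = {}"
        using conjunct1[OF conjunct2[OF G[OF that(1)]]] that(2,3) by blast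
      moreover have "R a \<in> R ` {..<r}" using that(4) by blast
      moreover have "R' b \<in> R' ` {..<r}" using that(5) by blast
      ultimately show False using that(6) by auto
    qed
    define K where "K T a = (\<lambda>R. R a) ` G T" for T :: "nat \<Rightarrow> nat" and a
    have qn: "c * real n \<le> real q" unfolding q_def by linarith
    have cn: "c * real n > 0" using c n1 by simp
    have q0: "q > 0" using order.strict_trans2[OF cn qn] by simp
    have ex: "\<exists>R. (R, T) \<in> N3" if "T \<in> \<T>" for T
    proof -
      have "G T \<noteq> {}" using Gcard[OF that] q0 by auto
      then obtain R where "R \<in> G T" by blast
      then show ?thesis using GN[OF that] by blast
    qed
    have bs: "block_structure A r I ({..<n} - I) P \<T> K q"
      unfolding block_structure_def
    proof (intro conjI ballI allI impI)
      show "finite \<T>" by (rule fin\<T>)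
      fix T assume T: "T \<in> \<T>"
      obtain R where RT: "(R, T) \<in> N3" using ex[OF T] by (rule exE)
      show "inj_on T {..<r}" by (rule N3D(6)[OF RT])
      show "T ` {..<r} \<subseteq> {..<n} - I" by (rule N3D(4)[OF RT])
      show "T ` {..<r} \<inter> T' ` {..<r} = {}" if "T' \<in> \<T>" "T \<noteq> T'" for T'
        using dis[rule_format, OF T that] .
      fix a assume a: "a < r"
      show "K T a \<subseteq> I" unfolding K_def
      proof (rule image_subsetI)
        fix R assume "R \<in> G T"
        then show "R a \<in> I" using N3D(3)[OF GN[OF T]] a by blast
      qed
      have "inj_on (\<lambda>R. R a) (G T)" using disG[OF T _ _ a a] by (intro inj_onI)
      then show "card (K T a) = q" using Gcard[OF T] by (simp add: K_def card_image)
      \<comment> \<open>A common index lies in two row tuples, which disjointness forces to be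
        equal; that tuple is injective because its minor is nonsingular.\<close>
      show "K T a \<inter> K T b = {}" if b: "b < r" "a \<noteq> b" for b
      proof (rule ccontr)
        assume "K T a \<inter> K T b \<noteq> {}"
        then obtain R R' where R: "R \<in> G T" "R' \<in> G T" "R a = R' b" by (auto simp: K_def)
        then have "R = R'" using disG[OF T _ _ a b(1)] by blast
        then show False using inj_onD[OF N3D(5)[OF GN[OF T R(1)]], of a b] R(3) a b by simp
      qed
      show "A i (T b) = P a b" if iK: "i \<in> K T a" and b: "b < r" for i b
      proof -
        obtain R where R: "R \<in> G T" "i = R a" using iK unfolding K_def by (rule imageE)
        have "pat (R, T) a b = P a b" using N3D(7)[OF GN[OF T R(1)]] by simp
        then show ?thesis using a b R(2) by (simp add: pat_def)
      qed
    qed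
    have card\<T>': "c * real n \<le> real (card \<T>)" using card\<T> r by (simp add: c_def field_simps)
    have "card \<T> > 0" using order.strict_trans2[OF cn card\<T>'] by simp
    then have "\<T> \<noteq> {}" by auto
    then obtain T where T: "T \<in> \<T>" by (auto simp only: ex_in_conv[symmetric])
    obtain R where RT: "(R, T) \<in> N3" using ex[OF T] by (rule exE)
    have "submat A r R T = mat r r (\<lambda>(a, b). P a b)"
      using N3D(7)[OF RT, symmetric] by (intro eq_matI) (auto simp: submat_def pat_def)
    then have "Determinant.det (mat r r (\<lambda>(a, b). P a b)) \<noteq> 0" using N3D(8)[OF RT] by simp
    then show ?thesis using I P bs card\<T>' qn
      by (intro exI[of _ I] conjI bexI[of _ P] exI[of _ \<T>] exI[of _ K] exI[of _ q])
  qed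
  then show ?thesis using c by (intro exI[of _ c] conjI exI[of _ n0] allI impI)
qed

section \<open>Resonances of a linear image of random walks\<close>

lemma central_binomial_sq: "((2 * m) choose m)\<^sup>2 * (2 * m + 1) \<le> 16 ^ m"
proof (induction m)
  case (Suc m)
  have sym: "(2 * m + 1) choose m = (2 * m + 1) choose (m + 1)"
    using binomial_symmetric[of m "2 * m + 1"] by simp
  then have "(2 * Suc m) choose (Suc m) = 2 * ((2 * m + 1) choose (m + 1))" by simp
  moreover have "Suc m * (Suc (2 * m) choose Suc m) = Suc (2 * m) * ((2 * m) choose m)"
    by (rule Suc_times_binomial)
  ultimately have rec: "Suc m * (2 * Suc m choose Suc m) = 2 * (2 * m + 1) * ((2 * m) choose m)"
    by (simp only: mult.left_commute[of "Suc m" 2] Suc_eq_plus1 mult.assoc)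
  have "(Suc m)\<^sup>2 * ((2 * Suc m choose Suc m)\<^sup>2 * (2 * Suc m + 1)) =
      (Suc m * (2 * Suc m choose Suc m))\<^sup>2 * (2 * m + 3)"
  proof -
    have "2 * Suc m + 1 = 2 * m + 3" by simp
    then show ?thesis by (simp only: power_mult_distrib mult.assoc)
  qed
  also have "\<dots> = (2 * (2 * m + 1) * ((2 * m) choose m))\<^sup>2 * (2 * m + 3)" by (simp only: rec)
  also have "\<dots> = (((2 * m) choose m)\<^sup>2 * (2 * m + 1)) * (4 * (2 * m + 1) * (2 * m + 3))"
    by (simp add: power2_eq_square algebra_simps)
  also have "\<dots> \<le> 16 ^ m * (4 * (2 * m + 1) * (2 * m + 3))"
    using Suc.IH by (rule mult_right_mono) simp
  \<comment> \<open>This is \<open>(2 * m + 1) * (2 * m + 3) \<le> 4 * (m + 1)^2\<close>; the factor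
    \<open>2 * m + 1\<close> in the claim is what makes the induction close.\<close>
  also have "\<dots> \<le> 16 ^ m * (16 * (Suc m)\<^sup>2)"
    by (rule mult_left_mono) (simp_all add: power2_eq_square algebra_simps)
  also have "\<dots> = (Suc m)\<^sup>2 * 16 ^ Suc m" by simp
  finally show ?case by (subst (asm) mult_le_cancel1) auto
qed simp

text \<open>The odd case follows from the next even one, whose central coefficient is exactly twice
  as large.\<close>

lemma central_binomial_sq': "(q choose (q div 2))\<^sup>2 * q \<le> 4 ^ q"
proof (cases "even q")
  case True
  then obtain m where q: "q = 2 * m" by blast
  have "((2 * m) choose m)\<^sup>2 * (2 * m) \<le> ((2 * m) choose m)\<^sup>2 * (2 * m + 1)" by simp
  also have "\<dots> \<le> 16 ^ m" by (rule central_binomial_sq)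
  finally show ?thesis by (simp add: q power_mult)
next
  case False
  then obtain m where q: "q = 2 * m + 1" by (metis oddE)
  have "(2 * m + 1) choose m = (2 * m + 1) choose (m + 1)"
    using binomial_symmetric[of m "2 * m + 1"] by simp
  then have "(2 * Suc m) choose (Suc m) = 2 * ((2 * m + 1) choose m)" by simp
  then have "4 * (((2 * m + 1) choose m)\<^sup>2 * (2 * Suc m + 1)) \<le> 16 ^ Suc m"
    using central_binomial_sq[of "Suc m"] by (simp add: power2_eq_square algebra_simps)
  also have "(16::nat) ^ Suc m = 4 * 4 ^ q" by (simp add: q power_mult)
  finally have "((2 * m + 1) choose m)\<^sup>2 * (2 * Suc m + 1) \<le> 4 ^ q" by simp
  moreover have "((2 * m + 1) choose m)\<^sup>2 * (2 * m + 1) \<le> ((2 * m + 1) choose m)\<^sup>2 * (2 * Suc m + 1)"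
    by (rule mult_left_mono) auto
  ultimately show ?thesis by (simp add: q)
qed

lemma binomial_prob_le_inverse_sqrt:
  assumes "q > 0"
  shows "real (q choose h) / 2 ^ q \<le> 1 / sqrt (real q)"
proof -
  have "(q choose h)\<^sup>2 * q \<le> (q choose (q div 2))\<^sup>2 * q"
    by (intro mult_right_mono power_mono binomial_maximum) auto
  also have "\<dots> \<le> 4 ^ q" by (rule central_binomial_sq')
  finally have "real ((q choose h)\<^sup>2 * q) \<le> real (4 ^ q)" by (rule of_nat_mono)
  moreover have "real ((q choose h)\<^sup>2 * q) = (real (q choose h) * sqrt (real q))\<^sup>2"
    by (simp add: power_mult_distrib)
  moreover have "real (4 ^ q) = (2 ^ q)\<^sup>2"
    by (simp add: power2_eq_square flip: power_mult_distrib)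
  ultimately have "(real (q choose h) * sqrt (real q))\<^sup>2 \<le> (2 ^ q)\<^sup>2" by simp
  then have "real (q choose h) * sqrt (real q) \<le> 2 ^ q" by (rule power2_le_imp_le) simp
  then show ?thesis using assms by (simp add: field_simps)
qed

lemma two_power_fact_le: "2 ^ n * fact n \<le> (fact (2 * n) :: nat)"
proof (induction n)
  case (Suc n)
  have "2 ^ Suc n * fact (Suc n) = (2 * Suc n) * (2 ^ n * fact n :: nat)" by (simp add: algebra_simps)
  also have "\<dots> \<le> (2 * Suc n) * fact (2 * n)" using Suc.IH by (rule mult_left_mono) simp
  also have "\<dots> \<le> (2 * Suc n) * (Suc (2 * n) * fact (2 * n))" by (rule mult_left_mono) auto
  also have "\<dots> = fact (2 * Suc n)" by simp
  finally show ?case .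
qed simp

text \<open>Termwise comparison of the power series. As \<open>cosh\<close> is the moment generating
  function of a Rademacher variable, this is its sub-Gaussian bound.\<close>

lemma cosh_le_exp_sq: "cosh (x::real) \<le> exp (x\<^sup>2 / 2)"
proof -
  have "(\<lambda>n. if even n then x ^ n /\<^sub>R fact n else 0) sums cosh x" by (rule cosh_converges)
  then have 1: "(\<lambda>n. x ^ (2 * n) /\<^sub>R fact (2 * n)) sums cosh x"
    using sums_mono_reindex[of "\<lambda>n. 2 * n" "\<lambda>n. if even n then x ^ n /\<^sub>R fact n else 0" "cosh x"]
    by (simp add: strict_mono_def image_iff) (metis evenE)
  have 2: "(\<lambda>n. (x\<^sup>2 / 2) ^ n /\<^sub>R fact n) sums exp (x\<^sup>2 / 2)" by (rule exp_converges)
  show ?thesis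
  proof (rule sums_le[OF _ 1 2])
    fix n
    have "real (2 ^ n * fact n) \<le> real (fact (2 * n))" by (rule of_nat_mono[OF two_power_fact_le])
    then have "2 ^ n * fact n \<le> (fact (2 * n) :: real)" by simp
    then have "(x\<^sup>2) ^ n / fact (2 * n) \<le> (x\<^sup>2) ^ n / (2 ^ n * fact n)"
      by (intro divide_left_mono) auto
    then show "x ^ (2 * n) /\<^sub>R fact (2 * n) \<le> (x\<^sup>2 / 2) ^ n /\<^sub>R fact n"
      unfolding power_mult[of x 2 n] real_scaleR_def power_divide
      by (simp add: divide_inverse_commute mult_ac)
  qed
qed

text \<open>Chernoff's method for a single point: with weights \<open>exp t\<close> and
  \<open>exp (- t)\<close>, one term of the binomial expansion is at most the whole sum
  \<open>(2 * cosh t)^q\<close>. Bounding points instead of tails suffices, as only polynomially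
  many lattice points will be summed.\<close>

lemma binomial_prob_tail:
  assumes "q > 0"
  shows "real (q choose h) / 2 ^ q \<le> exp (- ((2 * real h - real q)\<^sup>2 / (2 * real q)))"
proof (cases "h \<le> q")
  case True
  define u where "u = 2 * real h - real q"
  \<comment> \<open>The minimizer of \<open>q * t^2 / 2 - t * u\<close>.\<close>
  define t where "t = u / real q"
  have "real (q choose h) * exp (t * u) = real (q choose h) * exp t ^ h * exp (- t) ^ (q - h)"
  proof -
    have "exp t ^ h * exp (- t) ^ (q - h) = exp (real h * t + real (q - h) * (- t))"
      by (simp only: exp_add exp_of_nat_mult)
    also have "real h * t + real (q - h) * (- t) = t * u"
      using True by (simp add: u_def of_nat_diff algebra_simps)
    finally show ?thesis by simp
  qed
  also have "\<dots> \<le> (\<Sum>k\<le>q. real (q choose k) * exp t ^ k * exp (- t) ^ (q - k))"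
    using True by (intro member_le_sum) auto
  also have "\<dots> = (exp t + exp (- t)) ^ q" by (rule binomial_ring[symmetric])
  also have "exp t + exp (- t) = 2 * cosh t" by (simp add: cosh_field_def add_divide_distrib)
  also have "(2 * cosh t) ^ q \<le> (2 * exp (t\<^sup>2 / 2)) ^ q"
    by (intro power_mono mult_left_mono cosh_le_exp_sq) auto
  also have "\<dots> = 2 ^ q * exp (real q * (t\<^sup>2 / 2))"
    by (simp only: power_mult_distrib exp_of_nat_mult)
  finally have "real (q choose h) / 2 ^ q \<le> exp (real q * (t\<^sup>2 / 2)) / exp (t * u)"
    by (simp add: field_simps)
  also have "\<dots> = exp (real q * (t\<^sup>2 / 2) - t * u)" by (simp add: exp_diff)
  also have "real q * (t\<^sup>2 / 2) - t * u = - (u\<^sup>2 / (2 * real q))"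
    using assms by (simp add: t_def power2_eq_square field_simps)
  finally show ?thesis by (simp add: u_def)
qed (simp add: binomial_eq_0)

section \<open>Distance to the multiples of \<open>\<pi>\<close> and resonant points\<close>

lemma sin_ge_half: 
  assumes "0 \<le> y" "y \<le> pi / 2"
  shows "y / 2 \<le> sin y"
proof (cases "y \<le> pi / 3")
  case True
  have "sin 0 - 0 / 2 \<le> sin y - y / 2"
  proof (rule DERIV_nonneg_imp_nondecreasing[OF assms(1)])
    fix x assume x: "0 \<le> x" "x \<le> y"
    have "cos (pi / 3) \<le> cos x" using x True by (intro cos_monotone_0_pi_le) auto
    then have "0 \<le> cos x - 1 / 2" by (simp add: cos_60)
    moreover have "((\<lambda>x. sin x - x / 2) has_real_derivative cos x - 1 / 2) (at x)"
      by (auto intro!: derivative_eq_intros)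
    ultimately show "\<exists>d. ((\<lambda>x. sin x - x / 2) has_real_derivative d) (at x) \<and> 0 \<le> d" by blast
  qed
  then show ?thesis by simp
next
  case False
  \<comment> \<open>Beyond \<open>pi / 3\<close> the sine is at least \<open>4 / 5\<close>, which
    exceeds \<open>pi / 4\<close> and hence \<open>y / 2\<close>.\<close>
  have "sin (pi / 3) \<le> sin y" using assms False by (intro sin_monotone_2pi_le) auto
  moreover have "sin (pi / 3) \<ge> (8::real) / 10"
  proof -
    have "(8 / 5 :: real) \<le> sqrt 3" by (rule real_le_rsqrt) (simp add: power2_eq_square)
    then show ?thesis by (simp add: sin_60)
  qed
  moreover have "pi \<le> 32 / 10" using pi_approx by simp
  ultimately show ?thesis using assms(2) by linarith
qed

text \<open>Subtracting the nearest multiple of \<open>\<pi>\<close> changes the sine at most in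
  sign and leaves an argument of absolute value at most \<open>pi / 2\<close>.\<close>

lemma dist_round_pi_le: "\<bar>t - pi * of_int (round (t / pi))\<bar> \<le> 2 * \<bar>sin t\<bar>"
proof -
  define y where "y = t - pi * of_int (round (t / pi))"
  have "\<bar>of_int (round (t / pi)) - t / pi\<bar> \<le> 1 / 2" by (rule of_int_round_abs_le)
  then have "pi * \<bar>of_int (round (t / pi)) - t / pi\<bar> \<le> pi * (1 / 2)"
    by (intro mult_left_mono) auto
  moreover have "pi * \<bar>of_int (round (t / pi)) - t / pi\<bar> = \<bar>y\<bar>"
  proof -
    have "\<bar>y\<bar> = \<bar>pi * (of_int (round (t / pi)) - t / pi)\<bar>"
      by (simp add: y_def algebra_simps abs_minus_commute)
    then show ?thesis by (simp add: abs_mult)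
  qed
  ultimately have y: "\<bar>y\<bar> \<le> pi / 2" by simp
  have s0: "sin (pi * of_int (round (t / pi))) = 0" by (simp add: sin_zero_iff_int2)
  then have "(cos (pi * of_int (round (t / pi))))\<^sup>2 = 1"
    using sin_cos_squared_add[of "pi * of_int (round (t / pi))"] by simp
  then have c1: "\<bar>cos (pi * of_int (round (t / pi)))\<bar> = 1"
    by (metis abs_power2 abs_square_eq_1 power2_abs)
  have "\<bar>y\<bar> / 2 \<le> sin \<bar>y\<bar>" using y by (intro sin_ge_half) auto
  also have "\<dots> \<le> \<bar>sin y\<bar>" by (simp add: abs_if)
  also have "sin y = sin t * cos (pi * of_int (round (t / pi)))"
    unfolding y_def sin_diff s0 by simp
  also have "\<bar>\<dots>\<bar> = \<bar>sin t\<bar>" by (simp add: abs_mult c1)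
  finally show ?thesis by (simp add: y_def)
qed

lemma card_le_card_image_times:
  assumes "finite A" "\<And>b. b \<in> f ` A \<Longrightarrow> real (card {a \<in> A. f a = b}) \<le> M"
  shows "real (card A) \<le> real (card (f ` A)) * M"
proof -
  have "card A = (\<Sum>b\<in>f ` A. card {a \<in> A. f a = b})"
    using sum.group[OF assms(1) finite_imageI[OF assms(1)] order_refl[of "f ` A"], of "\<lambda>_. 1::nat"] by simp
  then have "real (card A) = (\<Sum>b\<in>f ` A. real (card {a \<in> A. f a = b}))" by simp
  also have "\<dots> \<le> real (card (f ` A)) * M"
    by (intro sum_bounded_above assms(2))
  finally show ?thesis .
qed

lemma card_nat_near_le:
  fixes d :: real
  assumes "d \<ge> 0"
  shows "finite {m::nat. \<bar>real m - real c\<bar> \<le> d}" "real (card {m::nat. \<bar>real m - real c\<bar> \<le> d}) \<le> 2 * d + 1"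
proof -
  have sub: "int ` {m::nat. \<bar>real m - real c\<bar> \<le> d} \<subseteq> {int c - \<lfloor>d\<rfloor>..int c + \<lfloor>d\<rfloor>}"
  proof (rule image_subsetI)
    fix m assume "m \<in> {m::nat. \<bar>real m - real c\<bar> \<le> d}"
    then have "real_of_int \<bar>int m - int c\<bar> \<le> d" by simp
    then have "\<bar>int m - int c\<bar> \<le> \<lfloor>d\<rfloor>" by (simp add: le_floor_iff)
    then show "int m \<in> {int c - \<lfloor>d\<rfloor>..int c + \<lfloor>d\<rfloor>}" by auto
  qed
  show "finite {m::nat. \<bar>real m - real c\<bar> \<le> d}"
    using finite_subset[OF sub] by (metis finite_atLeastAtMost_int finite_imageD inj_on_of_nat)
  have "card {m::nat. \<bar>real m - real c\<bar> \<le> d} = card (int ` {m::nat. \<bar>real m - real c\<bar> \<le> d})"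
    by (simp add: card_image)
  also have "\<dots> \<le> card {int c - \<lfloor>d\<rfloor>..int c + \<lfloor>d\<rfloor>}" using sub by (intro card_mono) auto
  also have "\<dots> = nat (2 * \<lfloor>d\<rfloor> + 1)" by simp
  finally have "real (card {m::nat. \<bar>real m - real c\<bar> \<le> d}) \<le> real (nat (2 * \<lfloor>d\<rfloor> + 1))"
    by (rule of_nat_mono)
  also have "\<dots> = 2 * real_of_int \<lfloor>d\<rfloor> + 1" using assms by simp
  also have "\<dots> \<le> 2 * d + 1" by simp
  finally show "real (card {m::nat. \<bar>real m - real c\<bar> \<le> d}) \<le> 2 * d + 1" .
qed

lemma card_PiE_le_power:
  fixes M :: real
  assumes "\<And>k. k < r \<Longrightarrow> finite (B k) \<and> real (card (B k)) \<le> M" "X \<subseteq> PiE {..<r} B"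
  shows "real (card X) \<le> M ^ r"
proof -
  have "card X \<le> card (PiE {..<r} B)" using assms by (intro card_mono finite_PiE) auto
  then have "real (card X) \<le> real (card (PiE {..<r} B))" by (rule of_nat_mono)
  also have "\<dots> = (\<Prod>k<r. real (card (B k)))" by (simp add: card_PiE)
  also have "\<dots> \<le> (\<Prod>k<r. M)" using assms(1) by (intro prod_mono) auto
  finally show ?thesis by simp
qed

text \<open>The counts of heads \<open>h k\<close> in \<open>q\<close> tosses of coin \<open>k\<close> determine the walk \<open>2 h k - q\<close>.\<close>
definition walk_comb :: "nat \<Rightarrow> nat \<Rightarrow> (nat \<Rightarrow> nat \<Rightarrow> real) \<Rightarrow> (nat \<Rightarrow> real) \<Rightarrow> (nat \<Rightarrow> nat) \<Rightarrow> nat \<Rightarrow> real" where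
  "walk_comb r q P c h b = (\<Sum>k<r. (2 * real (h k) - real q) * P k b) + c b"

text \<open>Quantitative invertibility: \<open>\<kappa>\<close> bounds the inverse of
  \<open>d \<mapsto> d P\<close> on row vectors in the maximum norm. In this form it applies
  directly to the difference of two walks with equal rounding.\<close>

definition inverse_bound :: "nat \<Rightarrow> (nat \<Rightarrow> nat \<Rightarrow> real) \<Rightarrow> real \<Rightarrow> bool" where
  "inverse_bound r P \<kappa> \<longleftrightarrow> \<kappa> \<ge> 0 \<and> (\<forall>d e. (\<forall>b<r. \<bar>\<Sum>a<r. d a * P a b\<bar> \<le> e) \<longrightarrow> (\<forall>a<r. \<bar>d a\<bar> \<le> \<kappa> * e))"

text \<open>
  The points counted are grouped by the integers nearest to \<open>\<theta> y b / \<pi>\<close>: few groups occur as the walk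
  is short, and each is small as \<open>P\<close> is invertible.
\<close>
lemma card_resonant_walks:
  fixes \<theta> \<rho> s \<sigma> \<kappa> :: real and q :: nat and c :: "nat \<Rightarrow> real"
  assumes \<theta>: "\<theta> > 0" and \<rho>: "\<rho> \<ge> 0" and s: "s \<ge> 0" and inv: "inverse_bound r P \<kappa>"
    and P: "\<And>a b. a < r \<Longrightarrow> b < r \<Longrightarrow> \<bar>P a b\<bar> \<le> \<sigma>"
  defines "Good \<equiv> {h \<in> PiE {..<r} (\<lambda>_. {..q}). (\<forall>k<r. \<bar>2 * real (h k) - real q\<bar> \<le> \<rho>) \<and>
    (\<forall>b<r. \<bar>sin (\<theta> * walk_comb r q P c h b)\<bar> \<le> s)}"
  shows "real (card Good) \<le> ((\<theta> * real r * \<sigma> * \<rho> + 2) * (4 * \<kappa> * s / \<theta> + 1)) ^ r"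
proof -
  define t where "t h b = \<theta> * walk_comb r q P c h b" for h b
  define p where "p h = (\<lambda>b\<in>{..<r}. round (t h b / pi))" for h
  have \<kappa>: "\<kappa> \<ge> 0" using inv by (simp add: inverse_bound_def)
  have fin: "finite Good" unfolding Good_def
    by (rule finite_subset[of _ "PiE {..<r} (\<lambda>_. {..q})"]) (auto intro: finite_PiE)
  \<comment> \<open>The walk moves \<open>\<theta> y b\<close> by at most \<open>w\<close> away from
    \<open>\<theta> * c b\<close>, so at most \<open>2 * w / pi + 2\<close> nearest integers occur
    in each coordinate.\<close>
  define w where "w = \<theta> * real r * \<sigma> * \<rho>"
  define B where "B b = {round ((\<theta> * c b - w) / pi)..round ((\<theta> * c b + w) / pi)}" for b
  have w: "w \<ge> 0 \<or> r = 0"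
  proof (cases "r = 0")
    case False
    then have "\<sigma> \<ge> 0" using P[of 0 0] by (simp add: order_trans[OF abs_ge_zero])
    then show ?thesis using \<theta> \<rho> by (simp add: w_def)
  qed simp
  have tb: "\<bar>t h b - \<theta> * c b\<bar> \<le> w" if h: "h \<in> Good" and b: "b < r" for h b
  proof -
    have "\<bar>\<Sum>k<r. (2 * real (h k) - real q) * P k b\<bar> \<le> (\<Sum>k<r. \<bar>(2 * real (h k) - real q) * P k b\<bar>)"
      by (rule sum_abs)
    also have "\<dots> \<le> (\<Sum>k<r. \<rho> * \<sigma>)"
      using h b P \<rho> by (intro sum_mono) (auto simp: Good_def abs_mult intro!: mult_mono)
    finally have "\<theta> * \<bar>\<Sum>k<r. (2 * real (h k) - real q) * P k b\<bar> \<le> \<theta> * (real r * (\<rho> * \<sigma>))"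
      using \<theta> by simp
    moreover have "\<bar>t h b - \<theta> * c b\<bar> = \<theta> * \<bar>\<Sum>k<r. (2 * real (h k) - real q) * P k b\<bar>"
      using \<theta> by (simp add: t_def walk_comb_def distrib_left abs_mult)
    ultimately show ?thesis by (simp add: w_def mult_ac)
  qed
  have im: "p ` Good \<subseteq> PiE {..<r} B"
  proof (rule image_subsetI)
    fix h assume h: "h \<in> Good"
    have "round (t h b / pi) \<in> B b" if "b < r" for b
    proof -
      have "\<theta> * c b - w \<le> t h b" "t h b \<le> \<theta> * c b + w" using tb[OF h that] by linarith+
      then show ?thesis unfolding B_def by (auto intro!: round_mono divide_right_mono)
    qed
    then show "p h \<in> PiE {..<r} B" by (simp add: p_def PiE_iff)
  qed
  have cB: "finite (B b) \<and> real (card (B b)) \<le> w + 2" if "b < r" for b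
  proof -
    let ?lo = "(\<theta> * c b - w) / pi" and ?hi = "(\<theta> * c b + w) / pi"
    have w0: "w \<ge> 0" using w that by auto
    then have "?lo \<le> ?hi" by (intro divide_right_mono) auto
    then have le: "round ?lo \<le> round ?hi" by (rule round_mono)
    have "real (card (B b)) = real_of_int (round ?hi) - real_of_int (round ?lo) + 1"
      using le by (simp add: B_def)
    also have "\<dots> \<le> (?hi + 1 / 2) - (?lo - 1 / 2) + 1"
      using of_int_round_le[of ?hi] of_int_round_ge[of ?lo] by linarith
    also have "\<dots> = (2 / pi) * w + 2" by (simp add: field_simps)
    also have "\<dots> \<le> 1 * w + 2" using pi_ge_two w0 by (intro add_right_mono mult_right_mono) auto
    finally show ?thesis by (simp add: B_def)
  qed
  have c1: "real (card (p ` Good)) \<le> (w + 2) ^ r" by (rule card_PiE_le_power[OF cB im])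
  have c2: "real (card {h \<in> Good. p h = g}) \<le> (4 * \<kappa> * s / \<theta> + 1) ^ r" if g: "g \<in> p ` Good" for g
  proof -
    obtain h0 where h0: "h0 \<in> Good" "g = p h0" using g by blast
    have near: "\<bar>real (h a) - real (h0 a)\<bar> \<le> 2 * \<kappa> * s / \<theta>"
      if h: "h \<in> Good" "p h = p h0" and a: "a < r" for h a
    proof -
      have "\<bar>\<Sum>a<r. (real (h a) - real (h0 a)) * P a b\<bar> \<le> 2 * s / \<theta>" if b: "b < r" for b
      proof -
        have "round (t h b / pi) = round (t h0 b / pi)"
          using fun_cong[OF h(2), of b] b by (simp add: p_def)
        then have "\<bar>t h b - pi * of_int (round (t h0 b / pi))\<bar> \<le> 2 * s"
          using dist_round_pi_le[of "t h b"] h(1) b by (fastforce simp: Good_def t_def)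
        moreover have "\<bar>t h0 b - pi * of_int (round (t h0 b / pi))\<bar> \<le> 2 * s"
          using dist_round_pi_le[of "t h0 b"] h0(1) b by (fastforce simp: Good_def t_def)
        \<comment> \<open>Both values are within \<open>2 * s\<close> of the same multiple of
          \<open>\<pi>\<close>. The walks are \<open>2 h - q\<close>, so the difference of the head
          counts enters with the factor \<open>2 * \<theta>\<close>, and its image under
          \<open>P\<close> is at most \<open>2 * s / \<theta>\<close>.\<close>
        ultimately have "\<bar>t h b - t h0 b\<bar> \<le> 4 * s" by linarith
        moreover have "t h b - t h0 b = 2 * \<theta> * (\<Sum>a<r. (real (h a) - real (h0 a)) * P a b)"
          by (simp add: t_def walk_comb_def sum_distrib_left algebra_simps sum_subtractf[symmetric] sum.distrib[symmetric])
        ultimately have "2 * \<theta> * \<bar>\<Sum>a<r. (real (h a) - real (h0 a)) * P a b\<bar> \<le> 4 * s"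
          using \<theta> by (simp add: abs_mult)
        then show ?thesis using \<theta> by (simp add: field_simps)
      qed
      then have "\<bar>real (h a) - real (h0 a)\<bar> \<le> \<kappa> * (2 * s / \<theta>)"
        using inv[unfolded inverse_bound_def] a
        by (auto dest!: spec[of _ "\<lambda>a. real (h a) - real (h0 a)"] spec[of _ "2 * s / \<theta>"])
      then show ?thesis by (simp add: mult_ac)
    qed
    have d: "2 * \<kappa> * s / \<theta> \<ge> 0" using \<kappa> s \<theta> by simp
    have "{h \<in> Good. p h = g} \<subseteq> PiE {..<r} (\<lambda>a. {m::nat. \<bar>real m - real (h0 a)\<bar> \<le> 2 * \<kappa> * s / \<theta>})"
    proof
      fix h assume "h \<in> {h \<in> Good. p h = g}"
      then have h: "h \<in> Good" "p h = p h0" using h0 by auto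
      then have "h \<in> extensional {..<r}" by (simp add: Good_def PiE_iff)
      then show "h \<in> PiE {..<r} (\<lambda>a. {m::nat. \<bar>real m - real (h0 a)\<bar> \<le> 2 * \<kappa> * s / \<theta>})"
        using near[OF h] by (simp add: PiE_iff)
    qed
    from card_PiE_le_power[OF _ this, of "2 * (2 * \<kappa> * s / \<theta>) + 1"]
    show ?thesis using card_nat_near_le[OF d] by (simp add: mult.assoc)
  qed
  have "real (card Good) \<le> real (card (p ` Good)) * (4 * \<kappa> * s / \<theta> + 1) ^ r"
    by (rule card_le_card_image_times[OF fin c2])
  also have "\<dots> \<le> (w + 2) ^ r * (4 * \<kappa> * s / \<theta> + 1) ^ r"
    using c1 \<kappa> s \<theta> by (intro mult_right_mono) auto
  finally show ?thesis by (simp add: power_mult_distrib w_def)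
qed

section \<open>Expected cosine weights of random walks\<close>

lemma abs_cos_le_exp: "\<bar>cos (x::real)\<bar> \<le> exp (- ((sin x)\<^sup>2 / 2))"
proof (rule power2_le_imp_le)
  have "\<bar>cos x\<bar>\<^sup>2 = 1 + - (sin x)\<^sup>2" by (simp add: cos_squared_eq)
  also have "\<dots> \<le> exp (- (sin x)\<^sup>2)" by (rule exp_ge_add_one_self)
  also have "\<dots> = (exp (- ((sin x)\<^sup>2 / 2)))\<^sup>2" by (simp add: power2_eq_square flip: exp_add)
  finally show "\<bar>cos x\<bar>\<^sup>2 \<le> (exp (- ((sin x)\<^sup>2 / 2)))\<^sup>2" .
qed simp

text \<open>The exponent \<open>m\<close> will be the number of column tuples, introduced by the
  AM-GM inequality. With \<open>m\<close> of order \<open>n\<close>, the weight is negligible unless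
  every \<open>\<theta> * y b\<close> is within order \<open>sqrt (ln n / n)\<close> of a multiple
  of \<open>\<pi>\<close>.\<close>

definition cos_weight :: "real \<Rightarrow> nat \<Rightarrow> nat \<Rightarrow> (nat \<Rightarrow> real) \<Rightarrow> real" where
  "cos_weight \<theta> r m y = (\<Prod>b<r. \<bar>cos (\<theta> * y b)\<bar> ^ m)"

lemma cos_weight_nonneg: "cos_weight \<theta> r m y \<ge> 0"
  by (simp add: cos_weight_def prod_nonneg)

lemma cos_weight_le_1: "cos_weight \<theta> r m y \<le> 1"
  unfolding cos_weight_def by (intro prod_le_1) (auto intro: power_le_one)

lemma cos_weight_le_exp:
  assumes "b < r" "\<bar>sin (\<theta> * y b)\<bar> \<ge> s" "s \<ge> 0"
  shows "cos_weight \<theta> r m y \<le> exp (- (s\<^sup>2 * real m / 2))"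
proof -
  have "cos_weight \<theta> r m y = \<bar>cos (\<theta> * y b)\<bar> ^ m * (\<Prod>b\<in>{..<r} - {b}. \<bar>cos (\<theta> * y b)\<bar> ^ m)"
    unfolding cos_weight_def using assms(1) by (subst prod.remove[of _ b]) auto
  also have "\<dots> \<le> \<bar>cos (\<theta> * y b)\<bar> ^ m"
    by (intro mult_left_le prod_le_1) (auto intro: power_le_one)
  also have "\<dots> \<le> exp (- ((sin (\<theta> * y b))\<^sup>2 / 2)) ^ m" by (intro power_mono abs_cos_le_exp) auto
  also have "\<dots> \<le> exp (- (s\<^sup>2 / 2)) ^ m"
  proof (rule power_mono)
    have "s\<^sup>2 \<le> (sin (\<theta> * y b))\<^sup>2" using assms(2,3) by (metis abs_of_nonneg abs_le_square_iff)
    then show "exp (- ((sin (\<theta> * y b))\<^sup>2 / 2)) \<le> exp (- (s\<^sup>2 / 2))" by simp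
  qed simp
  also have "\<dots> = exp (- (s\<^sup>2 * real m / 2))" by (simp add: mult.commute flip: exp_of_nat_mult)
  finally show ?thesis .
qed

text \<open>A point \<open>h\<close> with a walk longer than \<open>\<rho>\<close> has probability
  at most \<open>\<delta>\<close>, and one with a sine above \<open>s\<close> has weight at most
  \<open>\<delta>\<close>; there are \<open>(q + 1)^r\<close> points in all. Each remaining point
  has probability at most \<open>q^(- r / 2)\<close>, and their number is bounded by the count of
  resonant walks.\<close>

lemma sum_binomial_cos_weight_le:
  fixes \<theta> \<rho> s \<sigma> \<kappa> \<delta> :: real
  assumes \<theta>: "\<theta> > 0" and \<rho>: "\<rho> \<ge> 0" and s: "s \<ge> 0" and inv: "inverse_bound r P \<kappa>"
    and P: "\<And>a b. a < r \<Longrightarrow> b < r \<Longrightarrow> \<bar>P a b\<bar> \<le> \<sigma>" and q: "q > 0"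
    and \<delta>1: "exp (- (\<rho>\<^sup>2 / (2 * real q))) \<le> \<delta>" and \<delta>2: "exp (- (s\<^sup>2 * real m / 2)) \<le> \<delta>"
  shows "(\<Sum>h\<in>PiE {..<r} (\<lambda>_. {..q}). (\<Prod>k<r. real (q choose h k) / 2 ^ q) * cos_weight \<theta> r m (walk_comb r q P c h))
    \<le> 2 * (real q + 1) ^ r * \<delta> + ((\<theta> * real r * \<sigma> * \<rho> + 2) * (4 * \<kappa> * s / \<theta> + 1) / sqrt (real q)) ^ r"
proof -
  let ?H = "PiE {..<r} (\<lambda>_. {..q})"
  define Good where "Good = {h \<in> ?H. (\<forall>k<r. \<bar>2 * real (h k) - real q\<bar> \<le> \<rho>) \<and>
    (\<forall>b<r. \<bar>sin (\<theta> * walk_comb r q P c h b)\<bar> \<le> s)}"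
  define w where "w h = (\<Prod>k<r. real (q choose h k) / 2 ^ q)" for h :: "nat \<Rightarrow> nat"
  have \<delta>: "\<delta> \<ge> 0" using \<delta>1 exp_ge_zero order_trans by blast
  have finH: "finite ?H" by (intro finite_PiE) auto
  have p1: "real (q choose j) / 2 ^ q \<le> 1" for j
    using binomial_prob_le_inverse_sqrt[OF q, of j] q by (simp add: order_trans[of _ "1 / sqrt (real q)"])
  have w0: "w h \<ge> 0" for h by (simp add: w_def prod_nonneg)
  have w1: "w h \<le> 1" for h unfolding w_def using p1 by (intro prod_le_1) auto
  have pt: "w h * cos_weight \<theta> r m (walk_comb r q P c h) \<le> 2 * \<delta> + (if h \<in> Good then (1 / sqrt (real q)) ^ r else 0)"
    if h: "h \<in> ?H" for h
  proof (cases "h \<in> Good")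
    case True
    have "w h * cos_weight \<theta> r m (walk_comb r q P c h) \<le> w h"
      using cos_weight_le_1 w0 by (intro mult_left_le) auto
    also have "\<dots> \<le> (\<Prod>k<r. 1 / sqrt (real q))"
      unfolding w_def using binomial_prob_le_inverse_sqrt[OF q] by (intro prod_mono) auto
    finally show ?thesis using True \<delta> by simp
  next
    case False
    then consider k where "k < r" "\<bar>2 * real (h k) - real q\<bar> > \<rho>"
      | b where "b < r" "\<bar>sin (\<theta> * walk_comb r q P c h b)\<bar> > s"
      using h unfolding Good_def by (auto simp: not_le)
    then have "w h * cos_weight \<theta> r m (walk_comb r q P c h) \<le> \<delta>"
    proof cases
      case (1 k)
      have "w h * cos_weight \<theta> r m (walk_comb r q P c h) \<le> w h"
        using cos_weight_le_1 w0 by (intro mult_left_le) auto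
      also have "\<dots> = real (q choose h k) / 2 ^ q * (\<Prod>k\<in>{..<r} - {k}. real (q choose h k) / 2 ^ q)"
        unfolding w_def using 1 by (subst prod.remove[of _ k]) auto
      also have "\<dots> \<le> real (q choose h k) / 2 ^ q"
        using p1 by (intro mult_left_le prod_le_1) auto
      also have "\<dots> \<le> exp (- ((2 * real (h k) - real q)\<^sup>2 / (2 * real q)))"
        by (rule binomial_prob_tail[OF q])
      also have "\<dots> \<le> exp (- (\<rho>\<^sup>2 / (2 * real q)))"
      proof -
        have "\<rho>\<^sup>2 \<le> (2 * real (h k) - real q)\<^sup>2"
          using 1(2) \<rho> by (metis abs_of_nonneg abs_le_square_iff less_imp_le)
        then show ?thesis by (simp add: divide_right_mono)
      qed
      also have "\<dots> \<le> \<delta>" by (rule \<delta>1)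
      finally show ?thesis .
    next
      case (2 b)
      have "w h * cos_weight \<theta> r m (walk_comb r q P c h) \<le> cos_weight \<theta> r m (walk_comb r q P c h)"
        using w1 cos_weight_nonneg by (intro mult_left_le_one_le w0) auto
      also have "\<dots> \<le> exp (- (s\<^sup>2 * real m / 2))"
        using 2 s by (intro cos_weight_le_exp[of b]) auto
      also have "\<dots> \<le> \<delta>" by (rule \<delta>2)
      finally show ?thesis .
    qed
    then show ?thesis using False \<delta> by simp
  qed
  have "(\<Sum>h\<in>?H. w h * cos_weight \<theta> r m (walk_comb r q P c h)) \<le>
      (\<Sum>h\<in>?H. 2 * \<delta> + (if h \<in> Good then (1 / sqrt (real q)) ^ r else 0))"
    using pt by (rule sum_mono)
  also have "\<dots> = real (card ?H) * (2 * \<delta>) + real (card Good) * (1 / sqrt (real q)) ^ r"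
  proof -
    have "?H \<inter> {h. h \<in> Good} = Good" by (auto simp: Good_def)
    then show ?thesis by (simp add: sum.distrib sum.If_cases[OF finH])
  qed
  also have "card ?H = (q + 1) ^ r" by (simp add: card_PiE)
  also have "real ((q + 1) ^ r) * (2 * \<delta>) = 2 * (real q + 1) ^ r * \<delta>" by (simp add: add.commute)
  also have "real (card Good) * (1 / sqrt (real q)) ^ r \<le>
      ((\<theta> * real r * \<sigma> * \<rho> + 2) * (4 * \<kappa> * s / \<theta> + 1)) ^ r * (1 / sqrt (real q)) ^ r"
    using card_resonant_walks[OF \<theta> \<rho> s inv P, where q = q and c = c] by (intro mult_right_mono) (simp_all add: Good_def)
  also have "\<dots> = ((\<theta> * real r * \<sigma> * \<rho> + 2) * (4 * \<kappa> * s / \<theta> + 1) / sqrt (real q)) ^ r"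
    by (simp add: power_mult_distrib power_divide)
  finally show ?thesis by (simp add: w_def)
qed

section \<open>From head counts back to sign patterns\<close>

definition sgn_in :: "'a set \<Rightarrow> 'a \<Rightarrow> real" where
  "sgn_in V i = (if i \<in> V then 1 else - 1)"

lemma sum_Pow_Un:
  assumes "finite A" "finite B" "A \<inter> B = {}"
  shows "(\<Sum>V\<in>Pow (A \<union> B). f V) = (\<Sum>X\<in>Pow A. \<Sum>Y\<in>Pow B. f (X \<union> Y))"
proof -
  have "(\<Sum>X\<in>Pow A. \<Sum>Y\<in>Pow B. f (X \<union> Y)) = (\<Sum>(X, Y)\<in>Pow A \<times> Pow B. f (X \<union> Y))"
    by (rule sum.cartesian_product)
  also have "\<dots> = (\<Sum>V\<in>Pow (A \<union> B). f V)"
    by (rule sum.reindex_bij_witness[of _ "\<lambda>V. (V \<inter> A, V \<inter> B)" "\<lambda>(X, Y). X \<union> Y"])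
      (use assms(3) in auto)
  finally show ?thesis ..
qed

lemma card_sections_le:
  fixes r q :: nat and h :: "nat \<Rightarrow> nat"
  assumes fin: "\<And>k. k < r \<Longrightarrow> finite (K k) \<and> card (K k) = q"
  shows "card {W \<in> Pow (\<Union>k<r. K k). \<forall>k<r. card (W \<inter> K k) = h k} \<le> (\<Prod>k<r. q choose h k)"
proof -
  let ?W = "{W \<in> Pow (\<Union>k<r. K k). \<forall>k<r. card (W \<inter> K k) = h k}"
  let ?f = "\<lambda>W. \<lambda>k\<in>{..<r}. W \<inter> K k"
  let ?B = "\<lambda>k. {X. X \<subseteq> K k \<and> card X = h k}"
  have "inj_on ?f ?W"
  proof (rule inj_onI)
    fix W W' assume W: "W \<in> ?W" "W' \<in> ?W" and eq: "?f W = ?f W'"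
    have *: "W \<inter> K k = W' \<inter> K k" if "k < r" for k using fun_cong[OF eq, of k] that by simp
    have "W = (\<Union>k<r. W \<inter> K k)" using W(1) by blast
    also have "\<dots> = (\<Union>k<r. W' \<inter> K k)" using * by (intro SUP_cong) auto
    also have "\<dots> = W'" using W(2) by blast
    finally show "W = W'" .
  qed
  then have "card ?W = card (?f ` ?W)" by (simp add: card_image)
  also have "\<dots> \<le> card (PiE {..<r} ?B)"
  proof (rule card_mono)
    show "finite (PiE {..<r} ?B)"
    proof (rule finite_PiE)
      fix k assume "k \<in> {..<r}"
      then have "finite (Pow (K k))" using fin by simp
      then show "finite (?B k)" by (rule rev_finite_subset) auto
    qed (rule finite_lessThan)
    show "?f ` ?W \<subseteq> PiE {..<r} ?B" by (auto simp: PiE_iff)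
  qed
  also have "\<dots> = (\<Prod>k<r. card (?B k))" by (simp add: card_PiE)
  also have "\<dots> = (\<Prod>k<r. q choose h k)" using fin by (intro prod.cong) (auto simp: n_subsets)
  finally show ?thesis .
qed

lemma sum_sgn_in:
  assumes "finite K" "W \<subseteq> D" "K \<subseteq> D"
  shows "(\<Sum>i\<in>K. sgn_in W i) = 2 * real (card (W \<inter> K)) - real (card K)"
proof -
  have "(\<Sum>i\<in>K. sgn_in W i) = (\<Sum>i\<in>K. 2 * (if i \<in> W then 1 else 0) - 1)"
    by (intro sum.cong) (auto simp: sgn_in_def)
  also have "\<dots> = 2 * (\<Sum>i\<in>K. if i \<in> W then 1 else 0) - real (card K)"
    by (simp add: sum_subtractf sum_distrib_left)
  also have "(\<Sum>i\<in>K. if i \<in> W then 1 else 0) = real (card (W \<inter> K))"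
    using assms(1) by (simp add: sum.If_cases Int_commute Int_def conj_commute)
  finally show ?thesis .
qed

text \<open>The signs outside the blocks only shift the linear forms by a constant, which is why
  \<open>M\<close> has to bound the walk sum for every shift \<open>c\<close>. Inside block
  \<open>k\<close> only the number of positive signs matters, and a vector \<open>h\<close> of such
  numbers arises from at most the product of the \<open>q choose h k\<close> sign patterns.\<close>

lemma sum_Pow_cos_weight_le:
  fixes a :: "'i \<Rightarrow> nat \<Rightarrow> real"
  assumes I: "finite I" and K: "\<And>k. k < r \<Longrightarrow> K k \<subseteq> I \<and> card (K k) = q"
    and dis: "\<And>k l. k < r \<Longrightarrow> l < r \<Longrightarrow> k \<noteq> l \<Longrightarrow> K k \<inter> K l = {}"
    and a: "\<And>k b i. k < r \<Longrightarrow> b < r \<Longrightarrow> i \<in> K k \<Longrightarrow> a i b = P k b"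
    and M: "\<And>c. (\<Sum>h\<in>PiE {..<r} (\<lambda>_. {..q}). (\<Prod>k<r. real (q choose h k) / 2 ^ q) *
      cos_weight \<theta> r m (walk_comb r q P c h)) \<le> M"
  shows "(\<Sum>V\<in>Pow I. cos_weight \<theta> r m (\<lambda>b. (\<Sum>i\<in>I. sgn_in V i * a i b) + c b)) \<le> 2 ^ card I * M"
proof -
  define D where "D = (\<Union>k<r. K k)"
  define I0 where "I0 = I - D"
  have DI: "D \<subseteq> I" using K by (auto simp: D_def)
  have Ieq: "I = I0 \<union> D" and disID: "I0 \<inter> D = {}" using DI by (auto simp: I0_def)
  have finK: "finite (K k) \<and> card (K k) = q" if "k < r" for k
    using K[OF that] I finite_subset by blast
  have finD: "finite D" and finI0: "finite I0" using DI I finite_subset by (auto simp: I0_def)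
  have cD: "card D = r * q"
    unfolding D_def by (subst card_UN_disjoint) (use finK dis in auto)
  have inner: "(\<Sum>W\<in>Pow D. cos_weight \<theta> r m (\<lambda>b. (\<Sum>i\<in>I. sgn_in (V \<union> W) i * a i b) + c b)) \<le> 2 ^ card D * M"
    if V: "V \<subseteq> I0" for V
  proof -
    define c' where "c' b = (\<Sum>i\<in>I0. sgn_in V i * a i b) + c b" for b
    define hd where "hd W = (\<lambda>k\<in>{..<r}. card (W \<inter> K k))" for W
    have y: "cos_weight \<theta> r m (\<lambda>b. (\<Sum>i\<in>I. sgn_in (V \<union> W) i * a i b) + c b) =
        cos_weight \<theta> r m (walk_comb r q P c' (hd W))" if W: "W \<subseteq> D" for W
    proof -
      have "(\<Sum>i\<in>I. sgn_in (V \<union> W) i * a i b) + c b = walk_comb r q P c' (hd W) b" if b: "b < r" for b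
      proof -
        have "(\<Sum>i\<in>I. sgn_in (V \<union> W) i * a i b) =
            (\<Sum>i\<in>I0. sgn_in (V \<union> W) i * a i b) + (\<Sum>i\<in>D. sgn_in (V \<union> W) i * a i b)"
          unfolding Ieq by (rule sum.union_disjoint[OF finI0 finD disID])
        also have "(\<Sum>i\<in>I0. sgn_in (V \<union> W) i * a i b) = (\<Sum>i\<in>I0. sgn_in V i * a i b)"
          using W disID by (intro sum.cong) (auto simp: sgn_in_def)
        also have "(\<Sum>i\<in>D. sgn_in (V \<union> W) i * a i b) = (\<Sum>i\<in>D. sgn_in W i * a i b)"
          using V disID by (intro sum.cong) (auto simp: sgn_in_def)
        also have "\<dots> = (\<Sum>k<r. \<Sum>i\<in>K k. sgn_in W i * a i b)"
          unfolding D_def by (rule sum.UNION_disjoint) (use finK dis in auto)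
        also have "\<dots> = (\<Sum>k<r. (2 * real (hd W k) - real q) * P k b)"
        proof (rule sum.cong[OF refl])
          fix k assume "k \<in> {..<r}"
          then have k: "k < r" by simp
          have "(\<Sum>i\<in>K k. sgn_in W i * a i b) = (\<Sum>i\<in>K k. sgn_in W i) * P k b"
            using a[OF k b] by (simp add: sum_distrib_right)
          also have "(\<Sum>i\<in>K k. sgn_in W i) = 2 * real (card (W \<inter> K k)) - real (card (K k))"
            using k finK W by (intro sum_sgn_in[of _ _ D]) (auto simp: D_def)
          finally show "(\<Sum>i\<in>K k. sgn_in W i * a i b) = (2 * real (hd W k) - real q) * P k b"
            using k finK by (simp add: hd_def)
        qed
        finally show ?thesis by (simp add: walk_comb_def c'_def)
      qed
      then show ?thesis unfolding cos_weight_def by (intro prod.cong) auto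
    qed
    let ?H = "PiE {..<r} (\<lambda>_. {..q})"
    let ?G = "\<lambda>h. cos_weight \<theta> r m (walk_comb r q P c' h)"
    have finH: "finite ?H" by (intro finite_PiE) auto
    have hdH: "hd ` Pow D \<subseteq> ?H"
    proof (rule image_subsetI)
      fix W assume "W \<in> Pow D"
      have "card (W \<inter> K k) \<le> q" if "k < r" for k
        using card_mono[of "K k" "W \<inter> K k"] finK[OF that] by auto
      then show "hd W \<in> ?H" by (simp add: hd_def PiE_iff)
    qed
    have "(\<Sum>W\<in>Pow D. cos_weight \<theta> r m (\<lambda>b. (\<Sum>i\<in>I. sgn_in (V \<union> W) i * a i b) + c b)) =
        (\<Sum>W\<in>Pow D. ?G (hd W))" using y by (intro sum.cong) auto
    also have "\<dots> = (\<Sum>h\<in>?H. \<Sum>W\<in>{W \<in> Pow D. hd W = h}. ?G (hd W))"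
      using finD by (intro sum.group[OF _ finH hdH, symmetric]) simp
    also have "\<dots> = (\<Sum>h\<in>?H. real (card {W \<in> Pow D. hd W = h}) * ?G h)"
      by (intro sum.cong refl) simp
    also have "\<dots> \<le> (\<Sum>h\<in>?H. (\<Prod>k<r. real (q choose h k)) * ?G h)"
    proof (rule sum_mono)
      fix h assume h: "h \<in> ?H"
      have "{W \<in> Pow D. hd W = h} \<subseteq> {W \<in> Pow (\<Union>k<r. K k). \<forall>k<r. card (W \<inter> K k) = h k}"
        by (auto simp: hd_def D_def)
      then have "card {W \<in> Pow D. hd W = h} \<le> card {W \<in> Pow (\<Union>k<r. K k). \<forall>k<r. card (W \<inter> K k) = h k}"
        using finD by (intro card_mono) (auto simp: D_def)
      also have "\<dots> \<le> (\<Prod>k<r. q choose h k)" using finK by (rule card_sections_le)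
      finally have "real (card {W \<in> Pow D. hd W = h}) \<le> real (\<Prod>k<r. q choose h k)" by (rule of_nat_mono)
      then show "real (card {W \<in> Pow D. hd W = h}) * ?G h \<le> (\<Prod>k<r. real (q choose h k)) * ?G h"
        using cos_weight_nonneg by (intro mult_right_mono) auto
    qed
    also have "\<dots> = 2 ^ card D * (\<Sum>h\<in>?H. (\<Prod>k<r. real (q choose h k) / 2 ^ q) * ?G h)"
      by (simp add: cD prod_dividef sum_distrib_left power_mult mult.commute[of r q])
    also have "\<dots> \<le> 2 ^ card D * M" using M by (intro mult_left_mono) auto
    finally show ?thesis .
  qed
  have "(\<Sum>V\<in>Pow I. cos_weight \<theta> r m (\<lambda>b. (\<Sum>i\<in>I. sgn_in V i * a i b) + c b)) =
      (\<Sum>V\<in>Pow (I0 \<union> D). cos_weight \<theta> r m (\<lambda>b. (\<Sum>i\<in>I. sgn_in V i * a i b) + c b))"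
    using Ieq by simp
  also have "\<dots> = (\<Sum>V\<in>Pow I0. \<Sum>W\<in>Pow D. cos_weight \<theta> r m (\<lambda>b. (\<Sum>i\<in>I. sgn_in (V \<union> W) i * a i b) + c b))"
    by (rule sum_Pow_Un[OF finI0 finD disID])
  also have "\<dots> \<le> (\<Sum>V\<in>Pow I0. 2 ^ card D * M)" using inner by (intro sum_mono) auto
  also have "\<dots> = 2 ^ card I0 * (2 ^ card D * M)" using finI0 by (simp add: card_Pow)
  also have "\<dots> = 2 ^ card I * M"
    using card_Un_disjoint[OF finI0 finD disID] Ieq by (simp add: power_add)
  finally show ?thesis .
qed

text \<open>Up to constants this is
  \<open>(\<theta> * \<rho> + 1) * (s / \<theta> + 1) / sqrt n\<close> multiplied out, for walks of
  size \<open>\<rho>\<close> of order \<open>sqrt (n * ln n)\<close> and a sine threshold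
  \<open>s\<close> of order \<open>sqrt (ln n / n)\<close>. The fourth term
  \<open>1 / sqrt n\<close> of the product is absorbed by the middle one.\<close>

definition decay :: "nat \<Rightarrow> real \<Rightarrow> real" where
  "decay n \<theta> = sqrt (ln (real n)) * \<theta> + ln (real n) / sqrt (real n) + sqrt (ln (real n)) / (\<theta> * real n)"

lemma ln_ge_half: "n \<ge> 2 \<Longrightarrow> ln (real n) \<ge> 1 / 2"
proof -
  assume "n \<ge> 2"
  have "(1 / 2 :: real) \<le> ln 2" using ln2_ge_two_thirds by simp
  also have "\<dots> \<le> ln (real n)" using \<open>n \<ge> 2\<close> by simp
  finally show ?thesis .
qed

lemma sum_binomial_cos_weight_le_decay:
  fixes c \<kappa> \<sigma> :: real
  assumes c: "c > 0" and \<kappa>: "\<kappa> \<ge> 0" and \<sigma>: "\<sigma> \<ge> 0"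
  shows "\<exists>C>0. \<forall>n q m \<theta> P y. n \<ge> 2 \<longrightarrow> c * real n \<le> real q \<longrightarrow> c * real n \<le> real m \<longrightarrow> q \<le> n \<longrightarrow>
    \<theta> > 0 \<longrightarrow> inverse_bound r P \<kappa> \<longrightarrow> (\<forall>a<r. \<forall>b<r. \<bar>P a b\<bar> \<le> \<sigma>) \<longrightarrow>
    (\<Sum>h\<in>PiE {..<r} (\<lambda>_. {..q}). (\<Prod>k<r. real (q choose h k) / 2 ^ q) *
      cos_weight \<theta> r m (walk_comb r q P y h)) \<le> C * decay n \<theta> ^ r"
proof -
  define R where "R = sqrt (real r)"
  define e where "e = 1 / sqrt c"
  \<comment> \<open>The coefficients of the four terms of the product once it is multiplied out;
    \<open>e\<close> converts \<open>q\<close> and \<open>m\<close> to multiples of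
    \<open>n\<close>.\<close>
  define D where "D = 16 * real r * real r * \<sigma> * \<kappa> * e + 2 * real r * \<sigma> * R + 16 * \<kappa> * R * e\<^sup>2 + 4 * e"
  have e: "e > 0" using c by (simp add: e_def)
  have R: "R \<ge> 0" by (simp add: R_def)
  have D: "D \<ge> 0" using \<sigma> \<kappa> e R by (simp add: D_def)
  have "(\<Sum>h\<in>PiE {..<r} (\<lambda>_. {..q}). (\<Prod>k<r. real (q choose h k) / 2 ^ q) *
      cos_weight \<theta> r m (walk_comb r q P y h)) \<le> (2 * 4 ^ r + D ^ r) * decay n \<theta> ^ r"
    if n: "n \<ge> 2" and q: "c * real n \<le> real q" and m: "c * real n \<le> real m" and qn: "q \<le> n" and \<theta>: "\<theta> > 0"
      and inv: "inverse_bound r P \<kappa>" and P: "\<forall>a<r. \<forall>b<r. \<bar>P a b\<bar> \<le> \<sigma>" for n q m \<theta> P y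
  proof -
    define L where "L = sqrt (ln (real n))"
    define Q where "Q = sqrt (real q)"
    define Z where "Z = decay n \<theta>"
    define g where "g = 1 / sqrt (c * real n)"
    have ln: "ln (real n) \<ge> 1 / 2" by (rule ln_ge_half[OF n])
    have L2: "L\<^sup>2 = ln (real n)" using ln by (simp add: L_def)
    have L: "L > 0" using ln by (simp add: L_def)
    have cn: "c * real n > 0" using c n by simp
    have q0: "real q > 0" "real m > 0" using cn q m by linarith+
    then have Q: "Q > 0" and Q2: "Q\<^sup>2 = real q" by (simp_all add: Q_def)
    have g: "g > 0" using cn by (simp add: g_def)
    have gQ: "1 / Q \<le> g" unfolding g_def Q_def using q cn by (intro divide_left_mono) auto
    have Zt: "L * \<theta> \<le> Z" "L\<^sup>2 / sqrt (real n) \<le> Z" "L / (\<theta> * real n) \<le> Z"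
      unfolding Z_def decay_def L2 unfolding L_def using ln \<theta> n by simp_all
    have "0 < L * \<theta>" using L \<theta> by simp
    then have Z0: "Z \<ge> 0" using Zt(1) by linarith
    have sn: "1 / sqrt (real n) \<le> 2 * Z"
    proof -
      have "1 / sqrt (real n) \<le> 2 * (L\<^sup>2 / sqrt (real n))"
        using ln n by (simp add: L2 divide_right_mono)
      then show ?thesis using Zt(2) by linarith
    qed
    have ge: "g = e * (1 / sqrt (real n))" by (simp add: g_def e_def real_sqrt_mult)
    have g2: "g\<^sup>2 = e\<^sup>2 / real n" using n by (simp add: ge power_mult_distrib power_divide)
    \<comment> \<open>Both exponents \<open>\<rho>^2 / (2 * q)\<close> and
      \<open>s^2 * m / 2\<close> become \<open>2 * r * ln n\<close>, so
      \<open>\<delta> = n^(-2 * r)\<close>. Multiplied by the \<open>(q + 1)^r\<close> points this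
      leaves order \<open>n^(-r)\<close>, which the power of \<open>decay\<close> dominates up to a
      constant.\<close>
    define \<rho> where "\<rho> = 2 * R * Q * L"
    define s where "s = 2 * R * L / sqrt (real m)"
    define \<delta> where "\<delta> = (1 / real n) ^ (2 * r)"
    have \<rho>: "\<rho> \<ge> 0" and s: "s \<ge> 0" using R Q L by (simp_all add: \<rho>_def s_def)
    have \<delta>: "exp (- (2 * real r * L\<^sup>2)) = \<delta>"
    proof -
      have "exp (- (2 * real r * L\<^sup>2)) = exp (- ln (real n)) ^ (2 * r)"
        by (simp add: L2 flip: exp_of_nat_mult)
      also have "exp (- ln (real n)) = 1 / real n" using n by (simp add: exp_minus inverse_eq_divide)
      finally show ?thesis by (simp add: \<delta>_def)
    qed
    have R2: "R\<^sup>2 = real r" by (simp add: R_def)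
    have e1: "\<rho>\<^sup>2 / (2 * real q) = 2 * real r * L\<^sup>2"
      using q0 by (simp add: \<rho>_def power_mult_distrib R2 Q2)
    have \<delta>1: "exp (- (\<rho>\<^sup>2 / (2 * real q))) \<le> \<delta>" unfolding e1 \<delta> ..
    have e2: "s\<^sup>2 * real m / 2 = 2 * real r * L\<^sup>2"
      using q0 by (simp add: s_def power_mult_distrib power_divide R2)
    have \<delta>2: "exp (- (s\<^sup>2 * real m / 2)) \<le> \<delta>" unfolding e2 \<delta> ..
    have "(\<Sum>h\<in>PiE {..<r} (\<lambda>_. {..q}). (\<Prod>k<r. real (q choose h k) / 2 ^ q) *
        cos_weight \<theta> r m (walk_comb r q P y h)) \<le>
      2 * (real q + 1) ^ r * \<delta> + ((\<theta> * real r * \<sigma> * \<rho> + 2) * (4 * \<kappa> * s / \<theta> + 1) / sqrt (real q)) ^ r"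
      using P q0 by (intro sum_binomial_cos_weight_le[OF \<theta> \<rho> s inv _ _ \<delta>1 \<delta>2]) auto
    also have "2 * (real q + 1) ^ r * \<delta> \<le> 2 * (4 ^ r * Z ^ r)"
    proof -
      have "(real q + 1) ^ r * \<delta> = ((real q + 1) * (1 / real n)\<^sup>2) ^ r"
        by (simp add: \<delta>_def power_mult power_mult_distrib)
      also have "\<dots> \<le> (4 * Z) ^ r"
      proof (rule power_mono)
        have "real q + 1 \<le> 2 * real n" using qn n by linarith
        then have "(real q + 1) * (1 / real n)\<^sup>2 \<le> (2 * real n) * (1 / real n)\<^sup>2"
          by (rule mult_right_mono) simp
        also have "\<dots> = 2 * (1 / real n)" using n by (simp add: power2_eq_square)
        also have "\<dots> \<le> 2 * (1 / sqrt (real n))"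
        proof -
          have "sqrt (real n) \<le> real n" using n real_sqrt_le_mono[of "real n" "(real n)\<^sup>2"]
            by (simp add: power2_eq_square)
          then have "1 / real n \<le> 1 / sqrt (real n)" using n by (intro divide_left_mono) auto
          then show ?thesis by simp
        qed
        also have "\<dots> \<le> 4 * Z" using sn by simp
        finally show "(real q + 1) * (1 / real n)\<^sup>2 \<le> 4 * Z" .
      qed simp
      finally show ?thesis by (simp add: power_mult_distrib)
    qed
    also have "((\<theta> * real r * \<sigma> * \<rho> + 2) * (4 * \<kappa> * s / \<theta> + 1) / sqrt (real q)) ^ r \<le> (D * Z) ^ r"
    proof (rule power_mono)
      have "(\<theta> * real r * \<sigma> * \<rho> + 2) * (4 * \<kappa> * s / \<theta> + 1) / sqrt (real q) =
          (2 * real r * \<sigma> * R * \<theta> * L + 2 * (1 / Q)) * (4 * \<kappa> * s / \<theta> + 1)"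
        using Q by (simp add: \<rho>_def field_simps flip: Q_def)
      also have "\<dots> \<le> (2 * real r * \<sigma> * R * \<theta> * L + 2 * g) * (8 * \<kappa> * R * L * g / \<theta> + 1)"
      proof (intro mult_mono add_mono order_refl mult_left_mono gQ)
        have "1 / sqrt (real m) \<le> g" unfolding g_def using m cn q0 by (intro divide_left_mono) auto
        then have "2 * R * L * (1 / sqrt (real m)) \<le> 2 * R * L * g"
          using R L by (intro mult_left_mono) auto
        then have "s \<le> 2 * R * L * g" by (simp add: s_def)
        then have "4 * \<kappa> * s / \<theta> \<le> 4 * \<kappa> * (2 * R * L * g) / \<theta>"
          using \<kappa> \<theta> by (intro divide_right_mono mult_left_mono) auto
        then show "4 * \<kappa> * s / \<theta> \<le> 8 * \<kappa> * R * L * g / \<theta>" by (simp add: mult_ac)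
      qed (use \<sigma> R \<theta> L g \<kappa> s Q in auto)
      also have "\<dots> = 16 * real r * \<sigma> * \<kappa> * R\<^sup>2 * (L\<^sup>2 * g) + 2 * real r * \<sigma> * R * (L * \<theta>)
          + 16 * \<kappa> * R * (L * g\<^sup>2 / \<theta>) + 2 * g"
        using \<theta> by (simp add: field_simps power2_eq_square)
      also have "\<dots> \<le> 16 * real r * \<sigma> * \<kappa> * R\<^sup>2 * (e * Z) + 2 * real r * \<sigma> * R * Z
          + 16 * \<kappa> * R * (e\<^sup>2 * Z) + 2 * (e * (2 * Z))"
      proof (intro add_mono mult_left_mono)
        have "L\<^sup>2 * g = e * (L\<^sup>2 / sqrt (real n))" by (simp add: ge)
        also have "\<dots> \<le> e * Z" using Zt(2) e by (intro mult_left_mono) auto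
        finally show "L\<^sup>2 * g \<le> e * Z" .
        have "L * g\<^sup>2 / \<theta> = e\<^sup>2 * (L / (\<theta> * real n))" by (simp add: g2 mult_ac)
        also have "\<dots> \<le> e\<^sup>2 * Z" using Zt(3) by (intro mult_left_mono) auto
        finally show "L * g\<^sup>2 / \<theta> \<le> e\<^sup>2 * Z" .
        show "g \<le> e * (2 * Z)" unfolding ge using sn e by (intro mult_left_mono) auto
      qed (use Zt \<sigma> \<kappa> R in auto)
      also have "\<dots> = D * Z" by (simp add: D_def R2 algebra_simps)
      finally show "(\<theta> * real r * \<sigma> * \<rho> + 2) * (4 * \<kappa> * s / \<theta> + 1) / sqrt (real q) \<le> D * Z" .
    qed (use \<theta> \<sigma> \<rho> \<kappa> s in auto)
    finally show ?thesis by (simp add: Z_def algebra_simps power_mult_distrib)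
  qed
  moreover have "2 * 4 ^ r + D ^ r > 0" using D by (simp add: add_pos_nonneg)
  ultimately show ?thesis by blast
qed

section \<open>Decoupling and the characteristic function\<close>

lemma cis_sum: "finite J \<Longrightarrow> cis (\<Sum>j\<in>J. f j) = (\<Prod>j\<in>J. cis (f j))"
  by (induction J rule: finite_induct) (simp_all flip: cis_mult)

text \<open>Independence of the signs: expanding the product of
  \<open>cis (x j) + cis (- x j)\<close> lists all sign patterns.\<close>

lemma sum_Pow_cis:
  assumes J: "finite J"
  shows "(\<Sum>W\<in>Pow J. cis (\<Sum>j\<in>J. sgn_in W j * x j)) = (\<Prod>j\<in>J. complex_of_real (2 * cos (x j)))"
proof -
  have "(\<Prod>j\<in>J. complex_of_real (2 * cos (x j))) = (\<Prod>j\<in>J. cis (x j) + cis (- x j))"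
    by (intro prod.cong refl) (simp add: complex_eq_iff)
  also have "\<dots> = (\<Sum>W\<in>Pow J. (\<Prod>j\<in>W. cis (x j)) * (\<Prod>j\<in>J - W. cis (- x j)))"
    by (rule prod_add[OF J])
  also have "\<dots> = (\<Sum>W\<in>Pow J. cis (\<Sum>j\<in>J. sgn_in W j * x j))"
  proof (rule sum.cong[OF refl])
    fix W assume "W \<in> Pow J"
    then have W: "W \<subseteq> J" by simp
    have "cis (\<Sum>j\<in>J. sgn_in W j * x j) = (\<Prod>j\<in>J. cis (sgn_in W j * x j))" by (rule cis_sum[OF J])
    also have "\<dots> = (\<Prod>j\<in>J - W. cis (sgn_in W j * x j)) * (\<Prod>j\<in>W. cis (sgn_in W j * x j))"
      by (rule prod.subset_diff[OF W J])
    also have "(\<Prod>j\<in>J - W. cis (sgn_in W j * x j)) = (\<Prod>j\<in>J - W. cis (- x j))"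
      by (intro prod.cong) (auto simp: sgn_in_def)
    also have "(\<Prod>j\<in>W. cis (sgn_in W j * x j)) = (\<Prod>j\<in>W. cis (x j))"
      by (intro prod.cong) (auto simp: sgn_in_def)
    finally show "(\<Prod>j\<in>W. cis (x j)) * (\<Prod>j\<in>J - W. cis (- x j)) = cis (\<Sum>j\<in>J. sgn_in W j * x j)"
      by (simp add: mult.commute)
  qed
  finally show ?thesis ..
qed

text \<open>Squaring the inner sum over the signs in \<open>I\<close> introduces a second copy
  \<open>V'\<close> of them. With \<open>W\<close> common to both copies, \<open>v\<close> cancels
  and \<open>u\<close> leaves only a phase, so the exponent is linear in the signs on
  \<open>J\<close>; summing over these is exact and gives cosines. One factor
  \<open>2^card J\<close> comes from the Cauchy-Schwarz inequality, another from these sums.\<close>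

lemma decoupling:
  fixes A :: "'i \<Rightarrow> 'i \<Rightarrow> real"
  assumes I: "finite I" and J: "finite J" and IJ: "I \<inter> J = {}"
    and X: "\<And>V W. V \<subseteq> I \<Longrightarrow> W \<subseteq> J \<Longrightarrow>
      X (V \<union> W) = u V + v W + (\<Sum>i\<in>I. \<Sum>j\<in>J. A i j * sgn_in V i * sgn_in W j)"
  shows "(cmod (\<Sum>V\<in>Pow (I \<union> J). cis (\<theta> * X V)))\<^sup>2 \<le> 4 ^ card J *
    (\<Sum>V\<in>Pow I. \<Sum>V'\<in>Pow I. \<Prod>j\<in>J. \<bar>cos (\<theta> * (\<Sum>i\<in>I. (sgn_in V i - sgn_in V' i) * A i j))\<bar>)"
proof -
  define g where "g W = (\<Sum>V\<in>Pow I. cis (\<theta> * X (V \<union> W)))" for W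
  define y where "y V V' j = (\<Sum>i\<in>I. (sgn_in V i - sgn_in V' i) * A i j)" for V V' j
  have "(\<Sum>V\<in>Pow (I \<union> J). cis (\<theta> * X V)) = (\<Sum>W\<in>Pow J. g W)"
    unfolding g_def by (subst sum_Pow_Un[OF I J IJ]) (rule sum.swap)
  then have "(cmod (\<Sum>V\<in>Pow (I \<union> J). cis (\<theta> * X V)))\<^sup>2 \<le> (\<Sum>W\<in>Pow J. 1 * cmod (g W))\<^sup>2"
    by (simp add: power_mono norm_sum)
  also have "\<dots> \<le> (\<Sum>W\<in>Pow J. 1\<^sup>2) * (\<Sum>W\<in>Pow J. (cmod (g W))\<^sup>2)" by (rule Cauchy_Schwarz_ineq_sum)
  also have "\<dots> = 2 ^ card J * (\<Sum>W\<in>Pow J. (cmod (g W))\<^sup>2)" using J by (simp add: card_Pow)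
  also have "(\<Sum>W\<in>Pow J. (cmod (g W))\<^sup>2) \<le> (\<Sum>V\<in>Pow I. \<Sum>V'\<in>Pow I. 2 ^ card J * (\<Prod>j\<in>J. \<bar>cos (\<theta> * y V V' j)\<bar>))"
  proof -
    have "complex_of_real (\<Sum>W\<in>Pow J. (cmod (g W))\<^sup>2) = (\<Sum>W\<in>Pow J. g W * cnj (g W))"
      by (simp only: of_real_sum complex_norm_square)
    also have "\<dots> = (\<Sum>W\<in>Pow J. \<Sum>V\<in>Pow I. \<Sum>V'\<in>Pow I.
        cis (\<theta> * (u V - u V')) * cis (\<Sum>j\<in>J. sgn_in W j * (\<theta> * y V V' j)))"
    proof (rule sum.cong[OF refl])
      fix W assume "W \<in> Pow J"
      then have W: "W \<subseteq> J" by simp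
      have "g W * cnj (g W) = (\<Sum>V\<in>Pow I. \<Sum>V'\<in>Pow I. cis (\<theta> * X (V \<union> W)) * cis (- (\<theta> * X (V' \<union> W))))"
        by (simp add: g_def sum_product cis_cnj)
      also have "\<dots> = (\<Sum>V\<in>Pow I. \<Sum>V'\<in>Pow I.
          cis (\<theta> * (u V - u V')) * cis (\<Sum>j\<in>J. sgn_in W j * (\<theta> * y V V' j)))"
      proof (intro sum.cong refl)
        fix V V' assume "V \<in> Pow I" "V' \<in> Pow I"
        then have V: "V \<subseteq> I" "V' \<subseteq> I" by simp_all
        have "(\<Sum>j\<in>J. sgn_in W j * (\<theta> * y V V' j)) =
            (\<Sum>j\<in>J. \<Sum>i\<in>I. \<theta> * (A i j * sgn_in V i * sgn_in W j) - \<theta> * (A i j * sgn_in V' i * sgn_in W j))"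
          by (simp add: y_def sum_distrib_left algebra_simps)
        also have "\<dots> = (\<Sum>i\<in>I. \<Sum>j\<in>J. \<theta> * (A i j * sgn_in V i * sgn_in W j) - \<theta> * (A i j * sgn_in V' i * sgn_in W j))"
          by (rule sum.swap)
        also have "\<dots> = \<theta> * (\<Sum>i\<in>I. \<Sum>j\<in>J. A i j * sgn_in V i * sgn_in W j)
            - \<theta> * (\<Sum>i\<in>I. \<Sum>j\<in>J. A i j * sgn_in V' i * sgn_in W j)"
          by (simp add: sum_subtractf sum_distrib_left)
        finally have "\<theta> * X (V \<union> W) + - (\<theta> * X (V' \<union> W)) =
            \<theta> * (u V - u V') + (\<Sum>j\<in>J. sgn_in W j * (\<theta> * y V V' j))"
          using X[OF V(1) W] X[OF V(2) W] by (simp add: algebra_simps)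
        then show "cis (\<theta> * X (V \<union> W)) * cis (- (\<theta> * X (V' \<union> W))) =
            cis (\<theta> * (u V - u V')) * cis (\<Sum>j\<in>J. sgn_in W j * (\<theta> * y V V' j))"
          by (simp only: cis_mult)
      qed
      finally show "g W * cnj (g W) = (\<Sum>V\<in>Pow I. \<Sum>V'\<in>Pow I.
          cis (\<theta> * (u V - u V')) * cis (\<Sum>j\<in>J. sgn_in W j * (\<theta> * y V V' j)))" .
    qed
    also have "\<dots> = (\<Sum>V\<in>Pow I. \<Sum>W\<in>Pow J. \<Sum>V'\<in>Pow I.
        cis (\<theta> * (u V - u V')) * cis (\<Sum>j\<in>J. sgn_in W j * (\<theta> * y V V' j)))"
      by (rule sum.swap)
    also have "\<dots> = (\<Sum>V\<in>Pow I. \<Sum>V'\<in>Pow I. \<Sum>W\<in>Pow J.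
        cis (\<theta> * (u V - u V')) * cis (\<Sum>j\<in>J. sgn_in W j * (\<theta> * y V V' j)))"
      by (intro sum.cong refl sum.swap)
    also have "\<dots> = (\<Sum>V\<in>Pow I. \<Sum>V'\<in>Pow I.
        cis (\<theta> * (u V - u V')) * (\<Prod>j\<in>J. complex_of_real (2 * cos (\<theta> * y V V' j))))"
      by (simp only: sum_distrib_left[symmetric] sum_Pow_cis[OF J])
    finally have eq: "complex_of_real (\<Sum>W\<in>Pow J. (cmod (g W))\<^sup>2) = \<dots>" .
    have "(\<Sum>W\<in>Pow J. (cmod (g W))\<^sup>2) = cmod (complex_of_real (\<Sum>W\<in>Pow J. (cmod (g W))\<^sup>2))"
      by (simp only: norm_of_real) (simp add: sum_nonneg)
    also have "\<dots> \<le> (\<Sum>V\<in>Pow I. \<Sum>V'\<in>Pow I.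
        cmod (cis (\<theta> * (u V - u V')) * (\<Prod>j\<in>J. complex_of_real (2 * cos (\<theta> * y V V' j)))))"
      unfolding eq by (intro order.trans[OF norm_sum] sum_mono norm_sum)
    also have "\<dots> = (\<Sum>V\<in>Pow I. \<Sum>V'\<in>Pow I. 2 ^ card J * (\<Prod>j\<in>J. \<bar>cos (\<theta> * y V V' j)\<bar>))"
      by (intro sum.cong refl) (simp add: norm_mult norm_power abs_mult prod.distrib flip: prod_norm)
    finally show ?thesis .
  qed
  finally have "(cmod (\<Sum>V\<in>Pow (I \<union> J). cis (\<theta> * X V)))\<^sup>2 \<le>
      2 ^ card J * (\<Sum>V\<in>Pow I. \<Sum>V'\<in>Pow I. 2 ^ card J * (\<Prod>j\<in>J. \<bar>cos (\<theta> * y V V' j)\<bar>))"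
    by simp
  also have "\<dots> = 4 ^ card J * (\<Sum>V\<in>Pow I. \<Sum>V'\<in>Pow I. \<Prod>j\<in>J. \<bar>cos (\<theta> * y V V' j)\<bar>)"
  proof -
    have "(2::real) ^ card J * 2 ^ card J = 4 ^ card J" by (simp flip: power_mult_distrib)
    then show ?thesis by (simp only: sum_distrib_left[symmetric] mult.assoc[symmetric])
  qed
  finally show ?thesis by (simp only: y_def)
qed

text \<open>The AM-GM inequality for the powers \<open>x i ^ card S\<close>. It trades the joint
  product over all column tuples, whose row sets may overlap, for an average over single tuples at a
  high power.\<close>

lemma prod_le_mean_powers:
  fixes x :: "'a \<Rightarrow> real"
  assumes S: "finite S" "S \<noteq> {}" and x: "\<And>i. i \<in> S \<Longrightarrow> x i \<ge> 0"
  shows "(\<Prod>i\<in>S. x i) \<le> (\<Sum>i\<in>S. x i ^ card S / real (card S))"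
proof -
  have m: "card S > 0" using S by (simp add: card_gt_0_iff)
  have p: "(\<Prod>i\<in>S. x i) \<ge> 0" using x by (rule prod_nonneg)
  have "(\<Prod>i\<in>S. x i) = ((\<Prod>i\<in>S. x i) ^ card S) powr (1 / real (card S))"
  proof (cases "(\<Prod>i\<in>S. x i) = 0")
    case False
    then have "(\<Prod>i\<in>S. x i) > 0" using p by simp
    then show ?thesis using m by (simp add: powr_powr flip: powr_realpow)
  qed (use m in simp)
  also have "(\<Prod>i\<in>S. x i) ^ card S = (\<Prod>i\<in>S. x i ^ card S)" by (simp add: prod_power_distrib)
  also have "(\<Prod>i\<in>S. x i ^ card S) powr (1 / real (card S)) \<le> (\<Sum>i\<in>S. x i ^ card S / real (card S))"
    using x by (intro arith_geom_mean[OF S]) auto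
  finally show ?thesis .
qed

lemma block_structureD:
  assumes "block_structure A r I J P \<T> K q"
  shows "finite \<T>" "T \<in> \<T> \<Longrightarrow> inj_on T {..<r}" "T \<in> \<T> \<Longrightarrow> T ` {..<r} \<subseteq> J"
    "T \<in> \<T> \<Longrightarrow> T' \<in> \<T> \<Longrightarrow> T \<noteq> T' \<Longrightarrow> T ` {..<r} \<inter> T' ` {..<r} = {}"
    "T \<in> \<T> \<Longrightarrow> a < r \<Longrightarrow> K T a \<subseteq> I \<and> card (K T a) = q"
    "T \<in> \<T> \<Longrightarrow> a < r \<Longrightarrow> b < r \<Longrightarrow> a \<noteq> b \<Longrightarrow> K T a \<inter> K T b = {}"
    "T \<in> \<T> \<Longrightarrow> a < r \<Longrightarrow> b < r \<Longrightarrow> i \<in> K T a \<Longrightarrow> A i (T b) = P a b"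
  using assms unfolding block_structure_def by simp_all

text \<open>Columns outside all tuples are dropped, as their factors are at most 1; the others are
  grouped by the disjoint tuples, to which the AM-GM inequality applies.\<close>

lemma prod_cos_le_mean_cos_weight:
  assumes bs: "block_structure A r I J P \<T> K q" and \<T>: "\<T> \<noteq> {}" and J: "finite J"
  shows "(\<Prod>j\<in>J. \<bar>cos (\<theta> * z j)\<bar>) \<le>
    (\<Sum>T\<in>\<T>. cos_weight \<theta> r (card \<T>) (\<lambda>b. z (T b)) / real (card \<T>))"
proof -
  have fin: "finite \<T>" and inj: "\<And>T. T \<in> \<T> \<Longrightarrow> inj_on T {..<r}" and sub: "\<And>T. T \<in> \<T> \<Longrightarrow> T ` {..<r} \<subseteq> J"
    and dis: "\<And>T T'. T \<in> \<T> \<Longrightarrow> T' \<in> \<T> \<Longrightarrow> T \<noteq> T' \<Longrightarrow> T ` {..<r} \<inter> T' ` {..<r} = {}"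
    by (fact block_structureD[OF bs])+
  define U where "U = (\<Union>T\<in>\<T>. T ` {..<r})"
  have U: "U \<subseteq> J" using sub by (auto simp: U_def)
  have "(\<Prod>j\<in>J. \<bar>cos (\<theta> * z j)\<bar>) = (\<Prod>j\<in>J - U. \<bar>cos (\<theta> * z j)\<bar>) * (\<Prod>j\<in>U. \<bar>cos (\<theta> * z j)\<bar>)"
    by (rule prod.subset_diff[OF U J])
  also have "\<dots> \<le> (\<Prod>j\<in>U. \<bar>cos (\<theta> * z j)\<bar>)"
    by (intro mult_left_le_one_le prod_le_1 prod_nonneg) auto
  also have "\<dots> = (\<Prod>T\<in>\<T>. \<Prod>j\<in>T ` {..<r}. \<bar>cos (\<theta> * z j)\<bar>)"
    unfolding U_def by (rule prod.UNION_disjoint) (use fin dis in auto)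
  also have "\<dots> = (\<Prod>T\<in>\<T>. \<Prod>b<r. \<bar>cos (\<theta> * z (T b))\<bar>)"
  proof (rule prod.cong[OF refl])
    fix T assume "T \<in> \<T>"
    from prod.reindex[OF inj[OF this]]
    show "(\<Prod>j\<in>T ` {..<r}. \<bar>cos (\<theta> * z j)\<bar>) = (\<Prod>b<r. \<bar>cos (\<theta> * z (T b))\<bar>)"
      by (simp add: comp_def)
  qed
  also have "\<dots> \<le> (\<Sum>T\<in>\<T>. (\<Prod>b<r. \<bar>cos (\<theta> * z (T b))\<bar>) ^ card \<T> / real (card \<T>))"
    by (rule prod_le_mean_powers[OF fin \<T>]) (auto intro: prod_nonneg)
  finally show ?thesis by (simp add: cos_weight_def prod_power_distrib)
qed

text \<open>For a fixed second copy \<open>V'\<close> of the signs, its contribution to the linear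
  forms is a constant shift, so only the first copy varies. After the AM-GM inequality each column
  tuple \<open>T\<close> is treated with its own row blocks \<open>K T\<close>, and \<open>M\<close>
  bounds all of them.\<close>

lemma char_sum_sq_le:
  fixes A :: "nat \<Rightarrow> nat \<Rightarrow> real"
  assumes I: "finite I" and J: "finite J" and IJ: "I \<inter> J = {}"
    and X: "\<And>V W. V \<subseteq> I \<Longrightarrow> W \<subseteq> J \<Longrightarrow>
      X (V \<union> W) = u V + v W + (\<Sum>i\<in>I. \<Sum>j\<in>J. A i j * sgn_in V i * sgn_in W j)"
    and bs: "block_structure A r I J P \<T> K q" and \<T>: "\<T> \<noteq> {}"
    and M: "\<And>y. (\<Sum>h\<in>PiE {..<r} (\<lambda>_. {..q}). (\<Prod>k<r. real (q choose h k) / 2 ^ q) *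
      cos_weight \<theta> r (card \<T>) (walk_comb r q P y h)) \<le> M"
  shows "(cmod (\<Sum>V\<in>Pow (I \<union> J). cis (\<theta> * X V)))\<^sup>2 \<le> 4 ^ card (I \<union> J) * M"
proof -
  have fin: "finite \<T>" using bs by (simp add: block_structure_def)
  have m: "card \<T> > 0" using fin \<T> by (simp add: card_gt_0_iff)
  have inner: "(\<Sum>V\<in>Pow I. \<Prod>j\<in>J. \<bar>cos (\<theta> * (\<Sum>i\<in>I. (sgn_in V i - sgn_in V' i) * A i j))\<bar>) \<le> 2 ^ card I * M" for V'
  proof -
    have "(\<Sum>V\<in>Pow I. \<Prod>j\<in>J. \<bar>cos (\<theta> * (\<Sum>i\<in>I. (sgn_in V i - sgn_in V' i) * A i j))\<bar>) \<le>
        (\<Sum>V\<in>Pow I. \<Sum>T\<in>\<T>. cos_weight \<theta> r (card \<T>)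
          (\<lambda>b. \<Sum>i\<in>I. (sgn_in V i - sgn_in V' i) * A i (T b)) / real (card \<T>))"
      by (intro sum_mono prod_cos_le_mean_cos_weight[OF bs \<T> J])
    also have "\<dots> = (\<Sum>T\<in>\<T>. \<Sum>V\<in>Pow I. cos_weight \<theta> r (card \<T>)
          (\<lambda>b. \<Sum>i\<in>I. (sgn_in V i - sgn_in V' i) * A i (T b)) / real (card \<T>))"
      by (rule sum.swap)
    also have "\<dots> = (\<Sum>T\<in>\<T>. (\<Sum>V\<in>Pow I. cos_weight \<theta> r (card \<T>)
          (\<lambda>b. (\<Sum>i\<in>I. sgn_in V i * A i (T b)) + - (\<Sum>i\<in>I. sgn_in V' i * A i (T b)))) / real (card \<T>))"
      by (simp add: sum_divide_distrib left_diff_distrib sum_subtractf)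
    also have "\<dots> \<le> (\<Sum>T\<in>\<T>. 2 ^ card I * M / real (card \<T>))"
    proof (intro sum_mono divide_right_mono)
      fix T assume T: "T \<in> \<T>"
      show "(\<Sum>V\<in>Pow I. cos_weight \<theta> r (card \<T>)
          (\<lambda>b. (\<Sum>i\<in>I. sgn_in V i * A i (T b)) + - (\<Sum>i\<in>I. sgn_in V' i * A i (T b)))) \<le> 2 ^ card I * M"
      proof (rule sum_Pow_cos_weight_le[OF I, where K = "K T" and q = q and P = P])
        show "K T k \<subseteq> I \<and> card (K T k) = q" if "k < r" for k
          by (rule block_structureD(5)[OF bs T that])
        show "K T k \<inter> K T l = {}" if "k < r" "l < r" "k \<noteq> l" for k l
          by (rule block_structureD(6)[OF bs T that])
        show "A i (T b) = P k b" if "k < r" "b < r" "i \<in> K T k" for k b i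
          by (rule block_structureD(7)[OF bs T that])
      qed (rule M)
    qed simp
    also have "\<dots> = 2 ^ card I * M" using m by simp
    finally show ?thesis .
  qed
  have "(\<Sum>V\<in>Pow I. \<Sum>V'\<in>Pow I. \<Prod>j\<in>J. \<bar>cos (\<theta> * (\<Sum>i\<in>I. (sgn_in V i - sgn_in V' i) * A i j))\<bar>) =
      (\<Sum>V'\<in>Pow I. \<Sum>V\<in>Pow I. \<Prod>j\<in>J. \<bar>cos (\<theta> * (\<Sum>i\<in>I. (sgn_in V i - sgn_in V' i) * A i j))\<bar>)"
    by (rule sum.swap)
  also have "\<dots> \<le> (\<Sum>V'\<in>Pow I. 2 ^ card I * M)" by (intro sum_mono inner)
  also have "\<dots> = 4 ^ card I * M"
    using I by (simp add: card_Pow flip: power_mult_distrib mult.assoc)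
  finally have *: "(\<Sum>V\<in>Pow I. \<Sum>V'\<in>Pow I. \<Prod>j\<in>J. \<bar>cos (\<theta> * (\<Sum>i\<in>I. (sgn_in V i - sgn_in V' i) * A i j))\<bar>)
      \<le> 4 ^ card I * M" .
  have "(cmod (\<Sum>V\<in>Pow (I \<union> J). cis (\<theta> * X V)))\<^sup>2 \<le> 4 ^ card J *
    (\<Sum>V\<in>Pow I. \<Sum>V'\<in>Pow I. \<Prod>j\<in>J. \<bar>cos (\<theta> * (\<Sum>i\<in>I. (sgn_in V i - sgn_in V' i) * A i j))\<bar>)"
    by (rule decoupling[OF I J IJ X])
  also have "\<dots> \<le> 4 ^ card J * (4 ^ card I * M)" using * by (intro mult_left_mono) auto
  also have "\<dots> = 4 ^ card (I \<union> J) * M" by (simp add: card_Un_disjoint[OF I J IJ] power_add)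
  finally show ?thesis .
qed

text \<open>A smoothing inequality by positivity: the geometric sum \<open>f V\<close> equals
  \<open>N\<close> on the level set, and expanding the sum of all \<open>|f V|^2\<close>, which is
  \<open>N\<close> times a Fejer kernel, leaves the characteristic sums at differences of
  frequencies. The spacing \<open>\<eta>\<close> is a free parameter, as no lattice structure of
  \<open>X\<close> is involved.\<close>

lemma card_level_set_le:
  fixes X :: "'a \<Rightarrow> real" and \<phi> :: "nat \<Rightarrow> real"
  assumes \<Omega>: "finite \<Omega>" and N: "N > 0"
    and \<phi>: "\<And>k. k > 0 \<Longrightarrow> k < N \<Longrightarrow> cmod (\<Sum>V\<in>\<Omega>. cis (real k * \<eta> * X V)) \<le> \<phi> k"
  shows "real N * real (card {V \<in> \<Omega>. X V = x}) \<le> real (card \<Omega>) + 2 * (\<Sum>k\<in>{1..<N}. \<phi> k)"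
proof -
  define S where "S t = cmod (\<Sum>V\<in>\<Omega>. cis (t * \<eta> * X V))" for t
  have S_minus: "S (- t) = S t" for t
  proof -
    have "(\<Sum>V\<in>\<Omega>. cis (- t * \<eta> * X V)) = cnj (\<Sum>V\<in>\<Omega>. cis (t * \<eta> * X V))"
      by (simp add: cis_cnj)
    then show ?thesis unfolding S_def by (simp only: complex_mod_cnj)
  qed
  define \<psi> where "\<psi> k = (if k = 0 then real (card \<Omega>) else \<phi> k)" for k :: nat
  have S0: "S 0 = real (card \<Omega>)" by (simp add: S_def)
  have \<psi>: "S (real k) \<le> \<psi> k" if "k < N" for k
    using \<phi>[of k] that S0 by (auto simp: \<psi>_def S_def)
  have \<psi>0: "\<psi> k \<ge> 0" if "k < N" for k using \<psi>[OF that] by (rule order_trans[rotated]) (simp add: S_def)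
  \<comment> \<open>For fixed \<open>k\<close> the differences \<open>k - l\<close> take zero once
    and every positive absolute value below \<open>N\<close> at most twice, and \<open>S\<close> is
    even.\<close>
  have row: "(\<Sum>l<N. S (real k - real l)) \<le> real (card \<Omega>) + 2 * (\<Sum>k\<in>{1..<N}. \<phi> k)" if k: "k < N" for k
  proof -
    have split: "{..<N} = {..k} \<union> {Suc k..<N}" using k by auto
    have "(\<Sum>l<N. S (real k - real l)) = (\<Sum>l\<le>k. S (real k - real l)) + (\<Sum>l\<in>{Suc k..<N}. S (real k - real l))"
      unfolding split by (rule sum.union_disjoint) auto
    also have "(\<Sum>l\<le>k. S (real k - real l)) = (\<Sum>j\<le>k. S (real j))"
      by (rule sum.reindex_bij_witness[of _ "\<lambda>j. k - j" "\<lambda>j. k - j"]) (auto simp: of_nat_diff)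
    also have "(\<Sum>l\<in>{Suc k..<N}. S (real k - real l)) = (\<Sum>j\<in>{1..<N - k}. S (real j))"
    proof (rule sum.reindex_bij_witness[of _ "\<lambda>j. k + j" "\<lambda>l. l - k"])
      fix l assume "l \<in> {Suc k..<N}"
      then have "real (l - k) = - (real k - real l)" by (simp add: of_nat_diff)
      then show "S (real (l - k)) = S (real k - real l)" by (simp only: S_minus)
    qed auto
    also have "(\<Sum>j\<le>k. S (real j)) \<le> (\<Sum>j\<le>k. \<psi> j)" using k by (intro sum_mono \<psi>) auto
    also have "\<dots> \<le> (\<Sum>j\<in>{..<N}. \<psi> j)" using k \<psi>0 by (intro sum_mono2) auto
    also have "\<dots> = \<psi> 0 + (\<Sum>j\<in>{1..<N}. \<psi> j)"
      using N by (simp add: lessThan_atLeast0 sum.atLeast_Suc_lessThan)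
    also have "(\<Sum>j\<in>{1..<N - k}. S (real j)) \<le> (\<Sum>j\<in>{1..<N - k}. \<psi> j)" by (intro sum_mono \<psi>) auto
    also have "\<dots> \<le> (\<Sum>j\<in>{1..<N}. \<psi> j)" using \<psi>0 by (intro sum_mono2) auto
    also have "(\<Sum>j\<in>{1..<N}. \<psi> j) = (\<Sum>j\<in>{1..<N}. \<phi> j)" by (intro sum.cong) (auto simp: \<psi>_def)
    finally show ?thesis by (simp add: \<psi>_def)
  qed
  define f where "f V = (\<Sum>k<N. cis (real k * \<eta> * (X V - x)))" for V
  have fx: "f V = of_nat N" if "X V = x" for V using that by (simp add: f_def)
  have "(real N)\<^sup>2 * real (card {V \<in> \<Omega>. X V = x}) = (\<Sum>V\<in>{V \<in> \<Omega>. X V = x}. (cmod (f V))\<^sup>2)"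
    by (simp add: fx mult.commute)
  also have "\<dots> \<le> (\<Sum>V\<in>\<Omega>. (cmod (f V))\<^sup>2)" using \<Omega> by (intro sum_mono2) auto
  also have "\<dots> \<le> (\<Sum>k<N. \<Sum>l<N. S (real k - real l))"
  proof -
    have "complex_of_real (\<Sum>V\<in>\<Omega>. (cmod (f V))\<^sup>2) = (\<Sum>V\<in>\<Omega>. f V * cnj (f V))"
      by (simp only: of_real_sum complex_norm_square)
    also have "\<dots> = (\<Sum>V\<in>\<Omega>. \<Sum>k<N. \<Sum>l<N.
        cis (- (real k - real l) * \<eta> * x) * cis ((real k - real l) * \<eta> * X V))"
      unfolding f_def cnj_sum sum_product cis_cnj cis_mult
      by (intro sum.cong refl arg_cong[where f = cis]) (simp add: algebra_simps)
    also have "\<dots> = (\<Sum>k<N. \<Sum>V\<in>\<Omega>. \<Sum>l<N.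
        cis (- (real k - real l) * \<eta> * x) * cis ((real k - real l) * \<eta> * X V))"
      by (rule sum.swap)
    also have "\<dots> = (\<Sum>k<N. \<Sum>l<N. \<Sum>V\<in>\<Omega>.
        cis (- (real k - real l) * \<eta> * x) * cis ((real k - real l) * \<eta> * X V))"
      by (intro sum.cong refl sum.swap)
    also have "\<dots> = (\<Sum>k<N. \<Sum>l<N. cis (- (real k - real l) * \<eta> * x) *
        (\<Sum>V\<in>\<Omega>. cis ((real k - real l) * \<eta> * X V)))"
      by (simp only: sum_distrib_left)
    finally have eq: "complex_of_real (\<Sum>V\<in>\<Omega>. (cmod (f V))\<^sup>2) = \<dots>" .
    have "(\<Sum>V\<in>\<Omega>. (cmod (f V))\<^sup>2) = cmod (complex_of_real (\<Sum>V\<in>\<Omega>. (cmod (f V))\<^sup>2))"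
      by (simp only: norm_of_real) (simp add: sum_nonneg)
    also have "\<dots> \<le> (\<Sum>k<N. \<Sum>l<N. cmod (cis (- (real k - real l) * \<eta> * x) *
        (\<Sum>V\<in>\<Omega>. cis ((real k - real l) * \<eta> * X V))))"
      unfolding eq by (intro order.trans[OF norm_sum] sum_mono norm_sum)
    also have "\<dots> = (\<Sum>k<N. \<Sum>l<N. S (real k - real l))" by (simp add: norm_mult S_def)
    finally show ?thesis .
  qed
  also have "\<dots> \<le> (\<Sum>k<N. real (card \<Omega>) + 2 * (\<Sum>k\<in>{1..<N}. \<phi> k))" using row by (intro sum_mono) auto
  also have "\<dots> = real N * (real (card \<Omega>) + 2 * (\<Sum>k\<in>{1..<N}. \<phi> k))" by simp
  finally show ?thesis using N by (simp add: power2_eq_square mult.assoc)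
qed

section \<open>Averaging the decay over the frequencies\<close>

definition rate :: "nat \<Rightarrow> nat \<Rightarrow> real" where
  "rate r n = ln (real n) powr (real r / 2) / real n powr (1 - 2 / (real r + 2))"

lemma powr_sum3_le:
  fixes a b c p :: real
  assumes "a \<ge> 0" "b \<ge> 0" "c \<ge> 0" "p \<ge> 0"
  shows "(a + b + c) powr p \<le> 3 powr p * (a powr p + b powr p + c powr p)"
proof -
  define m where "m = max a (max b c)"
  have m: "m \<ge> 0" using assms by (simp add: m_def)
  have "(a + b + c) powr p \<le> (3 * m) powr p" using assms by (intro powr_mono2) (auto simp: m_def)
  also have "\<dots> = 3 powr p * m powr p" using m by (simp add: powr_mult)
  also have "\<dots> \<le> 3 powr p * (a powr p + b powr p + c powr p)"
    by (intro mult_left_mono) (auto simp: m_def max_def)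
  finally show ?thesis .
qed

text \<open>Uniform in \<open>N\<close> by convergence at the exponent \<open>3 / 2\<close>, which
  is \<open>r / 2\<close> for \<open>r = 3\<close>.\<close>

lemma sum_inverse_powr_le:
  assumes "p \<ge> 3 / 2"
  shows "(\<Sum>k\<in>{1..<N}. (1 / real k) powr p) \<le> suminf (\<lambda>k. real k powr (- (3 / 2)))"
proof -
  have "(\<Sum>k\<in>{1..<N}. (1 / real k) powr p) \<le> (\<Sum>k\<in>{1..<N}. real k powr (- (3 / 2)))"
  proof (rule sum_mono)
    fix k assume k: "k \<in> {1..<N}"
    have "(1 / real k) powr p = real k powr (- p)" using k by (simp add: powr_divide powr_minus_divide)
    also have "\<dots> \<le> real k powr (- (3 / 2))" using k assms by (intro powr_mono) auto
    finally show "(1 / real k) powr p \<le> real k powr (- (3 / 2))" .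
  qed
  also have "\<dots> \<le> suminf (\<lambda>k. real k powr (- (3 / 2)))"
    by (intro sum_le_suminf) (auto simp: summable_real_powr_iff)
  finally show ?thesis .
qed

text \<open>At \<open>\<theta> = k / n\<close> the three terms of \<open>decay\<close> are
  \<open>L * k / n\<close>, \<open>l / sqrt n\<close> and \<open>L / k\<close>, where
  \<open>l = ln n\<close> and \<open>L = sqrt l\<close>. With \<open>N\<close> of order
  \<open>n powr \<alpha>\<close>, the power \<open>p\<close> of the first is at most
  \<open>l powr p * n powr (- \<alpha>)\<close> up to a constant, that of the second is at most this
  since \<open>\<alpha> \<le> p / 2\<close>, and that of the third is summable in \<open>k\<close>,
  so that division by \<open>N\<close> yields the same power of \<open>n\<close>.\<close>

lemma mean_decay_le_rate:
  fixes r :: nat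
  assumes r: "r \<ge> 3"
  shows "\<exists>D>0. \<forall>n\<ge>2. \<exists>N>0. 1 / real N \<le> D * rate r n \<and>
    (\<Sum>k\<in>{1..<N}. decay n (real k / real n) powr (real r / 2)) / real N \<le> D * rate r n"
proof -
  define p where "p = real r / 2"
  define \<alpha> where "\<alpha> = 1 - 2 / (real r + 2)"
  define \<zeta> where "\<zeta> = suminf (\<lambda>k. real k powr (- (3 / 2)))"
  define D where "D = 2 powr p + 3 powr p * (4 powr p + 1 + 2 powr p * \<zeta>)"
  have p: "p \<ge> 3 / 2" using r by (simp add: p_def)
  have \<zeta>: "\<zeta> \<ge> 0" unfolding \<zeta>_def by (intro suminf_nonneg) (auto simp: summable_real_powr_iff)
  have D: "D > 0" unfolding D_def using \<zeta> by (intro add_pos_nonneg mult_nonneg_nonneg add_nonneg_nonneg) auto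
  \<comment> \<open>The balance that fixes \<open>\<alpha> = r / (r + 2)\<close>:
    \<open>(N / n) powr p\<close> and \<open>1 / N\<close> have the same order.\<close>
  have \<alpha>p: "(\<alpha> - 1) * p = - \<alpha>" using r by (simp add: \<alpha>_def p_def field_simps)
  have \<alpha>r: "\<alpha> \<le> p / 2"
  proof -
    have "\<alpha> = real r / (real r + 2)" by (simp add: \<alpha>_def field_simps)
    also have "\<dots> \<le> real r / 4" using r by (intro divide_left_mono) auto
    finally show ?thesis by (simp add: p_def)
  qed
  have "\<exists>N>0. 1 / real N \<le> D * rate r n \<and>
    (\<Sum>k\<in>{1..<N}. decay n (real k / real n) powr p) / real N \<le> D * rate r n" if n: "n \<ge> 2" for n
  proof -
    define l where "l = ln (real n)"
    define L where "L = sqrt l"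
    define \<tau> where "\<tau> = l powr p * real n powr (- \<alpha>)"
    define N where "N = nat \<lceil>real n powr \<alpha>\<rceil>"
    have \<tau>: "rate r n = \<tau>"
      by (simp add: rate_def \<tau>_def l_def powr_minus_divide flip: p_def \<alpha>_def)
    have l: "l \<ge> 1 / 2" unfolding l_def by (rule ln_ge_half[OF n])
    have L0: "L \<ge> 0" using l by (simp add: L_def)
    \<comment> \<open>Since \<open>l \<ge> 1 / 2\<close>, powers of \<open>L\<close> are absorbed by
      powers of \<open>l\<close> at the price of a constant.\<close>
    have "L \<le> 2 * l"
    proof -
      have "l \<le> (2 * l)\<^sup>2" using l mult_right_mono[of 1 "4 * l" l] by (simp add: power2_eq_square)
      then show ?thesis unfolding L_def using l by (intro real_le_lsqrt) auto
    qed
    then have Lp: "L powr p \<le> 2 powr p * l powr p"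
      using powr_mono2[of p L "2 * l"] L0 p l by (simp add: powr_mult)
    have one: "1 \<le> 2 powr p * l powr p"
    proof -
      have "1 \<le> (2 * l) powr p" using l p by (intro ge_one_powr_ge_zero) auto
      then show ?thesis using l by (simp add: powr_mult)
    qed
    have n\<alpha>: "real n powr \<alpha> \<ge> 1"
    proof -
      have "\<alpha> \<ge> 0" using r by (simp add: \<alpha>_def field_simps)
      then show ?thesis using n by (intro ge_one_powr_ge_zero) auto
    qed
    have N1: "real n powr \<alpha> \<le> real N" unfolding N_def by linarith
    have N2: "real N \<le> 2 * real n powr \<alpha>" unfolding N_def using n\<alpha> by linarith
    have N0: "real N > 0" using N1 n\<alpha> by linarith
    have inv: "1 / real N \<le> real n powr (- \<alpha>)"
    proof -
      have "1 / real N \<le> 1 / real n powr \<alpha>" using N1 n\<alpha> N0 n by (intro divide_left_mono) auto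
      then show ?thesis by (simp add: powr_minus_divide)
    qed
    have \<tau>0: "\<tau> \<ge> 0" by (simp add: \<tau>_def)
    have "1 / real N \<le> 1 * real n powr (- \<alpha>)" using inv by simp
    also have "\<dots> \<le> (2 powr p * l powr p) * real n powr (- \<alpha>)" using one by (intro mult_right_mono) auto
    also have "\<dots> = 2 powr p * \<tau>" by (simp add: \<tau>_def)
    also have "\<dots> \<le> D * \<tau>" using \<zeta> \<tau>0 unfolding D_def by (intro mult_right_mono) auto
    finally have first: "1 / real N \<le> D * \<tau>" .
    have pointwise: "decay n (real k / real n) powr p \<le>
        3 powr p * (4 powr p * \<tau> + \<tau> + 2 powr p * l powr p * (1 / real k) powr p)" if k: "k \<in> {1..<N}" for k
    proof -
      have k0: "real k > 0" using k by simp
      have "decay n (real k / real n) = L * (real k / real n) + l / sqrt (real n) + L * (1 / real k)"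
        using n by (simp add: decay_def L_def l_def)
      also have "\<dots> powr p \<le> 3 powr p * ((L * (real k / real n)) powr p + (l / sqrt (real n)) powr p + (L * (1 / real k)) powr p)"
        using L0 l p k0 by (intro powr_sum3_le) auto
      also have "\<dots> \<le> 3 powr p * (4 powr p * \<tau> + \<tau> + 2 powr p * l powr p * (1 / real k) powr p)"
      proof (intro mult_left_mono add_mono)
        have "real k / real n \<le> (2 * real n powr \<alpha>) / real n"
          using k N2 by (intro divide_right_mono) auto
        also have "\<dots> = 2 * real n powr (\<alpha> - 1)" using n by (simp add: powr_diff)
        finally have "L * (real k / real n) \<le> (2 * l) * (2 * real n powr (\<alpha> - 1))"
          using \<open>L \<le> 2 * l\<close> l by (intro mult_mono) auto
        then have "(L * (real k / real n)) powr p \<le> ((2 * l) * (2 * real n powr (\<alpha> - 1))) powr p"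
          using L0 k0 p by (intro powr_mono2) auto
        also have "\<dots> = (4 * l * real n powr (\<alpha> - 1)) powr p" by (simp add: mult.assoc)
        also have "\<dots> = 4 powr p * l powr p * real n powr ((\<alpha> - 1) * p)"
          using l by (simp add: powr_mult powr_powr)
        also have "\<dots> = 4 powr p * \<tau>" by (simp add: \<alpha>p \<tau>_def)
        finally show "(L * (real k / real n)) powr p \<le> 4 powr p * \<tau>" .
        have "(l / sqrt (real n)) powr p = l powr p * real n powr (- (p / 2))"
          using l n by (simp add: powr_divide powr_half_sqrt[symmetric] powr_powr powr_minus_divide)
        also have "\<dots> \<le> l powr p * real n powr (- \<alpha>)"
          using \<alpha>r n by (intro mult_left_mono powr_mono) auto
        finally show "(l / sqrt (real n)) powr p \<le> \<tau>" by (simp add: \<tau>_def)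
        have "(L * (1 / real k)) powr p = L powr p * (1 / real k) powr p"
          by (rule powr_mult)
        also have "\<dots> \<le> 2 powr p * l powr p * (1 / real k) powr p" using Lp by (intro mult_right_mono) auto
        finally show "(L * (1 / real k)) powr p \<le> 2 powr p * l powr p * (1 / real k) powr p" .
      qed auto
      finally show ?thesis .
    qed
    have "(\<Sum>k\<in>{1..<N}. decay n (real k / real n) powr p) \<le>
        (\<Sum>k\<in>{1..<N}. 3 powr p * (4 powr p * \<tau> + \<tau> + 2 powr p * l powr p * (1 / real k) powr p))"
      by (rule sum_mono[OF pointwise])
    also have "\<dots> = real (N - 1) * (3 powr p * (4 powr p * \<tau> + \<tau>)) +
        3 powr p * (2 powr p * l powr p) * (\<Sum>k\<in>{1..<N}. (1 / real k) powr p)"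
      by (simp add: distrib_left sum.distrib sum_distrib_left mult.assoc)
    also have "\<dots> \<le> real N * (3 powr p * (4 powr p * \<tau> + \<tau>)) + 3 powr p * (2 powr p * l powr p) * \<zeta>"
      unfolding \<zeta>_def using \<tau>0 by (intro add_mono mult_right_mono mult_left_mono sum_inverse_powr_le p) auto
    finally have "(\<Sum>k\<in>{1..<N}. decay n (real k / real n) powr p) / real N \<le>
        (real N * (3 powr p * (4 powr p * \<tau> + \<tau>)) + 3 powr p * (2 powr p * l powr p) * \<zeta>) / real N"
      using N0 by (intro divide_right_mono) auto
    also have "\<dots> = 3 powr p * (4 powr p * \<tau> + \<tau>) + 3 powr p * (2 powr p * l powr p) * \<zeta> * (1 / real N)"
      using N0 by (simp add: add_divide_distrib)
    also have "\<dots> \<le> 3 powr p * (4 powr p * \<tau> + \<tau>) + 3 powr p * (2 powr p * l powr p) * \<zeta> * real n powr (- \<alpha>)"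
      using inv \<zeta> by (intro add_left_mono mult_left_mono) auto
    also have "\<dots> = 3 powr p * (4 powr p + 1 + 2 powr p * \<zeta>) * \<tau>" by (simp add: \<tau>_def algebra_simps)
    also have "\<dots> \<le> D * \<tau>" using \<tau>0 unfolding D_def by (intro mult_right_mono) auto
    finally have "(\<Sum>k\<in>{1..<N}. decay n (real k / real n) powr p) / real N \<le> D * \<tau>" .
    then show ?thesis using first N0 unfolding \<tau> by (intro exI[of _ N]) auto
  qed
  then show ?thesis unfolding p_def using D by (intro exI[of _ D] conjI allI impI)
qed

text \<open>The characteristic sum is bounded by the square root of
  \<open>4^n * C * decay^r\<close>, whence the exponent \<open>r / 2\<close> in the average. The
  sampled frequencies are \<open>k / n\<close>, so the spacing is \<open>\<eta> = 1 / n\<close>; the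
  function \<open>X\<close> enters only through its bilinear part between \<open>I\<close> and the
  complement.\<close>

lemma level_set_le_rate:
  fixes r :: nat and c \<kappa> \<sigma> :: real
  assumes r: "r \<ge> 3" and c: "c > 0" and \<kappa>: "\<kappa> \<ge> 0" and \<sigma>: "\<sigma> \<ge> 0"
  shows "\<exists>C>0. \<forall>n\<ge>2. \<forall>I A P \<T> K q X u v x. I \<subseteq> {..<n} \<longrightarrow>
    block_structure A r I ({..<n} - I) P \<T> K q \<longrightarrow> c * real n \<le> real (card \<T>) \<longrightarrow> c * real n \<le> real q \<longrightarrow>
    inverse_bound r P \<kappa> \<longrightarrow> (\<forall>a<r. \<forall>b<r. \<bar>P a b\<bar> \<le> \<sigma>) \<longrightarrow>
    (\<forall>V W. V \<subseteq> I \<longrightarrow> W \<subseteq> {..<n} - I \<longrightarrow> X (V \<union> W) = u V + v W +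
      (\<Sum>i\<in>I. \<Sum>j\<in>{..<n} - I. A i j * sgn_in V i * sgn_in W j)) \<longrightarrow>
    real (card {V \<in> Pow {..<n}. X V = x}) / 2 ^ n \<le> C * rate r n"
proof -
  obtain C where C: "C > 0" and bound: "\<And>n q m \<theta> P y. n \<ge> 2 \<Longrightarrow> c * real n \<le> real q \<Longrightarrow>
    c * real n \<le> real m \<Longrightarrow> q \<le> n \<Longrightarrow> \<theta> > 0 \<Longrightarrow> inverse_bound r P \<kappa> \<Longrightarrow> \<forall>a<r. \<forall>b<r. \<bar>P a b\<bar> \<le> \<sigma> \<Longrightarrow>
    (\<Sum>h\<in>PiE {..<r} (\<lambda>_. {..q}). (\<Prod>k<r. real (q choose h k) / 2 ^ q) *
      cos_weight \<theta> r m (walk_comb r q P y h)) \<le> C * decay n \<theta> ^ r"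
    using sum_binomial_cos_weight_le_decay[OF c \<kappa> \<sigma>, of r] by blast
  obtain D where D: "D > 0" and mean: "\<And>n. n \<ge> 2 \<Longrightarrow> \<exists>N>0. 1 / real N \<le> D * rate r n \<and>
    (\<Sum>k\<in>{1..<N}. decay n (real k / real n) powr (real r / 2)) / real N \<le> D * rate r n"
    using mean_decay_le_rate[OF r] by blast
  have "real (card {V \<in> Pow {..<n}. X V = x}) / 2 ^ n \<le> (D + 2 * sqrt C * D) * rate r n"
    if n: "n \<ge> 2" and I: "I \<subseteq> {..<n}" and bs: "block_structure A r I ({..<n} - I) P \<T> K q"
      and c\<T>: "c * real n \<le> real (card \<T>)" and cq: "c * real n \<le> real q" and inv: "inverse_bound r P \<kappa>"
      and P: "\<forall>a<r. \<forall>b<r. \<bar>P a b\<bar> \<le> \<sigma>"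
      and X: "\<forall>V W. V \<subseteq> I \<longrightarrow> W \<subseteq> {..<n} - I \<longrightarrow> X (V \<union> W) = u V + v W +
        (\<Sum>i\<in>I. \<Sum>j\<in>{..<n} - I. A i j * sgn_in V i * sgn_in W j)" for n I A P \<T> K q X u v x
  proof -
    have fin: "finite I" "finite ({..<n} - I)" "I \<inter> ({..<n} - I) = {}" using I finite_subset by auto
    have un: "I \<union> ({..<n} - I) = {..<n}" using I by auto
    have "c * real n > 0" using c n by simp
    then have "card \<T> > 0" using c\<T> by (metis of_nat_0_less_iff order_less_le_trans)
    then have \<T>: "\<T> \<noteq> {}" by auto
    then obtain T where "T \<in> \<T>" by blast
    then have "K T 0 \<subseteq> I \<and> card (K T 0) = q" using block_structureD(5)[OF bs, of T 0] r by simp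
    then have qn: "q \<le> n" using I card_mono[of "{..<n}" "K T 0"] by auto
    define \<phi> where "\<phi> k = 2 ^ n * (sqrt C * decay n (real k / real n) powr (real r / 2))" for k
    obtain N where N: "N > 0" and N1: "1 / real N \<le> D * rate r n"
      and N2: "(\<Sum>k\<in>{1..<N}. decay n (real k / real n) powr (real r / 2)) / real N \<le> D * rate r n"
      using mean[OF n] by blast
    have \<phi>: "cmod (\<Sum>V\<in>Pow {..<n}. cis (real k * (1 / real n) * X V)) \<le> \<phi> k" if "k > 0" for k
    proof (rule power2_le_imp_le)
      let ?d = "decay n (real k / real n)"
      have \<theta>: "real k / real n > 0" using that n by simp
      have d: "?d > 0"
      proof -
        have "ln (real n) > 0" using ln_ge_half[OF n] by linarith
        then show ?thesis unfolding decay_def using \<theta> n that by (intro add_pos_pos) auto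
      qed
      have "(cmod (\<Sum>V\<in>Pow (I \<union> ({..<n} - I)). cis (real k / real n * X V)))\<^sup>2 \<le>
          4 ^ card (I \<union> ({..<n} - I)) * (C * ?d ^ r)"
        by (rule char_sum_sq_le[OF fin X[rule_format] bs \<T>]) (assumption | rule bound[OF n cq c\<T> qn \<theta> inv P])+
      then have "(cmod (\<Sum>V\<in>Pow {..<n}. cis (real k * (1 / real n) * X V)))\<^sup>2 \<le> 4 ^ n * (C * ?d ^ r)"
        unfolding un by simp
      also have "\<dots> = (\<phi> k)\<^sup>2"
      proof -
        have "(?d powr (real r / 2))\<^sup>2 = ?d ^ r"
          using d by (simp add: power2_eq_square powr_realpow flip: powr_add)
        moreover have "((2::real) ^ n)\<^sup>2 = 4 ^ n" by (simp add: power2_eq_square flip: power_mult_distrib)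
        ultimately show ?thesis using C by (simp add: \<phi>_def power_mult_distrib)
      qed
      finally show "(cmod (\<Sum>V\<in>Pow {..<n}. cis (real k * (1 / real n) * X V)))\<^sup>2 \<le> (\<phi> k)\<^sup>2" .
      show "0 \<le> \<phi> k" using C by (simp add: \<phi>_def)
    qed
    have "real N * real (card {V \<in> Pow {..<n}. X V = x}) \<le> real (card (Pow {..<n})) + 2 * (\<Sum>k\<in>{1..<N}. \<phi> k)"
      by (rule card_level_set_le[OF _ N, where \<eta> = "1 / real n"]) (use \<phi> in auto)
    also have "\<dots> = 2 ^ n * (1 + 2 * sqrt C * (\<Sum>k\<in>{1..<N}. decay n (real k / real n) powr (real r / 2)))"
      by (simp add: \<phi>_def card_Pow sum_distrib_left[symmetric] distrib_left mult_ac)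
    finally have "real (card {V \<in> Pow {..<n}. X V = x}) / 2 ^ n \<le>
        1 / real N + 2 * sqrt C * ((\<Sum>k\<in>{1..<N}. decay n (real k / real n) powr (real r / 2)) / real N)"
      using N by (simp add: field_simps)
    also have "\<dots> \<le> D * rate r n + 2 * sqrt C * (D * rate r n)"
      using N1 N2 C by (intro add_mono mult_left_mono) auto
    finally show ?thesis by (simp add: algebra_simps)
  qed
  moreover have "D + 2 * sqrt C * D > 0" using C D by (simp add: add_pos_nonneg)
  ultimately show ?thesis by (intro exI[of _ "D + 2 * sqrt C * D"] conjI allI impI)
qed

section \<open>Quadratic polynomials of Rademacher variables\<close>

definition unit_mon :: "nat \<Rightarrow> nat \<Rightarrow>\<^sub>0 nat" where
  "unit_mon i = Poly_Mapping.single i 1"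

lemma lookup_unit_mon: "Poly_Mapping.lookup (unit_mon i) j = (if i = j then 1 else 0)"
  by (simp add: unit_mon_def lookup_single when_def)

lemma keys_unit_mon: "Poly_Mapping.keys (unit_mon i) = {i}"
  by (simp add: unit_mon_def)

lemma unit_mon_eq_iff: "unit_mon i = unit_mon j \<longleftrightarrow> i = j"
  by (metis keys_unit_mon singleton_inject)

lemma unit_mon_add_eq_iff:
  "unit_mon i + unit_mon j = unit_mon a + unit_mon b \<longleftrightarrow> (i = a \<and> j = b) \<or> (i = b \<and> j = a)"
  unfolding unit_mon_def by (rule single_add_single_eq_iff)

lemma monom_degree_0D:
  assumes "monom_degree m = 0"
  shows "m = 0"
proof -
  have "\<forall>i\<in>Poly_Mapping.keys m. Poly_Mapping.lookup m i = 0"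
    using assms by (simp add: monom_degree_def)
  then have "Poly_Mapping.lookup m i = 0" for i by (cases "i \<in> Poly_Mapping.keys m") (auto simp: in_keys_iff)
  then show ?thesis by (intro poly_mapping_eqI) simp
qed

lemma monom_degree_1D:
  assumes "monom_degree m = 1"
  shows "\<exists>i. m = unit_mon i"
proof -
  have "(\<Sum>i\<in>Poly_Mapping.keys m. Poly_Mapping.lookup m i) = 1" using assms by (simp add: monom_degree_def)
  then obtain i where i: "i \<in> Poly_Mapping.keys m" "Poly_Mapping.lookup m i = 1"
    and z: "\<forall>j\<in>Poly_Mapping.keys m. i \<noteq> j \<longrightarrow> Poly_Mapping.lookup m j = 0"
    unfolding sum_eq_1_iff[OF finite_keys] by blast
  have "m = unit_mon i"
  proof (rule poly_mapping_eqI)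
    fix j show "Poly_Mapping.lookup m j = Poly_Mapping.lookup (unit_mon i) j"
      using i z by (cases "j \<in> Poly_Mapping.keys m") (auto simp: lookup_unit_mon in_keys_iff)
  qed
  then show ?thesis ..
qed

definition quad_monomials :: "nat \<Rightarrow> (nat \<Rightarrow>\<^sub>0 nat) set" where
  "quad_monomials n = insert 0 (unit_mon ` {..<n} \<union> (\<lambda>(i, j). unit_mon i + unit_mon j) ` {(i, j). i \<le> j \<and> j < n})"

lemma finite_pairs_le: "finite {(i, j). i \<le> j \<and> j < (n::nat)}"
  by (rule finite_subset[of _ "{..<n} \<times> {..<n}"]) auto

lemma keys_unit_mon_add: "Poly_Mapping.keys (unit_mon i + unit_mon j) = {i, j}"
  by (auto simp: in_keys_iff lookup_add lookup_unit_mon split: if_splits)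

lemma quadratic_coeff_outside:
  assumes f: "f \<in> quadratic_polys n" and m: "m \<notin> quad_monomials n"
  shows "coeff_of f m = 0"
proof (rule ccontr)
  assume "coeff_of f m \<noteq> 0"
  then have "m \<in> Poly_Mapping.keys f" by (simp add: coeff_of_def in_keys_iff)
  then have sub: "Poly_Mapping.keys m \<subseteq> {..<n}" and deg: "monom_degree m \<le> 2"
    using f by (auto simp: quadratic_polys_def mpolys_def)
  consider "monom_degree m = 0" | "monom_degree m = 1" | "monom_degree m = 2" using deg by linarith
  then show False
  proof cases
    case 1
    then show False using m monom_degree_0D by (auto simp: quad_monomials_def)
  next
    case 2
    then obtain i where "m = unit_mon i" using monom_degree_1D by blast
    then show False using m sub by (auto simp: quad_monomials_def keys_unit_mon)
  next
    case 3
    then obtain a b where ab: "m = unit_mon a + unit_mon b" using monom_degree_2D[folded unit_mon_def] by blast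
    then have "a < n" "b < n" using sub by (auto simp: keys_unit_mon_add)
    then have "(min a b, max a b) \<in> {(i, j). i \<le> j \<and> j < n}" by auto
    moreover have "m = unit_mon (min a b) + unit_mon (max a b)"
      using ab by (simp add: min_def max_def add.commute)
    ultimately have "m \<in> (\<lambda>(i, j). unit_mon i + unit_mon j) ` {(i, j). i \<le> j \<and> j < n}"
      by (intro image_eqI[of _ _ "(min a b, max a b)"]) auto
    then show False using m by (simp add: quad_monomials_def)
  qed
qed

lemma sum_quad_monomials:
  "(\<Sum>m\<in>quad_monomials n. g m) =
    g 0 + (\<Sum>i<n. g (unit_mon i)) + (\<Sum>(i, j)\<in>{(i, j). i \<le> j \<and> j < n}. g (unit_mon i + unit_mon j))"
proof -
  let ?L = "unit_mon ` {..<n}" and ?Q = "(\<lambda>(i, j). unit_mon i + unit_mon j) ` {(i, j). i \<le> j \<and> j < n}"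
  have deg: "monom_degree (0 :: nat \<Rightarrow>\<^sub>0 nat) = 0" "monom_degree (unit_mon i) = 1"
    "monom_degree (unit_mon i + unit_mon j) = 2" for i j
  proof -
    show "monom_degree (0 :: nat \<Rightarrow>\<^sub>0 nat) = 0" by (simp add: monom_degree_def)
    show "monom_degree (unit_mon i) = 1" by (simp add: monom_degree_def keys_unit_mon lookup_unit_mon)
    show "monom_degree (unit_mon i + unit_mon j) = 2"
      unfolding monom_degree_def keys_unit_mon_add
      by (cases "i = j") (auto simp: lookup_add lookup_unit_mon)
  qed
  have fin: "finite ?L" "finite ?Q" using finite_pairs_le by auto
  have dL: "monom_degree m = 1" if "m \<in> ?L" for m using that deg(2) by auto
  have dQ: "monom_degree m = 2" if "m \<in> ?Q" for m using that deg(3) by auto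
  have dis: "?L \<inter> ?Q = {}" using dL dQ by fastforce
  have "0 \<notin> ?L \<union> ?Q"
  proof
    assume "0 \<in> ?L \<union> ?Q"
    then have "monom_degree (0 :: nat \<Rightarrow>\<^sub>0 nat) \<in> {1, 2}" using dL dQ by blast
    then show False using deg(1) by simp
  qed
  then have "(\<Sum>m\<in>quad_monomials n. g m) = g 0 + (\<Sum>m\<in>?L \<union> ?Q. g m)"
    unfolding quad_monomials_def using fin by (subst sum.insert) auto
  also have "(\<Sum>m\<in>?L \<union> ?Q. g m) = (\<Sum>m\<in>?L. g m) + (\<Sum>m\<in>?Q. g m)"
    by (rule sum.union_disjoint[OF fin dis])
  also have "(\<Sum>m\<in>?L. g m) = (\<Sum>i<n. g (unit_mon i))"
    by (subst sum.reindex) (auto simp: inj_on_def unit_mon_eq_iff)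
  also have "(\<Sum>m\<in>?Q. g m) = (\<Sum>(i, j)\<in>{(i, j). i \<le> j \<and> j < n}. g (unit_mon i + unit_mon j))"
    by (subst sum.reindex) (auto simp: inj_on_def unit_mon_add_eq_iff intro!: sum.cong)
  finally show ?thesis by (simp add: add.assoc)
qed

lemma mpoly_eval_quadratic:
  fixes f :: "'a::comm_semiring_1 mpoly"
  assumes f: "f \<in> quadratic_polys n"
  shows "mpoly_eval f x = coeff_of f 0 + (\<Sum>i<n. coeff_of f (unit_mon i) * x i) +
    (\<Sum>(i, j)\<in>{(i, j). i \<le> j \<and> j < n}. coeff_of f (unit_mon i + unit_mon j) * (x i * x j))"
proof -
  define e where "e m = (\<Prod>i\<in>Poly_Mapping.keys m. x i ^ Poly_Mapping.lookup m i)" for m :: "nat \<Rightarrow>\<^sub>0 nat"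
  have fin: "finite (quad_monomials n)" using finite_pairs_le by (simp add: quad_monomials_def)
  have sub: "Poly_Mapping.keys f \<subseteq> quad_monomials n"
    using quadratic_coeff_outside[OF f] by (auto simp: coeff_of_def in_keys_iff)
  have "mpoly_eval f x = (\<Sum>m\<in>Poly_Mapping.keys f. coeff_of f m * e m)"
    by (simp add: mpoly_eval_def e_def)
  also have "\<dots> = (\<Sum>m\<in>quad_monomials n. coeff_of f m * e m)"
    by (rule sum.mono_neutral_left[OF fin sub]) (auto simp: coeff_of_def in_keys_iff)
  also have "\<dots> = coeff_of f 0 * e 0 + (\<Sum>i<n. coeff_of f (unit_mon i) * e (unit_mon i)) +
      (\<Sum>(i, j)\<in>{(i, j). i \<le> j \<and> j < n}. coeff_of f (unit_mon i + unit_mon j) * e (unit_mon i + unit_mon j))"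
    by (rule sum_quad_monomials)
  also have "e 0 = 1" by (simp add: e_def)
  also have "(\<lambda>i. coeff_of f (unit_mon i) * e (unit_mon i)) = (\<lambda>i. coeff_of f (unit_mon i) * x i)"
    by (simp add: e_def fun_eq_iff keys_unit_mon lookup_unit_mon)
  also have "(\<lambda>(i, j). coeff_of f (unit_mon i + unit_mon j) * e (unit_mon i + unit_mon j)) =
      (\<lambda>(i, j). coeff_of f (unit_mon i + unit_mon j) * (x i * x j))"
  proof -
    have "e (unit_mon i + unit_mon j) = x i * x j" for i j
      unfolding e_def keys_unit_mon_add
      by (cases "i = j") (auto simp: lookup_add lookup_unit_mon power2_eq_square)
    then show ?thesis by simp
  qed
  finally show ?thesis by simp
qed

lemma sum_pairs_le_symmetric:
  fixes g :: "nat \<Rightarrow> nat \<Rightarrow> real"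
  assumes "\<And>i j. i < n \<Longrightarrow> j < n \<Longrightarrow> g i j = g j i"
  shows "(\<Sum>(i, j)\<in>{(i, j). i \<le> j \<and> j < n}. g i j) = (\<Sum>i<n. \<Sum>j<n. g i j) / 2 + (\<Sum>i<n. g i i) / 2"
proof -
  let ?D = "{(i, j). i = j \<and> j < n}" and ?U = "{(i, j). i < j \<and> j < n}" and ?L = "{(i, j). j < i \<and> i < n}"
  have fin: "finite ?D" "finite ?U" "finite ?L"
    by (rule finite_subset[of _ "{..<n} \<times> {..<n}"]; force)+
  have D: "(\<Sum>(i, j)\<in>?D. g i j) = (\<Sum>i<n. g i i)"
    by (rule sum.reindex_bij_witness[of _ "\<lambda>i. (i, i)" fst]) auto
  have L: "(\<Sum>(i, j)\<in>?L. g i j) = (\<Sum>(i, j)\<in>?U. g i j)"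
    by (rule sum.reindex_bij_witness[of _ prod.swap prod.swap]) (auto intro!: assms)
  have "{(i, j). i \<le> j \<and> j < n} = ?D \<union> ?U" by auto
  then have 1: "(\<Sum>(i, j)\<in>{(i, j). i \<le> j \<and> j < n}. g i j) = (\<Sum>(i, j)\<in>?D. g i j) + (\<Sum>(i, j)\<in>?U. g i j)"
    using fin by (simp only:) (rule sum.union_disjoint, auto)
  have "(\<Sum>i<n. \<Sum>j<n. g i j) = (\<Sum>(i, j)\<in>{..<n} \<times> {..<n}. g i j)" by (rule sum.cartesian_product)
  also have "{..<n} \<times> {..<n} = (?D \<union> ?U) \<union> ?L" by auto
  also have "(\<Sum>(i, j)\<in>(?D \<union> ?U) \<union> ?L. g i j) = (\<Sum>(i, j)\<in>?D \<union> ?U. g i j) + (\<Sum>(i, j)\<in>?L. g i j)"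
    using fin by (intro sum.union_disjoint) auto
  also have "(\<Sum>(i, j)\<in>?D \<union> ?U. g i j) = (\<Sum>(i, j)\<in>?D. g i j) + (\<Sum>(i, j)\<in>?U. g i j)"
    using fin by (intro sum.union_disjoint) auto
  finally show ?thesis using 1 D L by linarith
qed

text \<open>Terms inside \<open>I\<close> go to \<open>u\<close>, terms inside the complement to
  \<open>v\<close>. In the symmetric double sum each cross term appears twice, which compensates the
  factor \<open>1 / 2\<close>, and the diagonal is constant because signs square to 1.\<close>

lemma quadratic_split:
  fixes a :: "nat \<Rightarrow> nat \<Rightarrow> real"
  assumes sym: "\<And>i j. i < n \<Longrightarrow> j < n \<Longrightarrow> a i j = a j i" and I: "I \<subseteq> {..<n}"
    and X: "\<And>V. X V = c + (\<Sum>i<n. b i * sgn_in V i) +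
      (\<Sum>(i, j)\<in>{(i, j). i \<le> j \<and> j < n}. a i j * (sgn_in V i * sgn_in V j))"
  shows "\<exists>u v. \<forall>V W. V \<subseteq> I \<longrightarrow> W \<subseteq> {..<n} - I \<longrightarrow> X (V \<union> W) = u V + v W +
      (\<Sum>i\<in>I. \<Sum>j\<in>{..<n} - I. a i j * sgn_in V i * sgn_in W j)"
proof -
  define J where "J = {..<n} - I"
  define u where "u V = c + (\<Sum>i\<in>I. b i * sgn_in V i) +
    (\<Sum>i\<in>I. \<Sum>j\<in>I. a i j * (sgn_in V i * sgn_in V j)) / 2 + (\<Sum>i<n. a i i) / 2" for V
  define v where "v W = (\<Sum>i\<in>J. b i * sgn_in W i) + (\<Sum>i\<in>J. \<Sum>j\<in>J. a i j * (sgn_in W i * sgn_in W j)) / 2" for W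
  have fin: "finite I" "finite J" "I \<inter> J = {}" using I finite_subset by (auto simp: J_def)
  have un: "{..<n} = I \<union> J" using I by (auto simp: J_def)
  have split: "(\<Sum>i<n. g i) = (\<Sum>i\<in>I. g i) + (\<Sum>i\<in>J. g i)" for g :: "nat \<Rightarrow> real"
    unfolding un by (rule sum.union_disjoint[OF fin])
  have "X (V \<union> W) = u V + v W + (\<Sum>i\<in>I. \<Sum>j\<in>J. a i j * sgn_in V i * sgn_in W j)"
    if V: "V \<subseteq> I" and W: "W \<subseteq> J" for V W
  proof -
    let ?s = "sgn_in (V \<union> W)"
    have sI: "?s i = sgn_in V i" if "i \<in> I" for i using that W fin(3) by (auto simp: sgn_in_def)
    have sJ: "?s i = sgn_in W i" if "i \<in> J" for i using that V fin(3) by (auto simp: sgn_in_def)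
    have sq: "?s i * ?s i = 1" for i by (simp add: sgn_in_def)
    have lin: "(\<Sum>i<n. b i * ?s i) = (\<Sum>i\<in>I. b i * sgn_in V i) + (\<Sum>i\<in>J. b i * sgn_in W i)"
      unfolding split using sI sJ by simp
    have "(\<Sum>i<n. \<Sum>j<n. a i j * (?s i * ?s j)) =
        (\<Sum>i\<in>I. \<Sum>j\<in>I. a i j * (?s i * ?s j)) + (\<Sum>i\<in>I. \<Sum>j\<in>J. a i j * (?s i * ?s j)) +
        ((\<Sum>i\<in>J. \<Sum>j\<in>I. a i j * (?s i * ?s j)) + (\<Sum>i\<in>J. \<Sum>j\<in>J. a i j * (?s i * ?s j)))"
      unfolding split by (simp add: sum.distrib)
    also have "(\<Sum>i\<in>J. \<Sum>j\<in>I. a i j * (?s i * ?s j)) = (\<Sum>j\<in>I. \<Sum>i\<in>J. a i j * (?s i * ?s j))"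
      by (rule sum.swap)
    also have "\<dots> = (\<Sum>i\<in>I. \<Sum>j\<in>J. a i j * (?s i * ?s j))"
      using un by (intro sum.cong refl) (simp add: sym[of _ _] mult.commute set_eq_iff)
    also have "(\<Sum>i\<in>I. \<Sum>j\<in>I. a i j * (?s i * ?s j)) = (\<Sum>i\<in>I. \<Sum>j\<in>I. a i j * (sgn_in V i * sgn_in V j))"
      using sI by simp
    also have "(\<Sum>i\<in>J. \<Sum>j\<in>J. a i j * (?s i * ?s j)) = (\<Sum>i\<in>J. \<Sum>j\<in>J. a i j * (sgn_in W i * sgn_in W j))"
      using sJ by simp
    also have "(\<Sum>i\<in>I. \<Sum>j\<in>J. a i j * (?s i * ?s j)) = (\<Sum>i\<in>I. \<Sum>j\<in>J. a i j * sgn_in V i * sgn_in W j)"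
      using sI sJ by (simp add: mult.assoc)
    finally have quad: "(\<Sum>i<n. \<Sum>j<n. a i j * (?s i * ?s j)) =
        (\<Sum>i\<in>I. \<Sum>j\<in>I. a i j * (sgn_in V i * sgn_in V j)) + (\<Sum>i\<in>I. \<Sum>j\<in>J. a i j * sgn_in V i * sgn_in W j) +
        ((\<Sum>i\<in>I. \<Sum>j\<in>J. a i j * sgn_in V i * sgn_in W j) + (\<Sum>i\<in>J. \<Sum>j\<in>J. a i j * (sgn_in W i * sgn_in W j)))" .
    have "(\<Sum>(i, j)\<in>{(i, j). i \<le> j \<and> j < n}. a i j * (?s i * ?s j)) =
        (\<Sum>i<n. \<Sum>j<n. a i j * (?s i * ?s j)) / 2 + (\<Sum>i<n. a i i * (?s i * ?s i)) / 2"
      by (rule sum_pairs_le_symmetric) (simp add: sym mult.commute)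
    then show ?thesis unfolding X lin quad u_def v_def sq by (simp add: add_divide_distrib)
  qed
  then show ?thesis unfolding J_def by (intro exI[of _ u] exI[of _ v] allI impI)
qed

text \<open>The value 0 from index \<open>n\<close> on is the dummy value of
  \<open>rademacher_seq\<close>, so that the subsets of \<open>{..<n}\<close> correspond exactly to
  the outcomes.\<close>

definition sign_vector :: "nat \<Rightarrow> nat set \<Rightarrow> nat \<Rightarrow> 'a::ring_1" where
  "sign_vector n V i = (if i < n then if i \<in> V then 1 else - 1 else 0)"

lemma bij_betw_sign_vector:
  "bij_betw (sign_vector n) (Pow {..<n}) (PiE_dflt {..<n} (0 :: 'a::field_char_0) (\<lambda>_. {1, - 1}))"
proof (rule bij_betwI[where g = "\<lambda>\<xi>. {i. i < n \<and> \<xi> i = 1}"])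
  show "sign_vector n (({i. i < n \<and> \<xi> i = 1})) = \<xi>" if "\<xi> \<in> PiE_dflt {..<n} (0 :: 'a) (\<lambda>_. {1, - 1})" for \<xi>
    using that by (auto simp: PiE_dflt_def sign_vector_def fun_eq_iff)
qed (auto simp: PiE_dflt_def sign_vector_def split: if_splits)

lemma prob_rademacher_seq:
  "measure_pmf.prob (rademacher_seq n :: (nat \<Rightarrow> 'a::field_char_0) pmf) {\<xi>. Q \<xi>} =
    real (card {V \<in> Pow {..<n}. Q (sign_vector n V)}) / 2 ^ n"
proof -
  let ?\<Omega> = "PiE_dflt {..<n} (0 :: 'a) (\<lambda>_. {1, - 1})"
  have bij: "bij_betw (sign_vector n) (Pow {..<n}) ?\<Omega>" by (rule bij_betw_sign_vector)
  have fin: "finite ?\<Omega>" using bij bij_betw_finite by blast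
  have card: "card ?\<Omega> = 2 ^ n" using bij_betw_same_card[OF bij] by (simp add: card_Pow)
  then have ne: "?\<Omega> \<noteq> {}" by auto
  have "rademacher_seq n = pmf_of_set ?\<Omega>"
    unfolding rademacher_seq_def by (rule Pi_pmf_of_set) auto
  then have "measure_pmf.prob (rademacher_seq n) {\<xi>. Q \<xi>} = real (card (?\<Omega> \<inter> {\<xi>. Q \<xi>})) / real (card ?\<Omega>)"
    by (simp add: measure_pmf_of_set[OF ne fin])
  also have "?\<Omega> \<inter> {\<xi>. Q \<xi>} = sign_vector n ` {V \<in> Pow {..<n}. Q (sign_vector n V)}"
    using bij_betw_imp_surj_on[OF bij] by auto
  also have "card \<dots> = card {V \<in> Pow {..<n}. Q (sign_vector n V)}"
    by (rule card_image) (rule inj_on_subset[OF bij_betw_imp_inj_on[OF bij]], auto)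
  finally show ?thesis by (simp add: card)
qed

text \<open>Coefficients are only multiplied by signs, so additivity alone carries
  \<open>lam\<close> through the evaluation. This admits maps such as
  \<open>z \<mapsto> Re z + y * Im z\<close>, which are not multiplicative.\<close>

lemma additive_eval_sign_vector:
  fixes f :: "'a::field_char_0 mpoly" and lam :: "'a \<Rightarrow> real"
  assumes f: "f \<in> quadratic_polys n" and lam: "\<And>x y. lam (x + y) = lam x + lam y"
  shows "lam (mpoly_eval f (sign_vector n V)) =
    lam (coeff_of f 0) + (\<Sum>i<n. lam (coeff_of f (unit_mon i)) * sgn_in V i) +
    (\<Sum>(i, j)\<in>{(i, j). i \<le> j \<and> j < n}. lam (coeff_of f (unit_mon i + unit_mon j)) * (sgn_in V i * sgn_in V j))"
proof -
  interpret additive lam by standard (rule lam)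
  have 1: "lam (c * sign_vector n V i) = lam c * sgn_in V i" if "i < n" for c i
    using that by (simp add: sign_vector_def sgn_in_def minus)
  have 2: "lam (c * (sign_vector n V i * sign_vector n V j)) = lam c * (sgn_in V i * sgn_in V j)"
    if "i < n" "j < n" for c i j
    using that by (simp add: sign_vector_def sgn_in_def minus)
  show ?thesis
    unfolding mpoly_eval_quadratic[OF f] add sum case_prod_unfold
    by (intro arg_cong2[where f = "(+)"] refl sum.cong) (auto simp: 1 2)
qed

section \<open>The inverse theorem\<close>

text \<open>Multiplying \<open>d P\<close> by the adjugate recovers \<open>d\<close> times the
  determinant \<open>D\<close>, so the sum of the absolute entries of the adjugate divided by
  \<open>|D|\<close> serves as \<open>\<kappa>\<close>.\<close>

lemma inverse_bound_exists:
  fixes P :: "nat \<Rightarrow> nat \<Rightarrow> real"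
  assumes det: "Determinant.det (mat r r (\<lambda>(a, b). P a b)) \<noteq> 0"
  shows "\<exists>\<kappa>. inverse_bound r P \<kappa>"
proof -
  define M where "M = mat r r (\<lambda>(a, b). P a b)"
  define N where "N = adj_mat M"
  define D where "D = Determinant.det M"
  have M: "M \<in> carrier_mat r r" by (simp add: M_def)
  have N: "N \<in> carrier_mat r r" "M * N = D \<cdot>\<^sub>m 1\<^sub>m r" using adj_mat[OF M] by (simp_all add: N_def D_def)
  have D: "D \<noteq> 0" using det by (simp add: D_def M_def)
  have PN: "(\<Sum>b<r. P a b * N $$ (b, a')) = (if a = a' then D else 0)" if a: "a < r" "a' < r" for a a'
  proof -
    have "(M * N) $$ (a, a') = row M a \<bullet> col N a'" using a M N(1) by simp
    also have "\<dots> = (\<Sum>b<r. P a b * N $$ (b, a'))"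
      using a N(1) by (simp add: scalar_prod_def M_def lessThan_atLeast0)
    finally have "(\<Sum>b<r. P a b * N $$ (b, a')) = (M * N) $$ (a, a')" ..
    also have "\<dots> = (if a = a' then D else 0)" using a by (simp add: N(2))
    finally show ?thesis .
  qed
  define s where "s = (\<Sum>a<r. \<Sum>b<r. \<bar>N $$ (b, a)\<bar>)"
  have "\<bar>d a\<bar> \<le> s / \<bar>D\<bar> * e" if e: "\<forall>b<r. \<bar>\<Sum>a<r. d a * P a b\<bar> \<le> e" and a: "a < r" for d e a
  proof -
    have "\<bar>\<Sum>a'<r. d a' * P a' a\<bar> \<le> e" using e a by blast
    then have e0: "e \<ge> 0" by linarith
    have "d a * D = (\<Sum>a'<r. d a' * (if a' = a then D else 0))" using a by (simp add: if_distrib cong: if_cong)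
    also have "\<dots> = (\<Sum>a'<r. d a' * (\<Sum>b<r. P a' b * N $$ (b, a)))"
      using PN a by (intro sum.cong refl) simp
    also have "\<dots> = (\<Sum>a'<r. \<Sum>b<r. d a' * P a' b * N $$ (b, a))" by (simp add: sum_distrib_left mult.assoc)
    also have "\<dots> = (\<Sum>b<r. \<Sum>a'<r. d a' * P a' b * N $$ (b, a))" by (rule sum.swap)
    also have "\<dots> = (\<Sum>b<r. (\<Sum>a'<r. d a' * P a' b) * N $$ (b, a))" by (simp add: sum_distrib_right)
    finally have "\<bar>d a\<bar> * \<bar>D\<bar> = \<bar>\<Sum>b<r. (\<Sum>a'<r. d a' * P a' b) * N $$ (b, a)\<bar>" by (metis abs_mult)
    also have "\<dots> \<le> (\<Sum>b<r. \<bar>(\<Sum>a'<r. d a' * P a' b) * N $$ (b, a)\<bar>)" by (rule sum_abs)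
    also have "\<dots> \<le> (\<Sum>b<r. e * \<bar>N $$ (b, a)\<bar>)"
      using e by (intro sum_mono) (auto simp: abs_mult intro!: mult_right_mono)
    also have "\<dots> = e * (\<Sum>b<r. \<bar>N $$ (b, a)\<bar>)" by (simp add: sum_distrib_left)
    also have "\<dots> \<le> e * s"
      unfolding s_def using a e0
      by (intro mult_left_mono member_le_sum[of a "{..<r}" "\<lambda>a. \<Sum>b<r. \<bar>N $$ (b, a)\<bar>"]) (auto intro: sum_nonneg)
    finally show ?thesis using D by (simp add: field_simps)
  qed
  moreover have "s / \<bar>D\<bar> \<ge> 0" by (simp add: s_def sum_nonneg)
  ultimately show ?thesis unfolding inverse_bound_def by blast
qed

lemma inverse_bound_mono:
  assumes "inverse_bound r P \<kappa>" "\<kappa> \<le> \<kappa>'"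
  shows "inverse_bound r P \<kappa>'"
  unfolding inverse_bound_def
proof (intro conjI allI impI)
  show "\<kappa>' \<ge> 0" using assms by (simp add: inverse_bound_def)
  fix d e a assume e: "\<forall>b<r. \<bar>\<Sum>a<r. d a * P a b\<bar> \<le> e" and a: "a < r"
  have "\<bar>\<Sum>a'<r. d a' * P a' a\<bar> \<le> e" using e a by blast
  then have "e \<ge> 0" by linarith
  have "\<bar>d a\<bar> \<le> \<kappa> * e" using assms(1) e a by (simp add: inverse_bound_def)
  also have "\<dots> \<le> \<kappa>' * e" using assms(2) \<open>e \<ge> 0\<close> by (rule mult_right_mono)
  finally show "\<bar>d a\<bar> \<le> \<kappa>' * e" .
qed

lemma rank_le_if_sum_products:
  fixes X W :: "nat \<Rightarrow> nat \<Rightarrow> 'a::field"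
  shows "vec_space.rank n (mat n n (\<lambda>(i, j). \<Sum>b<k. X i b * W b j)) \<le> k"
proof (induction k)
  case 0
  have eq: "mat n n (\<lambda>(i, j). \<Sum>b<0. X i b * W b j) = 0\<^sub>m n n" by (rule eq_matI) auto
  show ?case unfolding eq vec_space.rank_0I ..
next
  case (Suc k)
  let ?R = "mat n n (\<lambda>(i, j). X i k * W k j)"
  have "mat n n (\<lambda>(i, j). \<Sum>b<Suc k. X i b * W b j) = mat n n (\<lambda>(i, j). \<Sum>b<k. X i b * W b j) + ?R"
    by (rule eq_matI) auto
  moreover have "vec_space.rank n ?R \<le> 1"
    by (rule vec_space.rank_le_1_product_entries[where f = "\<lambda>i. X i k" and g = "\<lambda>j. W k j"]) auto
  ultimately show ?case
    using Suc.IH vec_space.rank_subadditive[of "mat n n (\<lambda>(i, j). \<Sum>b<k. X i b * W b j)" n n ?R] by simp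
qed

text \<open>Off the diagonal this is the full coefficient of the monomial, twice the entry of the
  symmetric matrix of the quadratic part, so that its entries lie in any set containing the degree-2
  coefficients.\<close>

definition coeff_matrix :: "'a::zero mpoly \<Rightarrow> nat \<Rightarrow> nat \<Rightarrow> 'a" where
  "coeff_matrix f i j = coeff_of f (unit_mon i + unit_mon j)"

lemma symm_valued_coeff_matrix:
  assumes "deg2_coeffs n f \<subseteq> S"
  shows "symm_valued S n (coeff_matrix f)"
  unfolding symm_valued_def
proof (intro allI impI conjI)
  fix i j assume ij: "i < n" "j < n"
  show sym: "coeff_matrix f i j = coeff_matrix f j i" by (simp add: coeff_matrix_def add.commute)
  have "coeff_matrix f a b \<in> S" if "a \<le> b" "b < n" for a b
    using assms that unfolding deg2_coeffs_def coeff_matrix_def unit_mon_def by blast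
  then show "coeff_matrix f i j \<in> S" using ij sym by (cases "i \<le> j") (simp_all, metis nat_le_linear)
qed

text \<open>With the matrix \<open>B / 2\<close> the form has the off-diagonal coefficients
  \<open>B i j\<close>. On the diagonal it has \<open>B i i / 2\<close>, which may differ from
  \<open>f\<close> throughout; together with the linear terms and the constant this costs at most
  \<open>2 * n + 1\<close> coefficients.\<close>

lemma quadratic_form_if_near_low_rank:
  fixes f :: "'a::field_char_0 mpoly"
  assumes f: "f \<in> quadratic_polys n" and near: "near_low_rank (coeff_matrix f) n k \<epsilon>"
  shows "\<exists>h\<in>quadratic_forms n. form_rank n h \<le> k \<and> real (num_diff_coeffs f h) \<le> \<epsilon> * (real n)\<^sup>2 + 2 * real n + 1"
proof -
  obtain B X W where sym: "\<And>i j. i < n \<Longrightarrow> j < n \<Longrightarrow> B i j = B j i"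
    and B: "\<And>i j. i < n \<Longrightarrow> j < n \<Longrightarrow> B i j = (\<Sum>b<k. X i b * W b j)"
    and diff: "real (card {(i, j). i < n \<and> j < n \<and> coeff_matrix f i j \<noteq> B i j}) \<le> \<epsilon> * (real n)\<^sup>2"
    using near unfolding near_low_rank_def by blast
  define Q where "Q = mat n n (\<lambda>(i, j). B i j / 2)"
  define h where "h = matrix_form n Q"
  have h: "h \<in> quadratic_forms n" unfolding h_def by (rule matrix_form_in_quadratic_forms)
  have Q: "represents_form n Q h"
  proof -
    have "transpose_mat Q = Q" by (rule eq_matI) (auto simp: Q_def sym)
    then show ?thesis by (simp add: represents_form_def Q_def h_def)
  qed
  have "(THE Q. represents_form n Q h) = Q" using ex1_represents_form[OF h] Q by (rule the1_equality)
  then have "form_rank n h = vec_space.rank n Q" by (simp add: form_rank_def)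
  also have "Q = mat n n (\<lambda>(i, j). \<Sum>b<k. (X i b / 2) * W b j)"
    by (rule eq_matI) (auto simp: Q_def B sum_divide_distrib)
  also have "vec_space.rank n \<dots> \<le> k" by (rule rank_le_if_sum_products)
  finally have rank: "form_rank n h \<le> k" .
  let ?E = "{(i, j). i < n \<and> j < n \<and> coeff_matrix f i j \<noteq> B i j}"
  let ?U = "(\<lambda>(i, j). unit_mon i + unit_mon j) ` ?E \<union> ((\<lambda>i. unit_mon i + unit_mon i) ` {..<n} \<union> (unit_mon ` {..<n} \<union> {0}))"
  have finE: "finite ?E" by (rule finite_subset[of _ "{..<n} \<times> {..<n}"]) auto
  have "{m. coeff_of f m \<noteq> coeff_of h m} \<subseteq> ?U"
  proof
    fix m assume "m \<in> {m. coeff_of f m \<noteq> coeff_of h m}"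
    then have ne: "coeff_of f m \<noteq> coeff_of h m" by simp
    have h2: "h \<in> quadratic_polys n" using h by (auto simp: quadratic_forms_def quadratic_polys_def)
    have "m \<in> quad_monomials n"
    proof (rule ccontr)
      assume "m \<notin> quad_monomials n"
      then show False using ne quadratic_coeff_outside[OF f] quadratic_coeff_outside[OF h2] by simp
    qed
    then have "m = 0 \<or> m \<in> unit_mon ` {..<n} \<or> (\<exists>i j. m = unit_mon i + unit_mon j \<and> i \<le> j \<and> j < n)"
      unfolding quad_monomials_def by auto
    then consider "m = 0" | "m \<in> unit_mon ` {..<n}" | i j where "m = unit_mon i + unit_mon j" "i \<le> j" "j < n"
      by blast
    then show "m \<in> ?U"
    proof cases
      case (3 i j)
      show ?thesis
      proof (cases "i = j")
        case True
        then show ?thesis using 3 by blast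
      next
        case False
        have "coeff_of h m = Q $$ (i, j) + Q $$ (j, i)"
          unfolding h_def 3(1) unit_mon_def using 3 False by (subst coeff_of_matrix_form) auto
        also have "\<dots> = B i j" using 3 sym[of i j] by (simp add: Q_def)
        finally have "(i, j) \<in> ?E" using ne 3 by (auto simp: coeff_matrix_def)
        then show ?thesis using 3(1) by (intro UnI1 image_eqI[of _ _ "(i, j)"]) simp_all
      qed
    qed blast+
  qed
  then have "num_diff_coeffs f h \<le> card ?U"
    unfolding num_diff_coeffs_def using finE by (intro card_mono) auto
  also have "\<dots> \<le> card ((\<lambda>(i, j). unit_mon i + unit_mon j) ` ?E) +
      (card ((\<lambda>i. unit_mon i + unit_mon i) ` {..<n}) + (card (unit_mon ` {..<n}) + card {0 :: nat \<Rightarrow>\<^sub>0 nat}))"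
    by (meson add_left_mono card_Un_le le_trans)
  also have "\<dots> \<le> card ?E + (card {..<n} + (card {..<n} + 1))"
    using finE by (intro add_mono card_image_le) auto
  finally have "real (num_diff_coeffs f h) \<le> real (card ?E + (card {..<n} + (card {..<n} + 1)))"
    by (rule of_nat_mono)
  then have "real (num_diff_coeffs f h) \<le> \<epsilon> * (real n)\<^sup>2 + 2 * real n + 1" using diff by simp
  then show ?thesis using h rank by blast
qed

lemma max_point_prob_le:
  assumes "\<And>x. measure_pmf.prob (rademacher_seq n) {\<xi>. mpoly_eval f \<xi> = x} \<le> c"
  shows "max_point_prob n f \<le> c"
  unfolding max_point_prob_def by (rule cSUP_least) (use assms in auto)

text \<open>Only the finitely many patterns over a finite \<open>S\<close> are constrained, which a
  generic additive map to the reals can satisfy.\<close>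

definition nonsingularity_preserving :: "'a::field set \<Rightarrow> nat \<Rightarrow> ('a \<Rightarrow> real) \<Rightarrow> bool" where
  "nonsingularity_preserving S r lam \<longleftrightarrow> (\<forall>P\<in>patterns S r. Determinant.det (mat r r (\<lambda>(a, b). P a b)) \<noteq> 0 \<longrightarrow>
    Determinant.det (mat r r (\<lambda>(a, b). lam (P a b))) \<noteq> 0)"

text \<open>The blocks are found over the original field and transported by \<open>lam\<close>,
  which keeps \<open>P\<close> nonsingular. Finiteness of the pattern set gives one
  \<open>\<kappa>\<close> and one \<open>\<sigma>\<close> for all patterns. Point probabilities can
  only increase under \<open>lam\<close>, since \<open>f = x\<close> implies
  \<open>lam f = lam x\<close>.\<close>

lemma point_prob_le_rate:
  fixes S :: "'a::field_char_0 set" and \<epsilon> :: real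
  assumes r: "r \<ge> 3" and \<epsilon>: "\<epsilon> > 0" and S: "finite S"
    and lam: "\<And>x y. lam (x + y) = lam x + lam y" and pres: "nonsingularity_preserving S r lam"
  shows "\<exists>C>0. \<exists>n0\<ge>2. \<forall>n\<ge>n0. \<forall>f\<in>quadratic_polys n. deg2_coeffs n f \<subseteq> S \<longrightarrow>
    \<not> near_low_rank (coeff_matrix f) n (r - 1) \<epsilon> \<longrightarrow> max_point_prob n f \<le> C * rate r n"
proof -
  define Pats where "Pats = {P \<in> patterns S r. Determinant.det (mat r r (\<lambda>(a, b). P a b)) \<noteq> 0}"
  have finP: "finite Pats" unfolding Pats_def using S by (auto intro!: finite_PiE)
  have "\<exists>\<kappa>. inverse_bound r (\<lambda>a b. lam (P a b)) \<kappa>" if "P \<in> Pats" for P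
    using pres that by (intro inverse_bound_exists) (auto simp: Pats_def nonsingularity_preserving_def)
  then obtain k where k: "\<And>P. P \<in> Pats \<Longrightarrow> inverse_bound r (\<lambda>a b. lam (P a b)) (k P)" by metis
  define \<kappa> where "\<kappa> = (\<Sum>P\<in>Pats. k P)"
  define \<sigma> where "\<sigma> = (\<Sum>s\<in>S. \<bar>lam s\<bar>)"
  have k0: "k P \<ge> 0" if "P \<in> Pats" for P using k[OF that] by (simp add: inverse_bound_def)
  have \<kappa>: "\<kappa> \<ge> 0" and \<sigma>: "\<sigma> \<ge> 0" using k0 by (auto simp: \<kappa>_def \<sigma>_def intro!: sum_nonneg)
  have inv: "inverse_bound r (\<lambda>a b. lam (P a b)) \<kappa>" if "P \<in> Pats" for P
    unfolding \<kappa>_def using that k0 finP by (intro inverse_bound_mono[OF k[OF that]] member_le_sum) auto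
  have bound\<sigma>: "\<bar>lam s\<bar> \<le> \<sigma>" if "s \<in> S" for s
    unfolding \<sigma>_def using that S by (intro member_le_sum) auto
  obtain c n0 where c: "c > 0" and blocks: "\<And>n A. n \<ge> n0 \<Longrightarrow> symm_valued S n A \<Longrightarrow>
    \<not> near_low_rank A n (r - 1) \<epsilon> \<Longrightarrow>
    (\<exists>I\<subseteq>{..<n}. \<exists>P\<in>patterns S r. \<exists>\<T> K q. Determinant.det (mat r r (\<lambda>(a, b). P a b)) \<noteq> 0 \<and>
      block_structure A r I ({..<n} - I) P \<T> K q \<and> real (card \<T>) \<ge> c * real n \<and> real q \<ge> c * real n)"
    using block_structure_exists[OF S _ \<epsilon>, of r] r by (metis (no_types, lifting) not_numeral_le_zero not_gr_zero)
  obtain C where C: "C > 0" and level: "\<forall>n\<ge>2. \<forall>I A P \<T> K q X u v x. I \<subseteq> {..<n} \<longrightarrow>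
    block_structure A r I ({..<n} - I) P \<T> K q \<longrightarrow> c * real n \<le> real (card \<T>) \<longrightarrow> c * real n \<le> real q \<longrightarrow>
    inverse_bound r P \<kappa> \<longrightarrow> (\<forall>a<r. \<forall>b<r. \<bar>P a b\<bar> \<le> \<sigma>) \<longrightarrow>
    (\<forall>V W. V \<subseteq> I \<longrightarrow> W \<subseteq> {..<n} - I \<longrightarrow> X (V \<union> W) = u V + v W +
      (\<Sum>i\<in>I. \<Sum>j\<in>{..<n} - I. A i j * sgn_in V i * sgn_in W j)) \<longrightarrow>
    real (card {V \<in> Pow {..<n}. X V = x}) / 2 ^ n \<le> C * rate r n"
    using level_set_le_rate[OF r c \<kappa> \<sigma>] by (elim exE conjE) (rule that)
  have "max_point_prob n f \<le> C * rate r n"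
    if n: "n \<ge> max n0 2" and f: "f \<in> quadratic_polys n" and coeffs: "deg2_coeffs n f \<subseteq> S"
      and far: "\<not> near_low_rank (coeff_matrix f) n (r - 1) \<epsilon>" for n f
  proof (rule max_point_prob_le)
    fix x
    have n2: "n \<ge> n0" "n \<ge> 2" using n by auto
    obtain I P \<T> K q where I: "I \<subseteq> {..<n}" and P: "P \<in> patterns S r"
      and det: "Determinant.det (mat r r (\<lambda>(a, b). P a b)) \<noteq> 0"
      and bs: "block_structure (coeff_matrix f) r I ({..<n} - I) P \<T> K q"
      and c\<T>: "c * real n \<le> real (card \<T>)" and cq: "c * real n \<le> real q"
      using blocks[OF n2(1) symm_valued_coeff_matrix[OF coeffs] far] by blast
    define A where "A i j = lam (coeff_matrix f i j)" for i j
    define X where "X V = lam (mpoly_eval f (sign_vector n V))" for V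
    have bs': "block_structure A r I ({..<n} - I) (\<lambda>a b. lam (P a b)) \<T> K q"
      using bs by (simp add: block_structure_def A_def)
    have "P \<in> Pats" using P det by (simp add: Pats_def)
    note inv = inv[OF this]
    have P\<sigma>: "\<forall>a<r. \<forall>b<r. \<bar>lam (P a b)\<bar> \<le> \<sigma>" using P by (auto simp: PiE_iff intro!: bound\<sigma>)
    have "X V = lam (coeff_of f 0) + (\<Sum>i<n. lam (coeff_of f (unit_mon i)) * sgn_in V i) +
        (\<Sum>(i, j)\<in>{(i, j). i \<le> j \<and> j < n}. A i j * (sgn_in V i * sgn_in V j))" for V
      unfolding X_def A_def coeff_matrix_def by (rule additive_eval_sign_vector[OF f lam])
    from quadratic_split[OF _ I this]
    obtain u v where uv: "\<forall>V W. V \<subseteq> I \<longrightarrow> W \<subseteq> {..<n} - I \<longrightarrow> X (V \<union> W) = u V + v W +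
        (\<Sum>i\<in>I. \<Sum>j\<in>{..<n} - I. A i j * sgn_in V i * sgn_in W j)"
      by (auto simp: A_def coeff_matrix_def add.commute)
    have "measure_pmf.prob (rademacher_seq n) {\<xi>. mpoly_eval f \<xi> = x} =
        real (card {V \<in> Pow {..<n}. mpoly_eval f (sign_vector n V) = x}) / 2 ^ n"
      by (rule prob_rademacher_seq)
    also have "\<dots> \<le> real (card {V \<in> Pow {..<n}. X V = lam x}) / 2 ^ n"
      by (intro divide_right_mono of_nat_mono card_mono) (auto simp: X_def)
    also have "\<dots> \<le> C * rate r n"
      by (intro level[rule_format, OF n2(2) I bs' c\<T> cq inv P\<sigma>[rule_format] uv[rule_format]])
    finally show "measure_pmf.prob (rademacher_seq n) {\<xi>. mpoly_eval f \<xi> = x} \<le> C * rate r n" .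
  qed
  then show ?thesis using C by (intro exI[of _ C] conjI exI[of _ "max n0 2"] allI ballI impI) auto
qed

text \<open>A crude bound, used for the positivity of the rate and to exclude the finitely many
  small \<open>n\<close>.\<close>

lemma rate_lower_bound:
  assumes "n \<ge> 2"
  shows "rate r n \<ge> (1 / 2) powr (real r / 2) / real n"
proof -
  have "(1 / 2) powr (real r / 2) \<le> ln (real n) powr (real r / 2)"
    using ln_ge_half[OF assms] by (intro powr_mono2) auto
  moreover have "real n powr (1 - 2 / (real r + 2)) \<le> real n powr 1" using assms by (intro powr_mono) auto
  ultimately show ?thesis unfolding rate_def using assms by (intro frac_le) auto
qed

text \<open>Closeness is sought with \<open>\<epsilon> / 2\<close>, which leaves room for the
  diagonal and lower-order coefficients. For large \<open>n\<close> the constant exceeds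
  \<open>C1\<close>, so being far from low rank contradicts the bound on point probabilities; for
  small \<open>n\<close> it makes the hypothesis demand a probability of at least 2.\<close>

lemma inverse_theorem:
  fixes S :: "'a::field_char_0 set" and \<epsilon> :: real
  assumes r: "r \<ge> 3" and \<epsilon>: "\<epsilon> > 0" and S: "finite S"
    and lam: "\<And>x y. lam (x + y) = lam x + lam y" and pres: "nonsingularity_preserving S r lam"
  shows "\<exists>C :: real. \<forall>n \<ge> 2. \<forall>f \<in> quadratic_polys n.
          deg2_coeffs n f \<subseteq> S \<longrightarrow>
          max_point_prob n f
            \<ge> C * (ln (real n) powr (real r / 2) / real n powr (1 - 2 / (real r + 2))) \<longrightarrow>
          (\<exists>h \<in> quadratic_forms n. form_rank n h < r \<and>
             real (num_diff_coeffs f h) \<le> \<epsilon> * (real n)\<^sup>2)"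
proof -
  obtain C1 n0 where C1: "C1 > 0" and n0: "n0 \<ge> 2" and main: "\<And>n f. n \<ge> n0 \<Longrightarrow> f \<in> quadratic_polys n \<Longrightarrow>
    deg2_coeffs n f \<subseteq> S \<Longrightarrow> \<not> near_low_rank (coeff_matrix f) n (r - 1) (\<epsilon> / 2) \<Longrightarrow> max_point_prob n f \<le> C1 * rate r n"
    using point_prob_le_rate[OF r half_gt_zero[OF \<epsilon>] S lam pres] by metis
  \<comment> \<open>For \<open>n \<ge> 6 / \<epsilon>\<close> one has
    \<open>2 * n + 1 \<le> 3 * n \<le> \<epsilon> / 2 * n^2\<close>.\<close>
  define n1 where "n1 = max n0 (nat \<lceil>6 / \<epsilon>\<rceil>)"
  define \<rho> where "\<rho> = (1 / 2) powr (real r / 2) / real n1"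
  \<comment> \<open>The rate is at least \<open>\<rho>\<close> for \<open>2 \<le> n < n1\<close>, so
    the summand \<open>2 / \<rho>\<close> pushes the required probability to 2 there; being
    positive, it also makes \<open>C\<close> strictly larger than \<open>C1\<close>.\<close>
  define C where "C = C1 + 2 / \<rho>"
  have n1: "n1 \<ge> 2" using n0 by (simp add: n1_def)
  then have \<rho>: "\<rho> > 0" by (simp add: \<rho>_def)
  have "\<exists>h \<in> quadratic_forms n. form_rank n h < r \<and> real (num_diff_coeffs f h) \<le> \<epsilon> * (real n)\<^sup>2"
    if n: "n \<ge> 2" and f: "f \<in> quadratic_polys n" and coeffs: "deg2_coeffs n f \<subseteq> S"
      and large: "max_point_prob n f \<ge> C * rate r n" for n f
  proof -
    have "(1 / 2) powr (real r / 2) / real n > 0" using n by simp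
    then have rate: "rate r n > 0" using rate_lower_bound[OF n, of r] by linarith
    have "n \<ge> n1"
    proof (rule ccontr)
      assume "\<not> n \<ge> n1"
      then have "\<rho> \<le> (1 / 2) powr (real r / 2) / real n" unfolding \<rho>_def using n by (intro divide_left_mono) auto
      then have "\<rho> \<le> rate r n" using rate_lower_bound[OF n, of r] by linarith
      then have "2 / \<rho> * \<rho> \<le> C * rate r n" unfolding C_def using C1 \<rho> by (intro mult_mono) auto
      then have "2 \<le> C * rate r n" using \<rho> by simp
      moreover have "max_point_prob n f \<le> 1" by (rule max_point_prob_le) (rule measure_pmf.prob_le_1)
      ultimately show False using large by linarith
    qed
    have "near_low_rank (coeff_matrix f) n (r - 1) (\<epsilon> / 2)"
    proof (rule ccontr)
      assume "\<not> near_low_rank (coeff_matrix f) n (r - 1) (\<epsilon> / 2)"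
      then have "max_point_prob n f \<le> C1 * rate r n" using \<open>n \<ge> n1\<close> by (intro main f coeffs) (auto simp: n1_def)
      moreover have "C1 * rate r n < C * rate r n"
        using rate \<rho> by (intro mult_strict_right_mono) (auto simp: C_def)
      ultimately show False using large by linarith
    qed
    from quadratic_form_if_near_low_rank[OF f this]
    obtain h where h: "h \<in> quadratic_forms n" "form_rank n h \<le> r - 1"
      and diff: "real (num_diff_coeffs f h) \<le> \<epsilon> / 2 * (real n)\<^sup>2 + 2 * real n + 1" by blast
    have "6 / \<epsilon> \<le> real n" using \<open>n \<ge> n1\<close> unfolding n1_def by linarith
    then have "6 \<le> \<epsilon> * real n" using \<epsilon> by (simp add: field_simps)
    then have "6 * real n \<le> \<epsilon> * (real n)\<^sup>2" using mult_right_mono[of 6 "\<epsilon> * real n" "real n"] by (simp add: power2_eq_square)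
    then have "real (num_diff_coeffs f h) \<le> \<epsilon> * (real n)\<^sup>2" using diff n by linarith
    then show ?thesis using h r by (intro bexI[of _ h]) auto
  qed
  then show ?thesis unfolding rate_def by (intro exI[of _ C] allI ballI impI)
qed

lemma nonsingularity_preserving_id: "nonsingularity_preserving S r (\<lambda>x :: real. x)"
  by (simp add: nonsingularity_preserving_def)

lemma nonsingularity_preserving_of_rat: "nonsingularity_preserving S r (of_rat :: rat \<Rightarrow> real)"
proof -
  have "Determinant.det (mat r r (\<lambda>(a, b). of_rat (P a b))) =
      (of_rat (Determinant.det (mat r r (\<lambda>(a, b). P a b))) :: real)" for P :: "nat \<Rightarrow> nat \<Rightarrow> rat"
  proof -
    have "mat r r (\<lambda>(a, b). of_rat (P a b)) = (map_mat of_rat (mat r r (\<lambda>(a, b). P a b)) :: real mat)"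
      by (rule eq_matI) auto
    then show ?thesis by (simp only: of_rat_hom.hom_det)
  qed
  then show ?thesis by (simp add: nonsingularity_preserving_def)
qed

text \<open>
  For a nonsingular complex matrix \<open>P\<close>, the polynomial \<open>t \<mapsto> det (Re P + t Im P)\<close> does not vanish
  at \<open>\<i>\<close>, so it is nonzero and almost every real \<open>t\<close> is good for the finitely many \<open>P\<close>.
\<close>
lemma nonsingularity_preserving_complex:
  fixes S :: "complex set"
  assumes S: "finite S"
  shows "\<exists>y. nonsingularity_preserving S r (\<lambda>z. Re z + y * Im z)"
proof -
  define D where "D P = Determinant.det (mat r r (\<lambda>(a, b). [:complex_of_real (Re (P a b)), complex_of_real (Im (P a b)):]))"
    for P :: "nat \<Rightarrow> nat \<Rightarrow> complex"
  define Pats where "Pats = {P \<in> patterns S r. Determinant.det (mat r r (\<lambda>(a, b). P a b)) \<noteq> 0}"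
  have finP: "finite Pats" unfolding Pats_def using S by (auto intro!: finite_PiE)
  have eval: "poly (D P) t = Determinant.det (mat r r (\<lambda>(a, b). complex_of_real (Re (P a b)) + t * complex_of_real (Im (P a b))))"
    for P t
  proof -
    have "map_mat (\<lambda>p. poly p t) (mat r r (\<lambda>(a, b). [:complex_of_real (Re (P a b)), complex_of_real (Im (P a b)):])) =
        mat r r (\<lambda>(a, b). complex_of_real (Re (P a b)) + t * complex_of_real (Im (P a b)))"
      by (rule eq_matI) auto
    note map_eq = this
    interpret poly_hom: comm_ring_hom "\<lambda>p. poly p t" by unfold_locales auto
    show ?thesis unfolding D_def by (simp only: poly_hom.hom_det[symmetric] map_eq)
  qed
  have "finite {t. poly (D P) t = 0}" if "P \<in> Pats" for P
  proof (rule poly_roots_finite)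
    have eq: "poly (D P) \<i> = Determinant.det (mat r r (\<lambda>(a, b). P a b))"
      unfolding eval by (intro arg_cong[where f = Determinant.det] eq_matI) (auto simp: complex_eq_iff)
    have "Determinant.det (mat r r (\<lambda>(a, b). P a b)) \<noteq> 0" using that by (simp add: Pats_def)
    then have "poly (D P) \<i> \<noteq> 0" unfolding eq .
    then show "D P \<noteq> 0" by (metis poly_0)
  qed
  \<comment> \<open>Avoiding the real parts of all complex roots avoids in particular every real
    root.\<close>
  then have "finite (Re ` (\<Union>P\<in>Pats. {t. poly (D P) t = 0}))" using finP by simp
  then obtain y where y: "y \<notin> Re ` (\<Union>P\<in>Pats. {t. poly (D P) t = 0})"
    using ex_new_if_finite[OF infinite_UNIV_char_0] by blast
  have "Determinant.det (mat r r (\<lambda>(a, b). Re (P a b) + y * Im (P a b))) \<noteq> 0" if P: "P \<in> Pats" for P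
  proof
    assume 0: "Determinant.det (mat r r (\<lambda>(a, b). Re (P a b) + y * Im (P a b))) = 0"
    have "mat r r (\<lambda>(a, b). complex_of_real (Re (P a b)) + complex_of_real y * complex_of_real (Im (P a b))) =
        map_mat complex_of_real (mat r r (\<lambda>(a, b). Re (P a b) + y * Im (P a b)))"
      by (rule eq_matI) auto
    then have "poly (D P) (complex_of_real y) = 0"
      unfolding eval by (simp only: of_real_hom.hom_det 0 of_real_0)
    then have "complex_of_real y \<in> (\<Union>P\<in>Pats. {t. poly (D P) t = 0})" using P by (intro UN_I[of P]) simp_all
    then have "Re (complex_of_real y) \<in> Re ` (\<Union>P\<in>Pats. {t. poly (D P) t = 0})" by (rule imageI)
    then show False using y by simp
  qed
  then show ?thesis by (intro exI[of _ y]) (auto simp: nonsingularity_preserving_def Pats_def)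
qed

theorem theorem1p2:
  fixes r :: nat and \<epsilon> :: real
  assumes "r \<ge> 3" and "0 < \<epsilon>" and "\<epsilon> \<le> 1"
  shows "(\<forall>S :: complex set. finite S \<longrightarrow>
       (\<exists>C :: real. \<forall>n \<ge> 2. \<forall>f \<in> quadratic_polys n.
          deg2_coeffs n f \<subseteq> S \<longrightarrow>
          max_point_prob n f
            \<ge> C * (ln (real n) powr (real r / 2) / real n powr (1 - 2 / (real r + 2))) \<longrightarrow>
          (\<exists>h \<in> quadratic_forms n. form_rank n h < r \<and>
             real (num_diff_coeffs f h) \<le> \<epsilon> * (real n)\<^sup>2))) \<and>
     (\<forall>S :: real set. finite S \<longrightarrow>
       (\<exists>C :: real. \<forall>n \<ge> 2. \<forall>f \<in> quadratic_polys n.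
          deg2_coeffs n f \<subseteq> S \<longrightarrow>
          max_point_prob n f
            \<ge> C * (ln (real n) powr (real r / 2) / real n powr (1 - 2 / (real r + 2))) \<longrightarrow>
          (\<exists>h \<in> quadratic_forms n. form_rank n h < r \<and>
             real (num_diff_coeffs f h) \<le> \<epsilon> * (real n)\<^sup>2))) \<and>
     (\<forall>S :: rat set. finite S \<longrightarrow>
       (\<exists>C :: real. \<forall>n \<ge> 2. \<forall>f \<in> quadratic_polys n.
          deg2_coeffs n f \<subseteq> S \<longrightarrow>
          max_point_prob n f
            \<ge> C * (ln (real n) powr (real r / 2) / real n powr (1 - 2 / (real r + 2))) \<longrightarrow>
          (\<exists>h \<in> quadratic_forms n. form_rank n h < r \<and>
             real (num_diff_coeffs f h) \<le> \<epsilon> * (real n)\<^sup>2)))"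
proof (intro conjI allI impI)
  fix S :: "complex set" assume S: "finite S"
  obtain y where y: "nonsingularity_preserving S r (\<lambda>z. Re z + y * Im z)"
    using nonsingularity_preserving_complex[OF S] by blast
  show "\<exists>C :: real. \<forall>n \<ge> 2. \<forall>f \<in> quadratic_polys n. deg2_coeffs n f \<subseteq> S \<longrightarrow>
      max_point_prob n f \<ge> C * (ln (real n) powr (real r / 2) / real n powr (1 - 2 / (real r + 2))) \<longrightarrow>
      (\<exists>h \<in> quadratic_forms n. form_rank n h < r \<and> real (num_diff_coeffs f h) \<le> \<epsilon> * (real n)\<^sup>2)"
    by (rule inverse_theorem[OF assms(1,2) S _ y]) (simp add: algebra_simps)
next
  fix S :: "real set" assume S: "finite S"
  show "\<exists>C :: real. \<forall>n \<ge> 2. \<forall>f \<in> quadratic_polys n. deg2_coeffs n f \<subseteq> S \<longrightarrow>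
      max_point_prob n f \<ge> C * (ln (real n) powr (real r / 2) / real n powr (1 - 2 / (real r + 2))) \<longrightarrow>
      (\<exists>h \<in> quadratic_forms n. form_rank n h < r \<and> real (num_diff_coeffs f h) \<le> \<epsilon> * (real n)\<^sup>2)"
    by (rule inverse_theorem[OF assms(1,2) S _ nonsingularity_preserving_id]) simp
next
  fix S :: "rat set" assume S: "finite S"
  show "\<exists>C :: real. \<forall>n \<ge> 2. \<forall>f \<in> quadratic_polys n. deg2_coeffs n f \<subseteq> S \<longrightarrow>
      max_point_prob n f \<ge> C * (ln (real n) powr (real r / 2) / real n powr (1 - 2 / (real r + 2))) \<longrightarrow>
      (\<exists>h \<in> quadratic_forms n. form_rank n h < r \<and> real (num_diff_coeffs f h) \<le> \<epsilon> * (real n)\<^sup>2)"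
    by (rule inverse_theorem[OF assms(1,2) S _ nonsingularity_preserving_of_rat]) (simp add: of_rat_add)
qed

end
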